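(* Let $B=(B_t)_{t\ge 0}$ be a standard one-dimensional Brownian motion with $B_0=0$, let $L_s^y$ denote its local time at level $y$ up to time $s$, and let $\alpha'_t(x)$ denote the derivative of the self-intersection local time of $B$. Then there is a set of probability one on which, for all $x\in\mathbb{R}$ and all $t\ge 0$, $$\frac{1}{2}\,\alpha'_t(x)+\frac{1}{2}\,\mathrm{sgn}(x)\,t=\int_0^t L_s^{B_s-x}\,dB_s-\frac{1}{2}\int_0^t \mathrm{sgn}(B_t-B_u-x)\,du .$$
   Context: The sign function is $\mathrm{sgn}(x)=-1$ if $x<0$, $\mathrm{sgn}(0)=0$, and $\mathrm{sgn}(x)=1$ if $x>0$. The local time $L_s^y$ is the jointly continuous (in $(s,y)$) occupation density of $B$ with respect to Lebesgue measure: $\int_0^s g(B_u)\,du=\int_{\mathbb{R}} g(y)L_s^y\,dy$ for all bounded Borel $g$ and all $s\ge 0$. $L_s^{B_s-x}$ means $L_s^y$ evaluated at the random level $y=B_s-x$. The derivative of self-intersection local time is the process $\alpha'_t(y)$, $t\ge 0$, $y\in\mathbb{R}$, formally given by $\alpha'_t(y)=-\int_0^t\int_0^s\delta'(B_s-B_r-y)\,dr\,ds$ ($\delta$ the Dirac delta). Its existence is a known result of J. Rosen. Rigorously, it is the process such that, almost surely, for all $t\ge 0$ and every $C^1$ function $g:\mathbb{R}\to\mathbb{R}$, $$\int_0^t\int_0^s g'(B_s-B_r)\,dr\,ds=-\int_{\mathbb{R}} g(y)\,\alpha'_t(y)\,dy ,$$ taken in the version for which $(t,y)\mapsto\alpha'_t(y)+t\,\mathrm{sgn}(y)$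 is continuous (so $\alpha'_t(y)$ is continuous in $y$ for $y\ne 0$, and its value at $y=0$ is determined by this continuity). The stochastic integral $\int_0^t L_s^{B_s-x}\,dB_s$ is an Itô integral in the Brownian filtration for each fixed $x$ and $t$. As a process in $(x,t)$ it is taken in its jointly continuous version. *)

theory Defs
  imports "HOL-Probability.Probability"
begin

locale brownian_motion = prob_space M for M :: "'a measure" +
  fixes B :: "real \<Rightarrow> 'a \<Rightarrow> real"
  assumes measurable_B: "\<And>t. 0 \<le> t \<Longrightarrow> B t \<in> borel_measurable M"
    and start_zero: "AE \<omega> in M. B 0 \<omega> = 0"
    and gaussian_increments: "\<And>s t. 0 \<le> s \<Longrightarrow> s < t \<Longrightarrow>
      distributed M lborel (\<lambda>\<omega>. B t \<omega> - B s \<omega>) (normal_density 0 (sqrt (t - s)))"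
    and indep_increments: "\<And>(n::nat) \<tau>. 0 \<le> \<tau> 0 \<Longrightarrow> (\<And>i. i < n \<Longrightarrow> \<tau> i \<le> \<tau> (Suc i)) \<Longrightarrow>
      indep_vars (\<lambda>_. borel) (\<lambda>i \<omega>. B (\<tau> (Suc i)) \<omega> - B (\<tau> i) \<omega>) {..<n}"
    and continuous_paths: "AE \<omega> in M. continuous_on {0..} (\<lambda>t. B t \<omega>)"

definition local_time :: "'a measure \<Rightarrow> (real \<Rightarrow> 'a \<Rightarrow> real) \<Rightarrow> (real \<Rightarrow> real \<Rightarrow> 'a \<Rightarrow> real) \<Rightarrow> bool" where
  "local_time M B L \<longleftrightarrow>
    (\<forall>s\<ge>0. \<forall>y. L s y \<in> borel_measurable M) \<and>
    (AE \<omega> in M.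
      continuous_on ({0..} \<times> UNIV) (\<lambda>(s, y). L s y \<omega>) \<and>
      (\<forall>g \<in> borel_measurable borel. bounded (range g) \<longrightarrow>
        (\<forall>s\<ge>0. integrable lborel (\<lambda>y. g y * L s y \<omega>) \<and>
          (LBINT u:{0..s}. g (B u \<omega>)) = (LBINT y. g y * L s y \<omega>))))"

definition self_intersection_local_time_deriv ::
    "'a measure \<Rightarrow> (real \<Rightarrow> 'a \<Rightarrow> real) \<Rightarrow> (real \<Rightarrow> real \<Rightarrow> 'a \<Rightarrow> real) \<Rightarrow> bool" where
  "self_intersection_local_time_deriv M B \<alpha> \<longleftrightarrow>
    (\<forall>t\<ge>0. \<forall>y. \<alpha> t y \<in> borel_measurable M) \<and>
    (AE \<omega> in M.
      continuous_on ({0..} \<times> UNIV) (\<lambda>(t, y). \<alpha> t y \<omega> + t * sgn y) \<and>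
      (\<forall>t\<ge>0. \<forall>g g'. (\<forall>y. (g has_real_derivative g' y) (at y)) \<and> continuous_on UNIV g' \<longrightarrow>
        integrable lborel (\<lambda>y. g y * \<alpha> t y \<omega>) \<and>
        (LBINT s:{0..t}. (LBINT r:{0..s}. g' (B s \<omega> - B r \<omega>))) = - (LBINT y. g y * \<alpha> t y \<omega>)))"

text \<open>The natural filtration of \<open>B\<close>, augmented by the null sets of \<open>M\<close>.\<close>

definition brownian_filtration :: "'a measure \<Rightarrow> (real \<Rightarrow> 'a \<Rightarrow> real) \<Rightarrow> real \<Rightarrow> 'a measure" where
  "brownian_filtration M B t = sigma (space M)
    ({B s -` A \<inter> space M | s A. 0 \<le> s \<and> s \<le> t \<and> A \<in> sets borel} \<union> null_sets M)"

text \<open>Simple integrands \<open>\<Sum>i<n. \<xi> i * indicator {\<tau> i<..\<tau> (Suc i)}\<close>, represented by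
  the number \<open>n\<close> of steps, the deterministic times \<open>\<tau>\<close> and the heights \<open>\<xi>\<close>.\<close>

definition simple_integrand ::
    "'a measure \<Rightarrow> (real \<Rightarrow> 'a \<Rightarrow> real) \<Rightarrow> nat \<Rightarrow> (nat \<Rightarrow> real) \<Rightarrow> (nat \<Rightarrow> 'a \<Rightarrow> real) \<Rightarrow> bool" where
  "simple_integrand M B n \<tau> \<xi> \<longleftrightarrow>
    0 \<le> \<tau> 0 \<and> (\<forall>i<n. \<tau> i \<le> \<tau> (Suc i)) \<and>
    (\<forall>i<n. \<xi> i \<in> borel_measurable (brownian_filtration M B (\<tau> i)) \<and> bounded (\<xi> i ` space M))"

definition simple_process :: "nat \<Rightarrow> (nat \<Rightarrow> real) \<Rightarrow> (nat \<Rightarrow> 'a \<Rightarrow> real) \<Rightarrow> real \<Rightarrow> 'a \<Rightarrow> real" where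
  "simple_process n \<tau> \<xi> s \<omega> = (\<Sum>i<n. \<xi> i \<omega> * indicator {\<tau> i<..\<tau> (Suc i)} s)"

definition simple_integral ::
    "(real \<Rightarrow> 'a \<Rightarrow> real) \<Rightarrow> nat \<Rightarrow> (nat \<Rightarrow> real) \<Rightarrow> (nat \<Rightarrow> 'a \<Rightarrow> real) \<Rightarrow> real \<Rightarrow> 'a \<Rightarrow> real" where
  "simple_integral B n \<tau> \<xi> t \<omega> =
    (\<Sum>i<n. \<xi> i \<omega> * (B (min t (\<tau> (Suc i))) \<omega> - B (min t (\<tau> i)) \<omega>))"

text \<open>The completion is used because a path integral of a process whose paths are only almost
  surely regular need not be measurable with respect to \<open>M\<close> itself.\<close>

definition tendsto_zero_in_prob :: "'a measure \<Rightarrow> (nat \<Rightarrow> 'a \<Rightarrow> ennreal) \<Rightarrow> bool" where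
  "tendsto_zero_in_prob M D \<longleftrightarrow>
    (\<forall>k. D k \<in> borel_measurable (completion M)) \<and>
    (\<forall>e>0. (\<lambda>k. emeasure (completion M) {\<omega> \<in> space M. e < D k \<omega>}) \<longlonglongrightarrow> 0)"

text \<open>\<open>ito_integral M B H t J\<close>: the random variable \<open>J\<close> is (a version of) the integral of \<open>H\<close>
  against \<open>B\<close> over \<open>[0, t]\<close>, that is, the limit in probability of the integrals of simple
  integrands \<open>H\<^sub>k\<close> for which the integral of \<open>(H\<^sub>k - H)\<^sup>2\<close> over \<open>[0, t]\<close> tends to \<open>0\<close> in probability.
  Such \<open>H\<^sub>k\<close> exist precisely when \<open>H\<close> is, up to a modification on a null set of
  \<open>[0, t] \<times> space M\<close>, progressively measurable with almost surely square integrable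
  paths on \<open>[0, t]\<close>, and \<open>J\<close> is determined up to almost sure equality.  The distance of \<open>H\<^sub>k\<close>
  to \<open>H\<close> is a nonnegative integral, so that it is infinite when \<open>H\<close> is not square integrable.\<close>

definition ito_integral ::
    "'a measure \<Rightarrow> (real \<Rightarrow> 'a \<Rightarrow> real) \<Rightarrow> (real \<Rightarrow> 'a \<Rightarrow> real) \<Rightarrow> real \<Rightarrow> ('a \<Rightarrow> real) \<Rightarrow> bool" where
  "ito_integral M B H t J \<longleftrightarrow>
    J \<in> borel_measurable M \<and>
    (AE \<omega> in M. set_borel_measurable lborel {0..t} (\<lambda>s. H s \<omega>)) \<and>
    (\<exists>n \<tau> \<xi>.
      (\<forall>k::nat. simple_integrand M B (n k) (\<tau> k) (\<xi> k)) \<and>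
      tendsto_zero_in_prob M (\<lambda>k \<omega>.
        \<integral>\<^sup>+s\<in>{0..t}. ennreal ((simple_process (n k) (\<tau> k) (\<xi> k) s \<omega> - H s \<omega>)\<^sup>2) \<partial>lborel) \<and>
      tendsto_zero_in_prob M (\<lambda>k \<omega>. ennreal \<bar>simple_integral B (n k) (\<tau> k) (\<xi> k) t \<omega> - J \<omega>\<bar>))"

end

theory Submission imports Defs begin

text \<open>
  Integrate both sides against a \<open>C\<^sup>1\<close> bump \<open>g\<close> in the variable \<open>x\<close>, and let \<open>G\<close> be an antiderivative
  of \<open>g\<close>.  By the occupation formula the stochastic integral becomes the Ito integral of the process
  \<open>h s\<close> given by the integral of \<open>g (B s - B u)\<close> over \<open>u \<le> s\<close>.  Summing Ito's formula for
  \<open>G (B t - B u)\<close> over \<open>u\<close> evaluates it as the integral of \<open>G (B t - B u) - G 0\<close> over \<open>u \<le> t\<close> minus half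
  the double integral of \<open>g' (B s - B u)\<close>; the former is half the integral of \<open>g\<close> against the two sign
  terms, the latter is by definition minus the integral of \<open>g\<close> against \<open>\<alpha>'\<close>.  Both sides being continuous
  in \<open>(t, x)\<close>, countably many bumps and times suffice.

  Only discrete approximations are needed: \<open>h\<close> is replaced by averages over a grid, for which Ito's
  formula is a Taylor expansion with a quadratic variation estimate, and elementary integrals are
  compared through the \<open>L\<^sup>2\<close> isometry after stopping.
\<close>

section \<open>The past is independent of future increments\<close>

text \<open>Testing in \<open>x\<close> is forced from both sides: \<alpha>' is characterised only
  by its integrals against \<open>C^1\<close> functions, and the integrand
  \<open>L s (B s - x)\<close> is merely continuous in \<open>x\<close>, so no Ito formula yields it
  directly. The definition of the integral offers, for each single \<open>x\<close>, simple
  approximations in probability, with no regularity in \<open>x\<close> and no moments. Hence the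
  \<open>x\<close> integral is replaced by sums over finitely many levels, with summable tolerances
  that hold eventually almost surely by Borel-Cantelli, and norms are controlled by stopping. The
  term \<open>sgn x * t\<close> comes from \<open>G 0\<close>: for \<open>g\<close> supported in
  \<open>{c..d}\<close> the integral of \<open>g x * sgn (y - x)\<close> is
  \<open>2 * G y - G c - G d\<close>, so \<open>G y - G 0\<close> is half the integral of
  \<open>g x * (sgn (y - x) + sgn x)\<close>. It is also exactly the term that makes \<alpha>'
  continuous across \<open>x = 0\<close>, which allows the passage from test integrals to every
  \<open>x\<close>.\<close>

context brownian_motion begin

abbreviation "\<F> \<equiv> brownian_filtration M B"

lemma filtration_generator_subset:
  "{B s -` A \<inter> space M | s A. 0 \<le> s \<and> s \<le> t \<and> A \<in> sets borel} \<union> null_sets M \<subseteq> events"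
  using measurable_B by (auto intro: measurable_sets)

lemma space_filtration [simp]: "space (\<F> t) = space M"
  by (simp add: brownian_filtration_def space_measure_of_conv)

lemma sets_filtration:
  "sets (\<F> t) = sigma_sets (space M)
    ({B s -` A \<inter> space M | s A. 0 \<le> s \<and> s \<le> t \<and> A \<in> sets borel} \<union> null_sets M)"
  unfolding brownian_filtration_def
  by (rule sets_measure_of) (use filtration_generator_subset[of t] sets.sets_into_space in blast)

lemma sets_filtration_subset: "sets (\<F> t) \<subseteq> events"
  unfolding sets_filtration by (rule sets.sigma_sets_subset[OF filtration_generator_subset])

lemma filtration_mono: "s \<le> t \<Longrightarrow> sets (\<F> s) \<subseteq> sets (\<F> t)"
  unfolding sets_filtration by (rule sigma_sets_mono') fastforce

lemma measurable_filtration_mono: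
  "f \<in> borel_measurable (\<F> s) \<Longrightarrow> s \<le> t \<Longrightarrow> f \<in> borel_measurable (\<F> t)"
  using filtration_mono[of s t] by (auto simp: measurable_def)

lemma measurable_filtration_M: "f \<in> borel_measurable (\<F> s) \<Longrightarrow> f \<in> borel_measurable M"
  using sets_filtration_subset[of s] by (auto simp: measurable_def)

lemma measurable_B_filtration: "0 \<le> s \<Longrightarrow> s \<le> t \<Longrightarrow> B s \<in> borel_measurable (\<F> t)"
  unfolding measurable_def by (auto simp: sets_filtration intro!: sigma_sets.Basic)

text \<open>The increments are taken relative to \<open>B 0\<close>, and events are compared almost surely, so that
  both the null sets and the value of \<open>B 0\<close> are absorbed.\<close>

definition past_cylinders :: "real \<Rightarrow> 'a set set" where
  "past_cylinders s = {A \<in> events. \<exists>J V. finite J \<and> J \<subseteq> {0..s} \<and> (\<forall>r\<in>J. V r \<in> sets borel) \<and>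
     (AE \<omega> in M. \<omega> \<in> A \<longleftrightarrow> (\<forall>r\<in>J. B r \<omega> - B 0 \<omega> \<in> V r))}"

text \<open>Outside its own index set a cylinder imposes no condition, so \<open>UNIV\<close> serves
  there and two cylinders meet in one over the union of the index sets. The pi-system property is
  what carries independence over to the generated sigma-algebra.\<close>

lemma Int_stable_past_cylinders: "Int_stable (past_cylinders s)"
proof (rule Int_stableI)
  fix A A' assume A: "A \<in> past_cylinders s" and A': "A' \<in> past_cylinders s"
  obtain J V where J: "finite J" "J \<subseteq> {0..s}" "\<And>r. r \<in> J \<Longrightarrow> V r \<in> sets borel"
    and V: "AE \<omega> in M. \<omega> \<in> A \<longleftrightarrow> (\<forall>r\<in>J. B r \<omega> - B 0 \<omega> \<in> V r)"
    using A unfolding past_cylinders_def by blast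
  obtain J' V' where J': "finite J'" "J' \<subseteq> {0..s}" "\<And>r. r \<in> J' \<Longrightarrow> V' r \<in> sets borel"
    and V': "AE \<omega> in M. \<omega> \<in> A' \<longleftrightarrow> (\<forall>r\<in>J'. B r \<omega> - B 0 \<omega> \<in> V' r)"
    using A' unfolding past_cylinders_def by blast
  define W where "W r = (if r \<in> J then V r else UNIV) \<inter> (if r \<in> J' then V' r else UNIV)" for r
  have "AE \<omega> in M. \<omega> \<in> A \<inter> A' \<longleftrightarrow> (\<forall>r\<in>J \<union> J'. B r \<omega> - B 0 \<omega> \<in> W r)"
    using V V' by eventually_elim (auto simp: W_def split: if_splits)
  then show "A \<inter> A' \<in> past_cylinders s"
    using A A' J J' unfolding past_cylinders_def mem_Collect_eq
    by (intro conjI exI[of _ "J \<union> J'"] exI[of _ W]) (auto simp: W_def)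
qed

text \<open>\<open>B 0 = 0\<close> almost surely, so \<open>B r\<close> may be replaced by
  \<open>B r - B 0\<close>; a null set is the cylinder with the impossible condition that
  \<open>B 0 - B 0\<close> lie in the empty set.\<close>

lemma filtration_generator_cylinders:
  assumes "0 \<le> s"
  shows "{B r -` A \<inter> space M | r A. 0 \<le> r \<and> r \<le> s \<and> A \<in> sets borel} \<union> null_sets M
    \<subseteq> past_cylinders s"
proof
  fix E assume E: "E \<in> {B r -` A \<inter> space M | r A. 0 \<le> r \<and> r \<le> s \<and> A \<in> sets borel} \<union> null_sets M"
  then have ev: "E \<in> events" using filtration_generator_subset[of s] by blast
  consider r A where "E = B r -` A \<inter> space M" "0 \<le> r" "r \<le> s" "A \<in> sets borel"
    | "E \<in> null_sets M" using E by auto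
  then show "E \<in> past_cylinders s"
  proof cases
    case 1
    have "AE \<omega> in M. \<omega> \<in> E \<longleftrightarrow> (\<forall>r\<in>{r}. B r \<omega> - B 0 \<omega> \<in> A)"
      using start_zero AE_space by eventually_elim (auto simp: 1)
    then show ?thesis using 1 ev unfolding past_cylinders_def mem_Collect_eq
      by (intro conjI exI[of _ "{r}"] exI[of _ "\<lambda>_. A"]) auto
  next
    case 2
    have "AE \<omega> in M. \<omega> \<in> E \<longleftrightarrow> (\<forall>r\<in>{0}. B r \<omega> - B 0 \<omega> \<in> {})"
      using AE_not_in[OF 2] by eventually_elim auto
    then show ?thesis using assms ev unfolding past_cylinders_def mem_Collect_eq
      by (intro conjI exI[of _ "{0}"] exI[of _ "\<lambda>_. {}"]) auto
  qed
qed

text \<open>Sort the finitely many times into a partition from 0 to \<open>s\<close> and append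
  \<open>u\<close>. Each \<open>B r - B 0\<close> is a partial sum of the earlier increments, so the
  cylinder is, up to a null set, a function of them, while the increment from \<open>s\<close> to
  \<open>u\<close> is the last, independent one.\<close>

lemma past_cylinder_indep_increment:
  assumes "0 \<le> s" "s < u" and A: "A \<in> past_cylinders s" and C: "C \<in> sets borel"
  shows "prob (A \<inter> ((\<lambda>\<omega>. B u \<omega> - B s \<omega>) -` C \<inter> space M)) =
    prob A * prob ((\<lambda>\<omega>. B u \<omega> - B s \<omega>) -` C \<inter> space M)"
proof -
  obtain J V where J: "finite J" "J \<subseteq> {0..s}" "\<And>r. r \<in> J \<Longrightarrow> V r \<in> sets borel"
    and V: "AE \<omega> in M. \<omega> \<in> A \<longleftrightarrow> (\<forall>r\<in>J. B r \<omega> - B 0 \<omega> \<in> V r)"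
    and Aev: "A \<in> events"
    using A unfolding past_cylinders_def by blast
  \<comment> \<open>Adjoining 0 makes the partial sums start at \<open>B 0\<close>; adjoining
    \<open>s\<close> makes the last increment start exactly at \<open>s\<close>.\<close>
  define p where "p = sorted_list_of_set ({0, s} \<union> J)"
  have p: "sorted p" "distinct p" "set p = {0, s} \<union> J"
    unfolding p_def using J(1)
    by (auto simp del: sorted_list_of_set_insert_remove simp: set_sorted_list_of_set)
  define N where "N = length p - 1"
  have len: "length p = Suc N"
    using p(3) by (cases p) (auto simp: N_def)
  have p0: "p ! 0 = 0"
  proof -
    obtain k where "k < length p" "p ! k = 0" using p(3) by (metis in_set_conv_nth insertI1 UnI1)
    then have "p ! 0 \<le> 0" using sorted_nth_mono[OF p(1), of 0 k] by simp
    moreover have "p ! 0 \<in> set p" using len by simp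
    ultimately show ?thesis using p(3) J(2) assms(1) by auto
  qed
  have pN: "p ! N = s"
  proof -
    obtain k where k: "k < length p" "p ! k = s" using p(3) by (metis in_set_conv_nth insertI1 insertI2 UnI1)
    then have "s \<le> p ! N" using sorted_nth_mono[OF p(1), of k N] len by simp
    moreover have "p ! N \<in> set p" using len by simp
    ultimately show ?thesis using p(3) J(2) assms(1) by auto
  qed
  \<comment> \<open>Beyond \<open>N\<close> the sequence continues with \<open>u\<close>, so
    increment number \<open>N\<close> is the one from \<open>s\<close> to \<open>u\<close>.\<close>
  define \<tau> where "\<tau> i = (if i \<le> N then p ! i else u)" for i
  define X where "X i \<omega> = B (\<tau> (Suc i)) \<omega> - B (\<tau> i) \<omega>" for i \<omega>
  have ind: "indep_vars (\<lambda>_. borel) X {..<Suc N}"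
    unfolding X_def
  proof (rule indep_increments)
    show "0 \<le> \<tau> 0" by (simp add: \<tau>_def p0)
    show "\<tau> i \<le> \<tau> (Suc i)" if "i < Suc N" for i
      using that sorted_nth_mono[OF p(1), of i "Suc i"] len pN assms(2)
      by (cases "i = N") (auto simp: \<tau>_def)
  qed
  have ind2: "indep_var (PiM {..<N} (\<lambda>_. borel)) (\<lambda>\<omega>. restrict (\<lambda>i. X i \<omega>) {..<N})
      (PiM {N} (\<lambda>_. borel)) (\<lambda>\<omega>. restrict (\<lambda>i. X i \<omega>) {N})"
    by (rule indep_var_restrict[OF ind]) auto
  have "\<forall>r\<in>J. \<exists>k\<le>N. p ! k = r"
    using p(3) len by (metis UnI2 in_set_conv_nth less_Suc_eq_le)
  then obtain idx where idx: "\<And>r. r \<in> J \<Longrightarrow> idx r \<le> N \<and> p ! idx r = r" by metis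
  let ?P = "PiM {..<N} (\<lambda>_. borel :: real measure)" and ?Q = "PiM {N} (\<lambda>_. borel :: real measure)"
  define Ea where "Ea = {f \<in> space ?P. \<forall>r\<in>J. (\<Sum>i<idx r. f i) \<in> V r}"
  define Eb where "Eb = {f \<in> space ?Q. f N \<in> C}"
  have Ea: "Ea \<in> sets ?P"
    unfolding Ea_def
  proof (rule sets.sets_Collect_finite_All[OF _ J(1)])
    fix r assume r: "r \<in> J"
    have [measurable]: "V r \<in> sets borel" using J(3) r .
    have [measurable]: "(\<lambda>f. \<Sum>i<idx r. f i) \<in> borel_measurable ?P"
      using idx[OF r] by (intro borel_measurable_sum measurable_component_singleton) auto
    show "{f \<in> space ?P. (\<Sum>i<idx r. f i) \<in> V r} \<in> sets ?P" by measurable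
  qed
  have Eb: "Eb \<in> sets ?Q"
  proof -
    have [measurable]: "C \<in> sets borel" "(\<lambda>f. f N) \<in> borel_measurable ?Q"
      using C by (auto intro: measurable_component_singleton)
    show ?thesis unfolding Eb_def by measurable
  qed
  have partial: "(\<Sum>i<idx r. X i \<omega>) = B r \<omega> - B 0 \<omega>" if "r \<in> J" for r \<omega>
  proof -
    have "(\<Sum>i<idx r. X i \<omega>) = (\<Sum>i<idx r. B (p ! Suc i) \<omega> - B (p ! i) \<omega>)"
      using idx[OF that] by (intro sum.cong) (auto simp: X_def \<tau>_def)
    also have "\<dots> = B r \<omega> - B 0 \<omega>"
      using sum_lessThan_telescope[of "\<lambda>k. B (p ! k) \<omega>" "idx r"] idx[OF that] len p0 by simp
    finally show ?thesis .
  qed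
  let ?A' = "(\<lambda>\<omega>. restrict (\<lambda>i. X i \<omega>) {..<N}) -` Ea \<inter> space M"
  let ?D = "(\<lambda>\<omega>. B u \<omega> - B s \<omega>) -` C \<inter> space M"
  have A'ev: "?A' \<in> events"
    using indep_var_rv1[OF ind2] Ea by (rule measurable_sets)
  have XN: "X N \<omega> = B u \<omega> - B s \<omega>" for \<omega> by (simp add: X_def \<tau>_def pN)
  have D': "(\<lambda>\<omega>. restrict (\<lambda>i. X i \<omega>) {N}) -` Eb \<inter> space M = ?D"
    by (auto simp: Eb_def XN space_PiM)
  have Dev: "?D \<in> events"
    using measurable_sets[OF borel_measurable_diff[OF measurable_B measurable_B] C, of u s] assms(1,2)
    by simp
  have A'_eq: "\<omega> \<in> ?A' \<longleftrightarrow> \<omega> \<in> space M \<and> (\<forall>r\<in>J. B r \<omega> - B 0 \<omega> \<in> V r)" for \<omega>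
  proof -
    have "(\<Sum>i<idx r. restrict (\<lambda>i. X i \<omega>) {..<N} i) = (\<Sum>i<idx r. X i \<omega>)" if "r \<in> J" for r
      using idx[OF that] by (intro sum.cong) auto
    then show ?thesis using partial by (auto simp: Ea_def space_PiM)
  qed
  \<comment> \<open>The cylinder is described only almost surely, so \<open>A\<close> is exchanged
    for the exact preimage \<open>?A'\<close> before independence is used.\<close>
  have AA': "AE \<omega> in M. \<omega> \<in> A \<longleftrightarrow> \<omega> \<in> ?A'"
    using V AE_space by eventually_elim (auto simp only: A'_eq)
  have "prob (A \<inter> ?D) = prob (?A' \<inter> ?D)"
    using AA' by (intro finite_measure_eq_AE) (use Aev A'ev Dev in auto)
  also have "?A' \<inter> ?D = (\<lambda>\<omega>. (restrict (\<lambda>i. X i \<omega>) {..<N}, restrict (\<lambda>i. X i \<omega>) {N})) -` (Ea \<times> Eb) \<inter> space M"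
    unfolding D'[symmetric] by auto
  also have "prob \<dots> = prob ?A' * prob ?D"
    unfolding indep_varD[OF ind2 Ea Eb] D' ..
  also have "prob ?A' = prob A"
    using AA' by (intro finite_measure_eq_AE) (use Aev A'ev Dev in auto)
  finally show ?thesis .
qed

text \<open>Both generators are closed under intersection, so independence passes to the generated
  sigma-algebras, and the one of the cylinders contains \<open>\<F> s\<close>.\<close>

lemma indep_filtration_increment:
  assumes "0 \<le> s" "s < u" and X: "X \<in> borel_measurable (\<F> s)"
  shows "indep_var borel X borel (\<lambda>\<omega>. B u \<omega> - B s \<omega>)"
proof -
  let ?D = "\<lambda>\<omega>. B u \<omega> - B s \<omega>"
  have D[measurable]: "?D \<in> borel_measurable M" using assms measurable_B[of u] measurable_B[of s] by simp
  let ?S = "{?D -` A \<inter> space M | A. A \<in> sets borel}"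
  have "indep_set (past_cylinders s) ?S"
    unfolding indep_sets2_eq
    using past_cylinder_indep_increment[OF assms(1,2)] measurable_sets[OF D]
    by (auto simp: past_cylinders_def)
  moreover have "Int_stable ?S"
  proof (rule Int_stableI)
    fix a b assume "a \<in> ?S" "b \<in> ?S"
    then obtain A A' where "a = ?D -` A \<inter> space M" "b = ?D -` A' \<inter> space M" "A \<in> sets borel" "A' \<in> sets borel"
      by auto
    then show "a \<inter> b \<in> ?S" by (intro CollectI exI[of _ "A \<inter> A'"]) auto
  qed
  ultimately have ind: "indep_set (sigma_sets (space M) (past_cylinders s)) (sigma_sets (space M) ?S)"
    by (intro indep_set_sigma_sets Int_stable_past_cylinders)
  have "{X -` A \<inter> space M | A. A \<in> sets borel} \<subseteq> sets (\<F> s)"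
    using measurable_sets[OF X] by auto
  then have "sigma_sets (space M) {X -` A \<inter> space M | A. A \<in> sets borel} \<subseteq> sets (\<F> s)"
    using sets.sigma_sets_subset[of _ "\<F> s"] by simp
  also have "\<dots> \<subseteq> sigma_sets (space M) (past_cylinders s)"
    unfolding sets_filtration by (rule sigma_sets_mono'[OF filtration_generator_cylinders[OF assms(1)]])
  finally show ?thesis
    unfolding indep_var_eq using ind measurable_filtration_M[OF X] D
    by (auto simp: indep_sets2_eq)
qed

text \<open>The fourth moment gives the squared increment the variance \<open>2 * (u - s)^2\<close>,
  which drives the quadratic variation estimate.\<close>

lemma increment_moments:
  assumes "0 \<le> s" "s < u"
  defines "D \<equiv> \<lambda>\<omega>. B u \<omega> - B s \<omega>"
  shows "integrable M D" "expectation D = 0"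
    "integrable M (\<lambda>\<omega>. (D \<omega>)\<^sup>2)" "expectation (\<lambda>\<omega>. (D \<omega>)\<^sup>2) = u - s"
    "integrable M (\<lambda>\<omega>. (D \<omega>)^4)" "expectation (\<lambda>\<omega>. (D \<omega>)^4) = 3 * (u - s)\<^sup>2"
proof -
  define \<sigma> where "\<sigma> = sqrt (u - s)"
  have \<sigma>: "\<sigma> > 0" "\<sigma>\<^sup>2 = u - s" using assms by (auto simp: \<sigma>_def)
  have dist: "distributed M lborel D (\<lambda>x. ennreal (normal_density 0 \<sigma> x))"
    unfolding D_def \<sigma>_def by (rule gaussian_increments[OF assms(1,2)])
  have int: "integrable M (\<lambda>\<omega>. D \<omega> ^ k)" for k
    using distributed_integrable[OF dist, of "\<lambda>x. x ^ k"] integrable_normal_moment[OF \<sigma>(1), of 0 k] by simp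
  have ex: "expectation (\<lambda>\<omega>. D \<omega> ^ k) = (\<integral>x. normal_density 0 \<sigma> x * x ^ k \<partial>lborel)" for k
    using distributed_integral[OF dist, of "\<lambda>x. x ^ k"] by simp
  show "integrable M D" "integrable M (\<lambda>\<omega>. (D \<omega>)\<^sup>2)" "integrable M (\<lambda>\<omega>. (D \<omega>)^4)"
    using int[of 1] int[of 2] int[of 4] by simp_all
  show "expectation D = 0"
    using ex[of 1] integral_normal_moment_odd[OF \<sigma>(1), of 0 0] by simp
  show "expectation (\<lambda>\<omega>. (D \<omega>)\<^sup>2) = u - s"
    using ex[of 2] integral_normal_moment_even[OF \<sigma>(1), of 0 1] \<sigma> by simp
  have "fact 4 = (24::real)" by (simp add: fact_numeral)
  then show "expectation (\<lambda>\<omega>. (D \<omega>)^4) = 3 * (u - s)\<^sup>2"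
    using ex[of 4] integral_normal_moment_even[OF \<sigma>(1), of 0 2] \<sigma> by (simp add: power_divide)
qed

end

section \<open>Elementary stochastic integrals\<close>

text \<open>A term is kept only if the running total including it is still at most \<open>c\<close>,
  so the kept terms cannot overshoot. This bounds the norm of an integrand that is switched off
  before the level is exceeded.\<close>

lemma sum_stopped_le_min:
  fixes a :: "nat \<Rightarrow> real"
  assumes "\<And>k. a k \<ge> 0" "c \<ge> 0"
  shows "(\<Sum>k<n. if (\<Sum>j\<le>k. a j) \<le> c then a k else 0) \<le> min c (\<Sum>k<n. a k)"
proof (induction n)
  case (Suc n)
  have "(\<Sum>j\<le>n. a j) = (\<Sum>k<n. a k) + a n" by (simp add: lessThan_Suc_atMost[symmetric])
  then show ?case using Suc assms(1)[of n] by auto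
qed (use assms in auto)

text \<open>Refines one block to a partition containing its end points. It is applied both to the
  path and to \<open>f u = indicator {..u} s\<close>, so that integral and integrand get the same
  coefficients.\<close>

lemma sum_between_telescope:
  fixes f :: "real \<Rightarrow> 'b::ab_group_add" and p :: "nat \<Rightarrow> real"
  assumes p: "\<And>i j. i < j \<Longrightarrow> j \<le> N \<Longrightarrow> p i < p j" and "a \<le> b" "a \<in> p ` {..N}" "b \<in> p ` {..N}"
  shows "(\<Sum>k<N. if a \<le> p k \<and> p k < b then f (p (Suc k)) - f (p k) else 0) = f b - f a"
proof -
  obtain \<alpha> \<beta> where ab: "\<alpha> \<le> N" "\<beta> \<le> N" "a = p \<alpha>" "b = p \<beta>" using assms by auto
  have le_iff: "p i \<le> p j \<longleftrightarrow> i \<le> j" if "i \<le> N" "j \<le> N" for i j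
    using p[of i j] p[of j i] that by (cases i j rule: linorder_cases) auto
  have less_iff: "p i < p j \<longleftrightarrow> i < j" if "i \<le> N" "j \<le> N" for i j
    using le_iff[OF that(2,1)] by (simp add: not_le[symmetric])
  have "\<alpha> \<le> \<beta>" using assms(2) ab le_iff by auto
  have "(\<Sum>k<N. if a \<le> p k \<and> p k < b then f (p (Suc k)) - f (p k) else 0) =
      (\<Sum>k\<in>{\<alpha>..<\<beta>}. f (p (Suc k)) - f (p k))"
    by (rule sum.mono_neutral_cong_right) (use ab le_iff less_iff in auto)
  also have "\<dots> = f b - f a"
    using sum_Suc_diff'[of \<alpha> \<beta> "\<lambda>k. f (p k)"] \<open>\<alpha> \<le> \<beta>\<close> ab by simp
  finally show ?thesis .
qed

lemma indicator_Ioc_diff: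
  fixes s :: real
  assumes "a \<le> b"
  shows "indicator {a<..b} s = indicator {..b} s - (indicator {..a} s :: real)"
  using assms by (auto simp: indicator_def)

section \<open>The L2 isometry and elementary integrands\<close>

context brownian_motion begin

text \<open>Expand the last square: the mixed term is a past-measurable factor times an independent
  centred one, so it vanishes in mean, and the squared last term factorises. With
  \<open>f k x = x\<close> this is the Ito isometry; with \<open>f k x = x^2 - \<Delta>\<close> it
  controls quadratic variation.\<close>

lemma martingale_transform_L2:
  fixes p :: "nat \<Rightarrow> real" and f :: "nat \<Rightarrow> real \<Rightarrow> real"
  defines "D \<equiv> \<lambda>k \<omega>. f k (B (p (Suc k)) \<omega> - B (p k) \<omega>)"
  assumes p: "0 \<le> p 0" "\<And>k. k < n \<Longrightarrow> p k < p (Suc k)"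
    and \<eta>: "\<And>k. k < n \<Longrightarrow> \<eta> k \<in> borel_measurable (\<F> (p k))"
    and bnd: "\<And>k \<omega>. k < n \<Longrightarrow> \<bar>\<eta> k \<omega>\<bar> \<le> C k"
    and f: "\<And>k. f k \<in> borel_measurable borel"
    and D: "\<And>k. k < n \<Longrightarrow> integrable M (D k)" "\<And>k. k < n \<Longrightarrow> expectation (D k) = 0"
      "\<And>k. k < n \<Longrightarrow> integrable M (\<lambda>\<omega>. (D k \<omega>)\<^sup>2)"
      "\<And>k. k < n \<Longrightarrow> expectation (\<lambda>\<omega>. (D k \<omega>)\<^sup>2) = v k"
  shows "integrable M (\<lambda>\<omega>. (\<Sum>k<n. \<eta> k \<omega> * D k \<omega>)\<^sup>2) \<and>
    (\<Sum>k<n. v k * expectation (\<lambda>\<omega>. (\<eta> k \<omega>)\<^sup>2)) = expectation (\<lambda>\<omega>. (\<Sum>k<n. \<eta> k \<omega> * D k \<omega>)\<^sup>2)"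
proof -
  have nonneg: "0 \<le> p k \<and> (k < n \<longrightarrow> p k < p (Suc k))" if "k \<le> n" for k
    using that
  proof (induction k)
    case (Suc k) then show ?case using p(2)[of k] p(2)[of "Suc k"] by auto
  qed (use p in auto)
  have mono: "p j \<le> p k" if "j \<le> k" "k \<le> n" for j k
    using that
  proof (induction k)
    case (Suc k) then show ?case using p(2)[of k] by (cases "j = Suc k") force+
  qed auto
  \<comment> \<open>Adaptedness of the partial sum is carried through the induction because
    independence from the next increment rests on it.\<close>
  have "(\<lambda>\<omega>. \<Sum>k<m. \<eta> k \<omega> * D k \<omega>) \<in> borel_measurable (\<F> (p m)) \<and>
      integrable M (\<lambda>\<omega>. (\<Sum>k<m. \<eta> k \<omega> * D k \<omega>)\<^sup>2) \<and>
    (\<Sum>k<m. v k * expectation (\<lambda>\<omega>. (\<eta> k \<omega>)\<^sup>2)) = expectation (\<lambda>\<omega>. (\<Sum>k<m. \<eta> k \<omega> * D k \<omega>)\<^sup>2)"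
    if "m \<le> n" for m
    using that
  proof (induction m)
    case (Suc m)
    let ?S = "\<lambda>\<omega>. \<Sum>k<m. \<eta> k \<omega> * D k \<omega>"
    have m: "m < n" using Suc by simp
    have pm: "0 \<le> p m" "p m < p (Suc m)" using nonneg[of m] m by auto
    have S_F: "?S \<in> borel_measurable (\<F> (p m))" using Suc by simp
    have SM[measurable]: "?S \<in> borel_measurable M" by (rule measurable_filtration_M[OF S_F])
    have S2: "integrable M (\<lambda>\<omega>. (?S \<omega>)\<^sup>2)" using Suc by simp
    have S1: "integrable M ?S" by (rule square_integrable_imp_integrable[OF SM S2])
    have \<eta>F: "\<eta> m \<in> borel_measurable (\<F> (p m))" using \<eta>[OF m] .
    have \<eta>M[measurable]: "\<eta> m \<in> borel_measurable M" by (rule measurable_filtration_M[OF \<eta>F])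
    have meas: "(\<lambda>\<omega>. \<Sum>k<Suc m. \<eta> k \<omega> * D k \<omega>) \<in> borel_measurable (\<F> (p (Suc m)))"
    proof -
      have [measurable]: "?S \<in> borel_measurable (\<F> (p (Suc m)))" "\<eta> m \<in> borel_measurable (\<F> (p (Suc m)))"
        using S_F \<eta>F pm by (auto intro: measurable_filtration_mono)
      have [measurable]: "B (p m) \<in> borel_measurable (\<F> (p (Suc m)))"
        "B (p (Suc m)) \<in> borel_measurable (\<F> (p (Suc m)))" "f m \<in> borel_measurable borel"
        using pm f by (auto intro: measurable_B_filtration)
      have [measurable]: "(\<lambda>\<omega>. D m \<omega>) \<in> borel_measurable (\<F> (p (Suc m)))"
        unfolding D_def by measurable
      show ?thesis unfolding sum.lessThan_Suc by measurable
    qed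
    have indep: "indep_var borel X borel (\<lambda>\<omega>. h (D m \<omega>))"
      if "X \<in> borel_measurable (\<F> (p m))" "h \<in> borel_measurable borel" for X and h :: "real \<Rightarrow> real"
      using indep_var_compose[OF indep_filtration_increment[OF pm that(1)] measurable_ident
          measurable_compose[OF f that(2)]]
      by (simp add: D_def comp_def)
    have S\<eta>_F: "(\<lambda>\<omega>. 2 * ?S \<omega> * \<eta> m \<omega>) \<in> borel_measurable (\<F> (p m))"
      using S_F \<eta>F by measurable
    \<comment> \<open>A square integrable partial sum times the bounded \<open>\<eta> m\<close> is
      integrable, as the product rule for independent variables requires.\<close>
    have S\<eta>: "integrable M (\<lambda>\<omega>. 2 * ?S \<omega> * \<eta> m \<omega>)"
    proof (rule Bochner_Integration.integrable_bound)
      show "integrable M (\<lambda>\<omega>. 2 * C m * ?S \<omega>)" using S1 by simp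
      show "AE \<omega> in M. norm (2 * ?S \<omega> * \<eta> m \<omega>) \<le> norm (2 * C m * ?S \<omega>)"
      proof (rule AE_I2)
        fix \<omega>
        have "\<bar>\<eta> m \<omega>\<bar> * \<bar>?S \<omega>\<bar> \<le> \<bar>C m\<bar> * \<bar>?S \<omega>\<bar>"
          using bnd[OF m, of \<omega>] by (intro mult_right_mono) auto
        then show "norm (2 * ?S \<omega> * \<eta> m \<omega>) \<le> norm (2 * C m * ?S \<omega>)"
          by (simp add: abs_mult algebra_simps)
      qed
    qed measurable
    have \<eta>2_F: "(\<lambda>\<omega>. (\<eta> m \<omega>)\<^sup>2) \<in> borel_measurable (\<F> (p m))"
      using \<eta>F by measurable
    have \<eta>2: "integrable M (\<lambda>\<omega>. (\<eta> m \<omega>)\<^sup>2)"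
    proof (rule integrable_const_bound[where B = "(C m)\<^sup>2"])
      show "AE \<omega> in M. norm ((\<eta> m \<omega>)\<^sup>2) \<le> (C m)\<^sup>2"
        using power_mono[OF bnd[OF m] abs_ge_zero, of _ 2] by (auto intro!: AE_I2)
    qed measurable
    have i1: "indep_var borel (\<lambda>\<omega>. 2 * ?S \<omega> * \<eta> m \<omega>) borel (D m)"
      using indep[OF S\<eta>_F measurable_ident] by simp
    have i2: "indep_var borel (\<lambda>\<omega>. (\<eta> m \<omega>)\<^sup>2) borel (\<lambda>\<omega>. (D m \<omega>)\<^sup>2)"
      using indep[OF \<eta>2_F, of "\<lambda>x. x\<^sup>2"] by simp
    have eq: "(\<Sum>k<Suc m. \<eta> k \<omega> * D k \<omega>)\<^sup>2 =
        (?S \<omega>)\<^sup>2 + 2 * ?S \<omega> * \<eta> m \<omega> * D m \<omega> + (\<eta> m \<omega>)\<^sup>2 * (D m \<omega>)\<^sup>2" for \<omega>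
      by (simp add: power2_sum power_mult_distrib)
    note c1 = indep_var_integrable[OF i1 S\<eta> D(1)[OF m]] indep_var_lebesgue_integral[OF i1 S\<eta> D(1)[OF m]]
    note c2 = indep_var_integrable[OF i2 \<eta>2 D(3)[OF m]] indep_var_lebesgue_integral[OF i2 \<eta>2 D(3)[OF m]]
    show ?case
      unfolding eq using S2 c1 c2 meas Suc D(2,4)[OF m] by (simp add: mult.commute)
  qed auto
  from this[of n] show ?thesis by simp
qed

text \<open>In contrast to \<open>simple_integrand\<close>, the blocks need not be ordered or disjoint, so that sums of
  integrands require no common partition.\<close>

inductive elementary :: "real \<Rightarrow> (real \<Rightarrow> 'a \<Rightarrow> real) \<Rightarrow> ('a \<Rightarrow> real) \<Rightarrow> bool" for T :: real where
  elementary_zero: "elementary T (\<lambda>s \<omega>. 0) (\<lambda>\<omega>. 0)"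
| elementary_block: "elementary T \<Phi> Z \<Longrightarrow> 0 \<le> a \<Longrightarrow> a \<le> b \<Longrightarrow> b \<le> T \<Longrightarrow>
    \<xi> \<in> borel_measurable (\<F> a) \<Longrightarrow>
    elementary T (\<lambda>s \<omega>. \<Phi> s \<omega> + \<xi> \<omega> * indicator {a<..b} s) (\<lambda>\<omega>. Z \<omega> + \<xi> \<omega> * (B b \<omega> - B a \<omega>))"

lemma elementary_scale:
  assumes "elementary T \<Phi> Z"
  shows "elementary T (\<lambda>s \<omega>. c * \<Phi> s \<omega>) (\<lambda>\<omega>. c * Z \<omega>)"
  using assms
proof induction
  case elementary_zero
  show ?case using elementary.elementary_zero by simp
next
  case (elementary_block \<Phi> Z a b \<xi>)
  have "(\<lambda>\<omega>. c * \<xi> \<omega>) \<in> borel_measurable (\<F> a)"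
    using elementary_block by measurable
  from elementary.elementary_block[OF elementary_block.IH elementary_block.hyps(2-4) this]
  show ?case by (simp add: algebra_simps)
qed

lemma elementary_add:
  assumes "elementary T \<Phi> Z" "elementary T \<Phi>' Z'"
  shows "elementary T (\<lambda>s \<omega>. \<Phi> s \<omega> + \<Phi>' s \<omega>) (\<lambda>\<omega>. Z \<omega> + Z' \<omega>)"
  using assms(2)
proof induction
  case elementary_zero
  show ?case using assms(1) by simp
next
  case (elementary_block \<Phi>' Z' a b \<xi>)
  from elementary.elementary_block[OF elementary_block.IH elementary_block.hyps(2-5)]
  show ?case by (simp add: algebra_simps)
qed

lemma elementary_sum:
  assumes "\<And>i. i \<in> I \<Longrightarrow> elementary T (\<Phi> i) (Z i)"
  shows "elementary T (\<lambda>s \<omega>. \<Sum>i\<in>I. \<Phi> i s \<omega>) (\<lambda>\<omega>. \<Sum>i\<in>I. Z i \<omega>)"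
proof (cases "finite I")
  case True
  then show ?thesis using assms
    by (induction I) (auto intro: elementary_zero elementary_add)
qed (auto intro: elementary_zero)

text \<open>Blocks are truncated at \<open>T\<close>. For \<open>\<tau> i > T\<close> the height
  need not be measurable at time \<open>T\<close>, so it is set to 0; the truncated block is then
  empty, and nothing changes on \<open>{0..T}\<close>.\<close>

lemma elementary_simple:
  assumes "simple_integrand M B n \<tau> \<xi>" "0 \<le> T"
  shows "\<exists>\<Phi>. elementary T \<Phi> (simple_integral B n \<tau> \<xi> T) \<and>
    (\<forall>s\<in>{0..T}. \<forall>\<omega>. \<Phi> s \<omega> = simple_process n \<tau> \<xi> s \<omega>)"
proof -
  have \<tau>: "0 \<le> \<tau> k" if "k \<le> n" for k
    using that
  proof (induction k)
    case (Suc k)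
    then have "\<tau> k \<le> \<tau> (Suc k)" using assms(1) unfolding simple_integrand_def by auto
    then show ?case using Suc by simp
  qed (use assms in \<open>auto simp: simple_integrand_def\<close>)
  define \<Phi> where "\<Phi> i s \<omega> = (if \<tau> i \<le> T then \<xi> i \<omega> else 0) * indicator {min T (\<tau> i)<..min T (\<tau> (Suc i))} s" for i s \<omega>
  define Z where "Z i \<omega> = (if \<tau> i \<le> T then \<xi> i \<omega> else 0) * (B (min T (\<tau> (Suc i))) \<omega> - B (min T (\<tau> i)) \<omega>)" for i \<omega>
  have le: "\<tau> i \<le> \<tau> (Suc i)" if "i < n" for i using that assms by (auto simp: simple_integrand_def)
  have el: "elementary T (\<Phi> i) (Z i)" if i: "i < n" for i
  proof -
    have "(\<lambda>\<omega>. if \<tau> i \<le> T then \<xi> i \<omega> else 0) \<in> borel_measurable (\<F> (min T (\<tau> i)))"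
    proof (cases "\<tau> i \<le> T")
      case True
      then show ?thesis using assms i by (auto simp: simple_integrand_def min_def)
    next
      case False
      then show ?thesis by (simp only: if_False) simp
    qed
    from elementary_block[OF elementary_zero _ _ _ this, of "min T (\<tau> (Suc i))" T]
    show ?thesis using \<tau>[of i] i assms(2) le[OF i] unfolding \<Phi>_def Z_def by simp
  qed
  have "elementary T (\<lambda>s \<omega>. \<Sum>i<n. \<Phi> i s \<omega>) (\<lambda>\<omega>. \<Sum>i<n. Z i \<omega>)"
    by (rule elementary_sum) (use el in auto)
  moreover have "(\<lambda>\<omega>. \<Sum>i<n. Z i \<omega>) = simple_integral B n \<tau> \<xi> T"
    unfolding simple_integral_def Z_def fun_eq_iff
  proof (intro allI sum.cong refl)
    fix \<omega> i assume "i \<in> {..<n}"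
    then show "(if \<tau> i \<le> T then \<xi> i \<omega> else 0) * (B (min T (\<tau> (Suc i))) \<omega> - B (min T (\<tau> i)) \<omega>) =
      \<xi> i \<omega> * (B (min T (\<tau> (Suc i))) \<omega> - B (min T (\<tau> i)) \<omega>)"
      using le[of i] by (auto simp: min_def)
  qed
  moreover have "(\<Sum>i<n. \<Phi> i s \<omega>) = simple_process n \<tau> \<xi> s \<omega>" if "s \<in> {0..T}" for s \<omega>
    unfolding simple_process_def \<Phi>_def
    by (intro sum.cong refl) (use that le in \<open>auto simp: indicator_def min_def\<close>)
  ultimately show ?thesis by (intro exI[of _ "\<lambda>s \<omega>. \<Sum>i<n. \<Phi> i s \<omega>"]) auto
qed

text \<open>Asking for a finite set \<open>P0\<close> of times to be met, rather than fixing a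
  partition, makes the induction work: a further block only adds its two end points, and every
  partition through the required times still represents the integrand.\<close>

lemma elementary_refine:
  assumes "elementary T \<Phi> Z"
  shows "\<exists>P0. finite P0 \<and> P0 \<subseteq> {0..T} \<and> (\<forall>n p. P0 \<subseteq> p ` {..n} \<longrightarrow> p ` {..n} \<subseteq> {0..T} \<longrightarrow>
    (\<forall>i j. i < j \<longrightarrow> j \<le> n \<longrightarrow> p i < p j) \<longrightarrow>
    (\<exists>\<xi>. (\<forall>k<n. \<xi> k \<in> borel_measurable (\<F> (p k))) \<and>
      \<Phi> = (\<lambda>s \<omega>. \<Sum>k<n. \<xi> k \<omega> * indicator {p k<..p (Suc k)} s) \<and>
      Z = (\<lambda>\<omega>. \<Sum>k<n. \<xi> k \<omega> * (B (p (Suc k)) \<omega> - B (p k) \<omega>))))"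
  using assms
proof induction
  case elementary_zero
  show ?case by (rule exI[of _ "{}"]) (auto intro!: exI[of _ "\<lambda>_ _. 0"])
next
  case (elementary_block \<Phi> Z a b \<zeta>)
  from elementary_block.IH obtain P0 where P0: "finite P0" "P0 \<subseteq> {0..T}"
    and *: "\<And>n (p :: nat \<Rightarrow> real). P0 \<subseteq> p ` {..n} \<Longrightarrow> p ` {..n} \<subseteq> {0..T} \<Longrightarrow>
    (\<forall>i j. i < j \<longrightarrow> j \<le> n \<longrightarrow> p i < p j) \<Longrightarrow>
    (\<exists>\<xi>. (\<forall>k<n. \<xi> k \<in> borel_measurable (\<F> (p k))) \<and>
      \<Phi> = (\<lambda>s \<omega>. \<Sum>k<n. \<xi> k \<omega> * indicator {p k<..p (Suc k)} s) \<and>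
      Z = (\<lambda>\<omega>. \<Sum>k<n. \<xi> k \<omega> * (B (p (Suc k)) \<omega> - B (p k) \<omega>)))"
    by blast
  show ?case
  proof (rule exI[of _ "insert a (insert b P0)"], intro conjI allI impI)
    show "finite (insert a (insert b P0))" using P0 by simp
    show "insert a (insert b P0) \<subseteq> {0..T}" using P0 elementary_block by auto
    fix n and p :: "nat \<Rightarrow> real"
    assume sub: "insert a (insert b P0) \<subseteq> p ` {..n}" "p ` {..n} \<subseteq> {0..T}"
      and mono: "\<forall>i j. i < j \<longrightarrow> j \<le> n \<longrightarrow> p i < p j"
    obtain \<xi> where \<xi>: "\<And>k. k < n \<Longrightarrow> \<xi> k \<in> borel_measurable (\<F> (p k))"
      and \<Phi>: "\<Phi> = (\<lambda>s \<omega>. \<Sum>k<n. \<xi> k \<omega> * indicator {p k<..p (Suc k)} s)"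
      and Z: "Z = (\<lambda>\<omega>. \<Sum>k<n. \<xi> k \<omega> * (B (p (Suc k)) \<omega> - B (p k) \<omega>))"
      using *[of p n] sub mono by auto
    \<comment> \<open>The new height is added on exactly those cells that lie inside the block; they
      start at or after \<open>a\<close>, where \<open>\<zeta>\<close> is already known.\<close>
    let ?\<xi> = "\<lambda>k \<omega>. \<xi> k \<omega> + (if a \<le> p k \<and> p k < b then \<zeta> \<omega> else 0)"
    have tele: "f b - f a = (\<Sum>k<n. if a \<le> p k \<and> p k < b then f (p (Suc k)) - f (p k) else 0)"
      for f :: "real \<Rightarrow> real"
      using sum_between_telescope[of n p a b f] mono sub elementary_block.hyps by auto
    have dist: "(\<Sum>k<n. \<xi> k \<omega> * g k) + \<zeta> \<omega> * (\<Sum>k<n. if a \<le> p k \<and> p k < b then g k else 0) =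
        (\<Sum>k<n. ?\<xi> k \<omega> * g k)" for g \<omega>
      unfolding sum_distrib_left sum.distrib[symmetric] by (intro sum.cong) (auto simp: algebra_simps)
    show "\<exists>\<xi>. (\<forall>k<n. \<xi> k \<in> borel_measurable (\<F> (p k))) \<and>
      (\<lambda>s \<omega>. \<Phi> s \<omega> + \<zeta> \<omega> * indicator {a<..b} s) = (\<lambda>s \<omega>. \<Sum>k<n. \<xi> k \<omega> * indicator {p k<..p (Suc k)} s) \<and>
      (\<lambda>\<omega>. Z \<omega> + \<zeta> \<omega> * (B b \<omega> - B a \<omega>)) = (\<lambda>\<omega>. \<Sum>k<n. \<xi> k \<omega> * (B (p (Suc k)) \<omega> - B (p k) \<omega>))"
    proof (rule exI[of _ ?\<xi>], intro conjI allI impI)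
      fix k assume k: "k < n"
      have "(\<lambda>\<omega>. if a \<le> p k \<and> p k < b then \<zeta> \<omega> else 0) \<in> borel_measurable (\<F> (p k))"
      proof (cases "a \<le> p k \<and> p k < b")
        case True
        then show ?thesis using measurable_filtration_mono[OF elementary_block.hyps(5)] by simp
      next
        case False
        then show ?thesis by (simp only: if_False) simp
      qed
      with \<xi>[OF k] show "?\<xi> k \<in> borel_measurable (\<F> (p k))" by measurable
    next
      show "(\<lambda>s \<omega>. \<Phi> s \<omega> + \<zeta> \<omega> * indicator {a<..b} s) = (\<lambda>s \<omega>. \<Sum>k<n. ?\<xi> k \<omega> * indicator {p k<..p (Suc k)} s)"
      proof (intro ext)
        fix s \<omega>
        have "(indicator {a<..b} s :: real) = (\<Sum>k<n. if a \<le> p k \<and> p k < b then indicator {p k<..p (Suc k)} s else 0)"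
          unfolding indicator_Ioc_diff[OF elementary_block.hyps(3)] tele[of "\<lambda>u. indicator {..u} s"]
          using mono by (intro sum.cong refl if_cong) (auto simp: indicator_Ioc_diff less_imp_le)
        then show "\<Phi> s \<omega> + \<zeta> \<omega> * indicator {a<..b} s = (\<Sum>k<n. ?\<xi> k \<omega> * indicator {p k<..p (Suc k)} s)"
          by (simp only: \<Phi> dist)
      qed
      show "(\<lambda>\<omega>. Z \<omega> + \<zeta> \<omega> * (B b \<omega> - B a \<omega>)) = (\<lambda>\<omega>. \<Sum>k<n. ?\<xi> k \<omega> * (B (p (Suc k)) \<omega> - B (p k) \<omega>))"
        unfolding Z tele[of "\<lambda>u. B u _"] dist ..
    qed
  qed
qed

lemma elementary_canonical:
  assumes "elementary T \<Phi> Z" "0 \<le> T"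
  obtains n and p :: "nat \<Rightarrow> real" and \<xi> where "\<And>k. k \<le> n \<Longrightarrow> p k \<in> {0..T}"
    "\<And>i j. i < j \<Longrightarrow> j \<le> n \<Longrightarrow> p i < p j" "\<And>k. k < n \<Longrightarrow> \<xi> k \<in> borel_measurable (\<F> (p k))"
    "\<And>s \<omega>. \<Phi> s \<omega> = (\<Sum>k<n. \<xi> k \<omega> * indicator {p k<..p (Suc k)} s)"
    "\<And>\<omega>. Z \<omega> = (\<Sum>k<n. \<xi> k \<omega> * (B (p (Suc k)) \<omega> - B (p k) \<omega>))"
proof -
  obtain P0 where P0: "finite P0" "P0 \<subseteq> {0..T}"
    and *: "\<And>n (p :: nat \<Rightarrow> real). P0 \<subseteq> p ` {..n} \<Longrightarrow> p ` {..n} \<subseteq> {0..T} \<Longrightarrow>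
    (\<forall>i j. i < j \<longrightarrow> j \<le> n \<longrightarrow> p i < p j) \<Longrightarrow>
    (\<exists>\<xi>. (\<forall>k<n. \<xi> k \<in> borel_measurable (\<F> (p k))) \<and>
      \<Phi> = (\<lambda>s \<omega>. \<Sum>k<n. \<xi> k \<omega> * indicator {p k<..p (Suc k)} s) \<and>
      Z = (\<lambda>\<omega>. \<Sum>k<n. \<xi> k \<omega> * (B (p (Suc k)) \<omega> - B (p k) \<omega>)))"
    using elementary_refine[OF assms(1)] by blast
  \<comment> \<open>Inserting 0 keeps the list nonempty even for an empty \<open>P0\<close>.\<close>
  define l where "l = sorted_list_of_set (insert 0 P0)"
  have l: "sorted l" "distinct l" "set l = insert 0 P0"
    unfolding l_def using P0(1)
    by (auto simp del: sorted_list_of_set_insert_remove simp: set_sorted_list_of_set)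
  define n where "n = length l - 1"
  have len: "length l = Suc n" using l(3) by (cases l) (auto simp: n_def)
  have im: "(!) l ` {..n} = insert 0 P0"
    using l(3) len by (metis lessThan_Suc_atMost list.set_map map_nth set_upt atLeast0LessThan)
  have mono: "\<forall>i j. i < j \<longrightarrow> j \<le> n \<longrightarrow> l ! i < l ! j"
    using l(1,2) len by (metis le_imp_less_Suc sorted_wrt_nth_less strict_sorted_iff)
  obtain \<xi> where "\<forall>k<n. \<xi> k \<in> borel_measurable (\<F> (l ! k))"
      "\<Phi> = (\<lambda>s \<omega>. \<Sum>k<n. \<xi> k \<omega> * indicator {l ! k<..l ! (Suc k)} s)"
      "Z = (\<lambda>\<omega>. \<Sum>k<n. \<xi> k \<omega> * (B (l ! (Suc k)) \<omega> - B (l ! k) \<omega>))"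
    using *[of "(!) l" n] mono im P0(2) assms(2) by auto
  moreover have "l ! k \<in> {0..T}" if "k \<le> n" for k
  proof -
    have "l ! k \<in> insert 0 P0" using im that by blast
    then show ?thesis using P0(2) assms(2) by auto
  qed
  ultimately show thesis
    using mono by (intro that[of n "(!) l" \<xi>]) auto
qed

text \<open>\<open>Z'\<close> integrates \<open>\<Phi>\<close> only as long as its running squared \<open>L\<^sup>2\<close> norm stays at most \<open>1\<close>:
  the stopped integrand is still adapted, and the isometry applies to it without any integrability
  assumption on \<open>\<Phi>\<close>.\<close>

lemma elementary_stopped:
  assumes "elementary T \<Phi> Z" "0 \<le> T"
  shows "\<exists>Q Z'. Q \<in> borel_measurable M \<and> (\<forall>\<omega>. 0 \<le> Q \<omega>) \<and>
    (\<forall>\<omega>. (\<integral>\<^sup>+s\<in>{0..T}. ennreal ((\<Phi> s \<omega>)\<^sup>2) \<partial>lborel) = ennreal (Q \<omega>)) \<and>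
    Z' \<in> borel_measurable M \<and> integrable M (\<lambda>\<omega>. (Z' \<omega>)\<^sup>2) \<and>
    expectation (\<lambda>\<omega>. (Z' \<omega>)\<^sup>2) \<le> expectation (\<lambda>\<omega>. min 1 (Q \<omega>)) \<and>
    (\<forall>\<omega>. Q \<omega> \<le> 1 \<longrightarrow> Z' \<omega> = Z \<omega>)"
proof -
  obtain n and p :: "nat \<Rightarrow> real" and \<xi> where p: "\<And>k. k \<le> n \<Longrightarrow> p k \<in> {0..T}"
    and mono: "\<And>i j. i < j \<Longrightarrow> j \<le> n \<Longrightarrow> p i < p j"
    and \<xi>: "\<And>k. k < n \<Longrightarrow> \<xi> k \<in> borel_measurable (\<F> (p k))"
    and \<Phi>: "\<And>s \<omega>. \<Phi> s \<omega> = (\<Sum>k<n. \<xi> k \<omega> * indicator {p k<..p (Suc k)} s)"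
    and Z: "\<And>\<omega>. Z \<omega> = (\<Sum>k<n. \<xi> k \<omega> * (B (p (Suc k)) \<omega> - B (p k) \<omega>))"
    by (rule elementary_canonical[OF assms]) blast
  define \<Delta> where "\<Delta> k = p (Suc k) - p k" for k
  have \<Delta>: "\<Delta> k > 0" if "k < n" for k using mono[of k "Suc k"] that by (simp add: \<Delta>_def)
  define a where "a k \<omega> = (if k < n then (\<xi> k \<omega>)\<^sup>2 * \<Delta> k else 0)" for k \<omega>
  have a_nonneg: "0 \<le> a k \<omega>" for k \<omega> using \<Delta>[of k] by (simp add: a_def less_imp_le)
  define Q where "Q \<omega> = (\<Sum>k<n. a k \<omega>)" for \<omega>
  \<comment> \<open>The running total includes the present cell, whose height is already known at
    its left end; so the stopped height is adapted and the kept norm never exceeds 1.\<close>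
  define \<eta> where "\<eta> k \<omega> = (if (\<Sum>j\<le>k. a j \<omega>) \<le> 1 then \<xi> k \<omega> else 0)" for k \<omega>
  define Z' where "Z' \<omega> = (\<Sum>k<n. \<eta> k \<omega> * (B (p (Suc k)) \<omega> - B (p k) \<omega>))" for \<omega>
  have le_p: "p j \<le> p k" if "j \<le> k" "k \<le> n" for j k
    using mono[of j k] that by (cases "j = k") auto
  have a_F: "a j \<in> borel_measurable (\<F> (p k))" if "j \<le> k" "k \<le> n" for j k
  proof (cases "j < n")
    case True
    have [measurable]: "\<xi> j \<in> borel_measurable (\<F> (p k))"
      using measurable_filtration_mono[OF \<xi>[OF True] le_p[OF that]] .
    show ?thesis using True unfolding a_def by simp
  next
    case False then show ?thesis unfolding a_def by simp
  qed
  have Q_M[measurable]: "Q \<in> borel_measurable M"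
    unfolding Q_def using a_F by (intro borel_measurable_sum measurable_filtration_M[OF a_F[OF order_refl]]) auto
  have \<eta>_F: "\<eta> k \<in> borel_measurable (\<F> (p k))" if "k < n" for k
  proof -
    have [measurable]: "(\<lambda>\<omega>. \<Sum>j\<le>k. a j \<omega>) \<in> borel_measurable (\<F> (p k))"
      using a_F that by (intro borel_measurable_sum) auto
    have [measurable]: "\<xi> k \<in> borel_measurable (\<F> (p k))" using \<xi>[OF that] .
    show ?thesis unfolding \<eta>_def by measurable
  qed
  have \<eta>_M: "\<eta> k \<in> borel_measurable M" if "k < n" for k
    using measurable_filtration_M[OF \<eta>_F[OF that]] .
  have \<eta>_sq: "(\<eta> k \<omega>)\<^sup>2 * \<Delta> k = (if (\<Sum>j\<le>k. a j \<omega>) \<le> 1 then a k \<omega> else 0)" if "k < n" for k \<omega>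
    using that by (simp add: \<eta>_def a_def)
  have a_le: "a k \<omega> \<le> (\<Sum>j\<le>k. a j \<omega>)" for k \<omega>
    using a_nonneg by (intro member_le_sum) auto
  \<comment> \<open>Stopping turns an arbitrary height into one whose square is at most
    \<open>1 / \<Delta> k\<close>, so the isometry for bounded heights applies.\<close>
  have \<eta>_sq_le: "(\<eta> k \<omega>)\<^sup>2 \<le> 1 / \<Delta> k" if "k < n" for k \<omega>
  proof -
    have "(\<eta> k \<omega>)\<^sup>2 * \<Delta> k \<le> 1"
      unfolding \<eta>_sq[OF that] using a_le[of k \<omega>] by simp
    then show ?thesis using \<Delta>[OF that] by (simp add: pos_le_divide_eq)
  qed
  have \<eta>_bnd: "\<bar>\<eta> k \<omega>\<bar> \<le> sqrt (1 / \<Delta> k)" if "k < n" for k \<omega>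
    using real_sqrt_le_mono[OF \<eta>_sq_le[OF that, of \<omega>]] by simp
  have \<eta>2_int: "integrable M (\<lambda>\<omega>. (\<eta> k \<omega>)\<^sup>2)" if "k < n" for k
    using \<eta>_sq_le[OF that] \<eta>_M[OF that]
    by (intro integrable_const_bound[where B = "1 / \<Delta> k"]) auto
  have iso: "integrable M (\<lambda>\<omega>. (Z' \<omega>)\<^sup>2) \<and>
      (\<Sum>k<n. \<Delta> k * expectation (\<lambda>\<omega>. (\<eta> k \<omega>)\<^sup>2)) = expectation (\<lambda>\<omega>. (Z' \<omega>)\<^sup>2)"
    unfolding Z'_def
  proof (rule martingale_transform_L2[where f = "\<lambda>_ x. x" and C = "\<lambda>k. sqrt (1 / \<Delta> k)"])
    fix k assume k: "k < n"
    have "0 \<le> p k" "p k < p (Suc k)" using p[of k] mono[of k "Suc k"] k by auto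
    from increment_moments[OF this]
    show "integrable M (\<lambda>\<omega>. B (p (Suc k)) \<omega> - B (p k) \<omega>)"
      "expectation (\<lambda>\<omega>. B (p (Suc k)) \<omega> - B (p k) \<omega>) = 0"
      "integrable M (\<lambda>\<omega>. (B (p (Suc k)) \<omega> - B (p k) \<omega>)\<^sup>2)"
      "expectation (\<lambda>\<omega>. (B (p (Suc k)) \<omega> - B (p k) \<omega>)\<^sup>2) = \<Delta> k"
      by (simp_all add: \<Delta>_def)
  qed (use p[of 0] mono \<eta>_F \<eta>_bnd in auto)
  have Z'_M: "Z' \<in> borel_measurable M"
  proof -
    have "(\<lambda>\<omega>. B (p (Suc k)) \<omega> - B (p k) \<omega>) \<in> borel_measurable M" if "k < n" for k
      using p[of k] p[of "Suc k"] that by (intro borel_measurable_diff measurable_B) auto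
    then show ?thesis unfolding Z'_def using \<eta>_M by (intro borel_measurable_sum borel_measurable_times) auto
  qed
  have min_le: "(\<Sum>k<n. \<Delta> k * (\<eta> k \<omega>)\<^sup>2) \<le> min 1 (Q \<omega>)" for \<omega>
  proof -
    have "(\<Sum>k<n. \<Delta> k * (\<eta> k \<omega>)\<^sup>2) = (\<Sum>k<n. if (\<Sum>j\<le>k. a j \<omega>) \<le> 1 then a k \<omega> else 0)"
      by (intro sum.cong refl) (use \<eta>_sq in \<open>auto simp: mult.commute\<close>)
    also have "\<dots> \<le> min 1 (Q \<omega>)" unfolding Q_def by (rule sum_stopped_le_min) (auto simp: a_nonneg)
    finally show ?thesis .
  qed
  have "expectation (\<lambda>\<omega>. (Z' \<omega>)\<^sup>2) = expectation (\<lambda>\<omega>. \<Sum>k<n. \<Delta> k * (\<eta> k \<omega>)\<^sup>2)"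
    using iso \<eta>2_int by (subst Bochner_Integration.integral_sum) auto
  also have "\<dots> \<le> expectation (\<lambda>\<omega>. min 1 (Q \<omega>))"
  proof (rule integral_mono)
    show "integrable M (\<lambda>\<omega>. min 1 (Q \<omega>))"
    proof (rule integrable_const_bound[where B = 1])
      have "0 \<le> Q \<omega>" for \<omega> unfolding Q_def by (intro sum_nonneg a_nonneg)
      then show "AE \<omega> in M. norm (min 1 (Q \<omega>)) \<le> 1" by (intro AE_I2) (auto simp: min_def)
    qed measurable
  qed (use \<eta>2_int min_le in auto)
  finally have le: "expectation (\<lambda>\<omega>. (Z' \<omega>)\<^sup>2) \<le> expectation (\<lambda>\<omega>. min 1 (Q \<omega>))" .
  \<comment> \<open>Every running total is at most \<open>Q\<close>, so for
    \<open>Q \<omega> \<le> 1\<close> no cell is switched off.\<close>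
  have eq: "Z' \<omega> = Z \<omega>" if "Q \<omega> \<le> 1" for \<omega>
  proof -
    have "\<eta> k \<omega> = \<xi> k \<omega>" if "k < n" for k
    proof -
      have "(\<Sum>j\<le>k. a j \<omega>) \<le> Q \<omega>"
        unfolding Q_def using that a_nonneg by (intro sum_mono2) auto
      then show ?thesis using \<open>Q \<omega> \<le> 1\<close> by (simp add: \<eta>_def)
    qed
    then show ?thesis unfolding Z'_def Z by simp
  qed
  have Q_eq: "(\<integral>\<^sup>+s\<in>{0..T}. ennreal ((\<Phi> s \<omega>)\<^sup>2) \<partial>lborel) = ennreal (Q \<omega>)" for \<omega>
  proof -
    \<comment> \<open>The cells are disjoint, so at most one term is nonzero and the square of the
      sum is the sum of the squares.\<close>
    have sq: "ennreal ((\<Phi> s \<omega>)\<^sup>2) * indicator {0..T} s =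
        (\<Sum>k<n. ennreal ((\<xi> k \<omega>)\<^sup>2) * indicator {p k<..p (Suc k)} s)" for s
    proof (cases "\<exists>k<n. s \<in> {p k<..p (Suc k)}")
      case True
      then obtain k where k: "k < n" "s \<in> {p k<..p (Suc k)}" by auto
      have only: "(indicator {p j<..p (Suc j)} s :: real) = (if j = k then 1 else 0)"
          "(indicator {p j<..p (Suc j)} s :: ennreal) = (if j = k then 1 else 0)" if "j < n" for j
      proof -
        have "s \<notin> {p j<..p (Suc j)}" if "j < k"
          using that k le_p[of "Suc j" k] by simp
        moreover have "s \<notin> {p j<..p (Suc j)}" if "k < j"
          using that k \<open>j < n\<close> le_p[of "Suc k" j] by simp
        ultimately have "s \<in> {p j<..p (Suc j)} \<longleftrightarrow> j = k"
          using k(2) by (cases j k rule: linorder_cases) simp_all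
        then show "(indicator {p j<..p (Suc j)} s :: real) = (if j = k then 1 else 0)"
          "(indicator {p j<..p (Suc j)} s :: ennreal) = (if j = k then 1 else 0)"
          by (simp_all only: indicator_def of_bool_def)
      qed
      have "s \<in> {0..T}" using k p[of k] p[of "Suc k"] by auto
      have "\<Phi> s \<omega> = (\<Sum>j<n. if j = k then \<xi> j \<omega> else 0)"
        unfolding \<Phi> by (intro sum.cong refl) (simp add: only del: indicator_simps)
      moreover have "(\<Sum>j<n. ennreal ((\<xi> j \<omega>)\<^sup>2) * indicator {p j<..p (Suc j)} s) =
          (\<Sum>j<n. if j = k then ennreal ((\<xi> j \<omega>)\<^sup>2) else 0)"
        by (intro sum.cong refl) (simp add: only del: indicator_simps)
      ultimately show ?thesis using k \<open>s \<in> {0..T}\<close> by simp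
    next
      case False
      then have "\<Phi> s \<omega> = 0" unfolding \<Phi> by (intro sum.neutral) (auto simp: indicator_def)
      moreover have "(\<Sum>k<n. ennreal ((\<xi> k \<omega>)\<^sup>2) * indicator {p k<..p (Suc k)} s) = 0"
        using False by (intro sum.neutral) (auto simp: indicator_def)
      ultimately show ?thesis by simp
    qed
    have "(\<integral>\<^sup>+s\<in>{0..T}. ennreal ((\<Phi> s \<omega>)\<^sup>2) \<partial>lborel) =
        (\<Sum>k<n. \<integral>\<^sup>+s. ennreal ((\<xi> k \<omega>)\<^sup>2) * indicator {p k<..p (Suc k)} s \<partial>lborel)"
      unfolding sq by (rule nn_integral_sum) simp
    also have "\<dots> = (\<Sum>k<n. ennreal (a k \<omega>))"
    proof (intro sum.cong refl)
      fix k assume "k \<in> {..<n}"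
      then show "(\<integral>\<^sup>+s. ennreal ((\<xi> k \<omega>)\<^sup>2) * indicator {p k<..p (Suc k)} s \<partial>lborel) = ennreal (a k \<omega>)"
        using \<Delta>[of k] by (simp add: nn_integral_cmult a_def ennreal_mult \<Delta>_def)
    qed
    also have "\<dots> = ennreal (Q \<omega>)" unfolding Q_def using a_nonneg by (intro sum_ennreal) auto
    finally show ?thesis .
  qed
  show ?thesis
    using Q_M Q_eq Z'_M iso le eq a_nonneg
    by (intro exI[of _ Q] exI[of _ Z']) (auto simp: Q_def intro: sum_nonneg)
qed

text \<open>\<open>min 1 Q\<close> tends to 0 in mean by dominated convergence, hence the stopped
  integrals tend to 0 in \<open>L2\<close>, and almost surely along a subsequence. Eventually
  \<open>Q < 1\<close>, where stopping has not acted. Thus almost sure convergence of the norms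
  suffices, without moments.\<close>

lemma elementary_integral_subseq:
  assumes el: "\<And>n. elementary T (\<Phi> n) (Z n)" and T: "0 \<le> T"
    and lim: "AE \<omega> in M. (\<lambda>n. \<integral>\<^sup>+s\<in>{0..T}. ennreal ((\<Phi> n s \<omega>)\<^sup>2) \<partial>lborel) \<longlonglongrightarrow> 0"
  shows "\<exists>r::nat \<Rightarrow> nat. strict_mono r \<and> (AE \<omega> in M. (\<lambda>n. Z (r n) \<omega>) \<longlonglongrightarrow> 0)"
proof -
  obtain Q Z' where Q_M[measurable]: "\<And>n. Q n \<in> borel_measurable M" and Q_nonneg: "\<And>n \<omega>. 0 \<le> Q n \<omega>"
    and Q_eq: "\<And>n \<omega>. (\<integral>\<^sup>+s\<in>{0..T}. ennreal ((\<Phi> n s \<omega>)\<^sup>2) \<partial>lborel) = ennreal (Q n \<omega>)"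
    and Z'_M[measurable]: "\<And>n. Z' n \<in> borel_measurable M" and Z'_int: "\<And>n. integrable M (\<lambda>\<omega>. (Z' n \<omega>)\<^sup>2)"
    and Z'_le: "\<And>n. expectation (\<lambda>\<omega>. (Z' n \<omega>)\<^sup>2) \<le> expectation (\<lambda>\<omega>. min 1 (Q n \<omega>))"
    and Z'_eq: "\<And>n \<omega>. Q n \<omega> \<le> 1 \<Longrightarrow> Z' n \<omega> = Z n \<omega>"
  proof -
    from elementary_stopped[OF el T] have "\<forall>n. \<exists>QZ. fst QZ \<in> borel_measurable M \<and> (\<forall>\<omega>. 0 \<le> fst QZ \<omega>) \<and>
      (\<forall>\<omega>. (\<integral>\<^sup>+s\<in>{0..T}. ennreal ((\<Phi> n s \<omega>)\<^sup>2) \<partial>lborel) = ennreal (fst QZ \<omega>)) \<and>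
      snd QZ \<in> borel_measurable M \<and> integrable M (\<lambda>\<omega>. (snd QZ \<omega>)\<^sup>2) \<and>
      expectation (\<lambda>\<omega>. (snd QZ \<omega>)\<^sup>2) \<le> expectation (\<lambda>\<omega>. min 1 (fst QZ \<omega>)) \<and>
      (\<forall>\<omega>. fst QZ \<omega> \<le> 1 \<longrightarrow> snd QZ \<omega> = Z n \<omega>)" (is "\<forall>n. \<exists>QZ. ?R n QZ")
      by (simp add: split_paired_Ex)
    then have "\<exists>F. \<forall>n. ?R n (F n)" by (rule choice)
    then obtain F where "\<And>n. ?R n (F n)" by blast
    then show thesis by (intro that[of "\<lambda>n. fst (F n)" "\<lambda>n. snd (F n)"]) simp_all
  qed
  have Q_lim: "AE \<omega> in M. (\<lambda>n. Q n \<omega>) \<longlonglongrightarrow> 0"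
    using lim unfolding Q_eq
  proof eventually_elim
    case (elim \<omega>)
    then show ?case using tendsto_ennreal_iff[of "\<lambda>n. Q n \<omega>" sequentially 0] Q_nonneg by auto
  qed
  have "(\<lambda>n. expectation (\<lambda>\<omega>. min 1 (Q n \<omega>))) \<longlonglongrightarrow> expectation (\<lambda>\<omega>. 0)"
  proof (rule integral_dominated_convergence[where w = "\<lambda>_. 1"])
    show "AE \<omega> in M. (\<lambda>n. min 1 (Q n \<omega>)) \<longlonglongrightarrow> 0"
      using Q_lim
    proof eventually_elim
      case (elim \<omega>)
      from tendsto_min[OF tendsto_const[of 1] elim] show ?case by simp
    qed
  qed (use Q_nonneg in auto)
  then have "(\<lambda>n. expectation (\<lambda>\<omega>. min 1 (Q n \<omega>))) \<longlonglongrightarrow> 0" by simp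
  then have "(\<lambda>n. expectation (\<lambda>\<omega>. norm ((Z' n \<omega>)\<^sup>2))) \<longlonglongrightarrow> 0"
    by (rule tendsto_sandwich[OF _ _ tendsto_const, rotated 2]) (use Z'_le in auto)
  from tendsto_L1_AE_subseq[OF Z'_int this] obtain r :: "nat \<Rightarrow> nat"
    where r: "strict_mono r" "AE \<omega> in M. (\<lambda>n. (Z' (r n) \<omega>)\<^sup>2) \<longlonglongrightarrow> 0" by blast
  have "AE \<omega> in M. (\<lambda>n. Z (r n) \<omega>) \<longlonglongrightarrow> 0"
    using r(2) Q_lim
  proof eventually_elim
    case (elim \<omega>)
    have "(\<lambda>n. Z' (r n) \<omega>) \<longlonglongrightarrow> 0"
      using tendsto_real_sqrt[OF elim(1)] by (simp add: tendsto_rabs_zero_iff)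
    moreover have "\<forall>\<^sub>F n in sequentially. Z' (r n) \<omega> = Z (r n) \<omega>"
    proof -
      have "(\<lambda>n. Q (r n) \<omega>) \<longlonglongrightarrow> 0" using LIMSEQ_subseq_LIMSEQ[OF elim(2) r(1)] by (simp add: comp_def)
      then have "\<forall>\<^sub>F n in sequentially. Q (r n) \<omega> < 1" by (rule order_tendstoD) simp
      then show ?thesis by eventually_elim (auto intro: Z'_eq)
    qed
    ultimately show ?case using tendsto_cong by fast
  qed
  with r(1) show ?thesis by blast
qed

end

section \<open>Riemann sums along a path\<close>

text \<open>The length is divided by \<open>Suc n\<close>, so that every \<open>n\<close> gives a
  genuine grid, with \<open>Suc n\<close> cells.\<close>

definition grid :: "real \<Rightarrow> real \<Rightarrow> nat \<Rightarrow> nat \<Rightarrow> real" where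
  "grid a b n i = a + (b - a) * real i / real (Suc n)"

text \<open>Cells are open on the left, like the blocks of an integrand, hence the ceiling. At
  \<open>s = a\<close> the truncation of \<open>nat\<close> gives 0; that point is a null
  set.\<close>

definition cell :: "real \<Rightarrow> real \<Rightarrow> nat \<Rightarrow> real \<Rightarrow> nat" where
  "cell a b n s = nat (\<lceil>(s - a) * real (Suc n) / (b - a)\<rceil> - 1)"

lemma grid_0 [simp]: "grid a b n 0 = a"
  by (simp add: grid_def)

lemma grid_Suc [simp]: "grid a b n (Suc n) = b"
  by (simp add: grid_def)

lemma grid_diff: "grid a b n (Suc i) - grid a b n i = (b - a) / real (Suc n)"
  unfolding grid_def by (simp only: add_diff_add diff_divide_distrib[symmetric] right_diff_distrib[symmetric]) simp

lemma grid_le_iff: "a < b \<Longrightarrow> grid a b n i \<le> grid a b n j \<longleftrightarrow> i \<le> j"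
  by (simp add: grid_def divide_le_cancel)

lemma grid_less_iff: "a < b \<Longrightarrow> grid a b n i < grid a b n j \<longleftrightarrow> i < j"
  using grid_le_iff[of a b n j i] by (simp add: not_le[symmetric])

lemma grid_in: "a < b \<Longrightarrow> i \<le> Suc n \<Longrightarrow> grid a b n i \<in> {a..b}"
  using grid_le_iff[of a b n 0 i] grid_le_iff[of a b n i "Suc n"] by simp

lemma cell_grid:
  assumes "a < b" "s \<in> {a<..b}"
  shows "cell a b n s < Suc n" "grid a b n (cell a b n s) < s" "s \<le> grid a b n (Suc (cell a b n s))"
proof -
  define x where "x = (s - a) * real (Suc n) / (b - a)"
  have x: "0 < x" "x \<le> real (Suc n)"
    using assms by (simp_all add: x_def pos_divide_le_eq mult_right_mono)
  have s: "s = a + (b - a) * x / real (Suc n)" using assms(1) by (simp add: x_def)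
  define k where "k = cell a b n s"
  have c: "\<lceil>x\<rceil> \<ge> 1" "\<lceil>x\<rceil> \<le> int (Suc n)" using x by (simp_all add: ceiling_le_iff)
  have k: "int k = \<lceil>x\<rceil> - 1" unfolding k_def cell_def x_def[symmetric] using c by simp
  then have k': "real k = of_int \<lceil>x\<rceil> - 1" by (metis of_int_1 of_int_diff of_int_of_nat_eq)
  have "real k < x" "x \<le> real (Suc k)" using ceiling_correct[of x] k' by simp_all
  then have "(b - a) * real k / real (Suc n) < (b - a) * x / real (Suc n)"
      "(b - a) * x / real (Suc n) \<le> (b - a) * real (Suc k) / real (Suc n)"
    using assms(1) by (intro divide_strict_right_mono mult_strict_left_mono divide_right_mono mult_left_mono; simp)+
  then show "grid a b n (cell a b n s) < s" "s \<le> grid a b n (Suc (cell a b n s))"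
    unfolding k_def[symmetric] grid_def by (simp_all only: s add_strict_left_mono add_left_mono)
  show "cell a b n s < Suc n" using k c by (simp add: k_def[symmetric])
qed

lemma cell_unique:
  assumes "a < b" "s \<in> {a<..b}"
  shows "s \<in> {grid a b n i<..grid a b n (Suc i)} \<longleftrightarrow> i = cell a b n s"
proof
  assume s: "s \<in> {grid a b n i<..grid a b n (Suc i)}"
  have "grid a b n i < grid a b n (Suc (cell a b n s))"
    "grid a b n (cell a b n s) < grid a b n (Suc i)"
    using s cell_grid[OF assms, of n] by auto
  then show "i = cell a b n s" using grid_less_iff[OF assms(1)] by simp
qed (use cell_grid[OF assms, of n] in auto)

lemma sum_indicator_cell:
  assumes "a < b" "s \<in> {a<..b}"
  shows "(\<Sum>i<Suc n. c i * indicator {grid a b n i<..grid a b n (Suc i)} s) = (c (cell a b n s) :: real)"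
proof -
  have "(\<Sum>i<Suc n. c i * indicator {grid a b n i<..grid a b n (Suc i)} s) =
      (\<Sum>i<Suc n. if i = cell a b n s then c i else 0)"
    by (intro sum.cong refl) (simp add: indicator_def cell_unique[OF assms] del: greaterThanAtMost_iff)
  also have "\<dots> = c (cell a b n s)" using cell_grid(1)[OF assms, of n] by simp
  finally show ?thesis .
qed

lemma measurable_cell [measurable]: "cell a b n \<in> measurable borel (count_space UNIV)"
  unfolding cell_def by measurable

lemma AE_Icc_from_Ioc: "(\<And>s. s \<in> {a<..b} \<Longrightarrow> P s) \<Longrightarrow> AE s in lborel. s \<in> {a..b::real} \<longrightarrow> P s"
  using AE_lborel_singleton[of a] by eventually_elim auto

text \<open>Riemann sums become integrals of step functions, so that their limits are instances of
  dominated convergence.\<close>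

lemma integral_cell:
  assumes "a < b"
  shows "(LBINT s:{a..b}. c (cell a b n s)) = (b - a) / real (Suc n) * (\<Sum>i<Suc n. c i)"
proof -
  have "(LBINT s:{a..b}. c (cell a b n s)) =
      (LBINT s. \<Sum>i<Suc n. c i * indicator {grid a b n i<..grid a b n (Suc i)} s)"
    unfolding set_lebesgue_integral_def
  proof (rule integral_cong_AE)
    show "AE s in lborel. indicator {a..b} s *\<^sub>R c (cell a b n s) =
        (\<Sum>i<Suc n. c i * indicator {grid a b n i<..grid a b n (Suc i)} s)"
      using AE_lborel_singleton[of a]
    proof eventually_elim
      case (elim s)
      show ?case
      proof (cases "s \<in> {a<..b}")
        case True
        then show ?thesis using sum_indicator_cell[OF assms True, of c n] by simp
      next
        case False
        have "{grid a b n i<..grid a b n (Suc i)} \<subseteq> {a<..b}" if "i < Suc n" for i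
          using grid_in[OF assms, of i n] grid_in[OF assms, of "Suc i" n] that by auto
        then have "(\<Sum>i<Suc n. c i * indicator {grid a b n i<..grid a b n (Suc i)} s) = 0"
          using False by (intro sum.neutral ballI) (auto simp: indicator_def subset_eq simp del: greaterThanAtMost_iff)
        then show ?thesis using False elim by auto
      qed
    qed
  qed measurable
  also have "\<dots> = (\<Sum>i<Suc n. c i * (grid a b n (Suc i) - grid a b n i))"
    using grid_le_iff[OF assms, of n] by (subst Bochner_Integration.integral_sum) auto
  also have "\<dots> = (b - a) / real (Suc n) * (\<Sum>i<Suc n. c i)"
    unfolding grid_diff sum_distrib_left by (simp only: mult.commute)
  finally show ?thesis .
qed

lemma tendsto_grid_cell:
  assumes "a < b" "s \<in> {a<..b}"
  shows "(\<lambda>n. grid a b n (cell a b n s)) \<longlonglongrightarrow> s"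
proof (rule tendsto_sandwich)
  have "(\<lambda>n. (b - a) / real (Suc n)) \<longlonglongrightarrow> 0"
    using tendsto_mult[OF tendsto_const[of "b - a"] LIMSEQ_inverse_real_of_nat] by (simp add: divide_inverse)
  from tendsto_diff[OF tendsto_const[of s] this] show "(\<lambda>n. s - (b - a) / real (Suc n)) \<longlonglongrightarrow> s" by simp
  show "\<forall>\<^sub>F n in sequentially. s - (b - a) / real (Suc n) \<le> grid a b n (cell a b n s)"
  proof (intro always_eventually allI)
    fix n
    show "s - (b - a) / real (Suc n) \<le> grid a b n (cell a b n s)"
      using cell_grid(3)[OF assms, of n] grid_diff[of a b n "cell a b n s"] by linarith
  qed
  show "\<forall>\<^sub>F n in sequentially. grid a b n (cell a b n s) \<le> s"
    using cell_grid(2)[OF assms] by (intro always_eventually allI less_imp_le)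
qed simp

lemma grid_cell_in: "a < b \<Longrightarrow> s \<in> {a<..b} \<Longrightarrow> grid a b n (cell a b n s) \<in> {a..b}"
  using cell_grid(1)[of a b s n] by (intro grid_in) auto

lemma tendsto_along_grid:
  fixes f :: "real \<Rightarrow> 'b::topological_space"
  assumes "a < b" "s \<in> {a<..b}" "continuous_on {a..b} f"
  shows "(\<lambda>n. f (grid a b n (cell a b n s))) \<longlonglongrightarrow> f s"
  by (rule continuous_on_tendsto_compose[OF assms(3) tendsto_grid_cell[OF assms(1,2)]])
    (use grid_cell_in assms in auto)

lemma set_integral_tendsto_bounded:
  fixes f :: "nat \<Rightarrow> real \<Rightarrow> real"
  assumes "\<And>n. f n \<in> borel_measurable borel" "f0 \<in> borel_measurable borel"
    and lim: "AE s in lborel. s \<in> {a..b} \<longrightarrow> (\<lambda>n. f n s) \<longlonglongrightarrow> f0 s"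
    and bnd: "\<And>n. AE s in lborel. s \<in> {a..b} \<longrightarrow> \<bar>f n s\<bar> \<le> C"
  shows "(\<lambda>n. LBINT s:{a..b}. f n s) \<longlonglongrightarrow> (LBINT s:{a..b}. f0 s)"
  unfolding set_lebesgue_integral_def
proof (rule integral_dominated_convergence[where w = "\<lambda>s. indicator {a..b} s * C"])
  show "integrable lborel (\<lambda>s. indicator {a..b} s * C)"
    by (intro integrable_mult_left integrable_real_indicator) (auto simp: emeasure_lborel_Icc_eq)
  show "AE s in lborel. (\<lambda>n. indicator {a..b} s *\<^sub>R f n s) \<longlonglongrightarrow> indicator {a..b} s *\<^sub>R f0 s"
    using lim by eventually_elim (auto simp: indicator_def)
  show "AE s in lborel. norm (indicator {a..b} s *\<^sub>R f n s) \<le> indicator {a..b} s * C" for n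
    using bnd[of n] by eventually_elim (auto simp: indicator_def)
qed (use assms in auto)

lemma continuous_on_compact_bound:
  fixes f :: "'b::topological_space \<Rightarrow> real"
  assumes "continuous_on S f" "compact S"
  obtains C where "0 \<le> C" "\<And>x. x \<in> S \<Longrightarrow> \<bar>f x\<bar> \<le> C"
proof -
  have "bounded (f ` S)" using compact_continuous_image[OF assms] compact_imp_bounded by blast
  then obtain C where "\<forall>y\<in>f ` S. norm y \<le> C" unfolding bounded_iff by blast
  then show thesis by (intro that[of "max 0 C"]) auto
qed

lemma borel_measurable_on_Icc:
  fixes f :: "real \<Rightarrow> real"
  assumes "continuous_on {a..b} f"
  shows "(\<lambda>s. if s \<in> {a..b} then f s else 0) \<in> borel_measurable borel"
proof -
  have "(\<lambda>s. if s \<in> {a..b} then f s else 0) = (\<lambda>s. indicator {a..b} s *\<^sub>R f s)" by auto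
  then show ?thesis using borel_measurable_continuous_on_indicator[OF _ assms] by simp
qed

lemma riemann_sum_tendsto:
  fixes f :: "real \<Rightarrow> real"
  assumes "a < b" "continuous_on {a..b} f"
  shows "(\<lambda>n. (b - a) / real (Suc n) * (\<Sum>i<Suc n. f (grid a b n i))) \<longlonglongrightarrow> (LBINT s:{a..b}. f s)"
proof -
  obtain C where C: "\<And>x. x \<in> {a..b} \<Longrightarrow> \<bar>f x\<bar> \<le> C"
    using continuous_on_compact_bound[OF assms(2)] by auto
  let ?f = "\<lambda>s. if s \<in> {a..b} then f s else 0"
  have "(\<lambda>n. LBINT s:{a..b}. f (grid a b n (cell a b n s))) \<longlonglongrightarrow> (LBINT s:{a..b}. ?f s)"
  proof (rule set_integral_tendsto_bounded)
    show "?f \<in> borel_measurable borel" by (rule borel_measurable_on_Icc[OF assms(2)])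
    show "AE s in lborel. s \<in> {a..b} \<longrightarrow> (\<lambda>n. f (grid a b n (cell a b n s))) \<longlonglongrightarrow> ?f s"
      using tendsto_along_grid[OF assms(1) _ assms(2)] by (intro AE_Icc_from_Ioc) auto
    show "AE s in lborel. s \<in> {a..b} \<longrightarrow> \<bar>f (grid a b n (cell a b n s))\<bar> \<le> C" for n
      by (intro AE_Icc_from_Ioc C grid_cell_in) (use assms in auto)
  qed measurable
  also have "(LBINT s:{a..b}. ?f s) = (LBINT s:{a..b}. f s)"
    by (intro set_lebesgue_integral_cong) auto
  finally show ?thesis
    using integral_cell[OF assms(1), of "\<lambda>i. f (grid a b _ i)"] by simp
qed

section \<open>Averages over the past of a path\<close>

lemma eventually_less_of_limits:
  fixes X Y :: "nat \<Rightarrow> real"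
  assumes "X \<longlonglongrightarrow> x" "Y \<longlonglongrightarrow> y" "x < y"
  shows "\<forall>\<^sub>F n in sequentially. X n < Y n"
  using order_tendstoD(1)[OF tendsto_diff[OF assms(2,1)], of 0] assms(3) by simp

text \<open>The grid version of the integral of \<open>f (b s - b r)\<close> over
  \<open>r \<le> s\<close>, using the path only up to the left end of the cell. The diagonal term
  \<open>j = i\<close> is what lets the triangular sum telescope down to \<open>G 0\<close>.\<close>

definition past_average :: "(real \<Rightarrow> real) \<Rightarrow> (real \<Rightarrow> real) \<Rightarrow> real \<Rightarrow> nat \<Rightarrow> nat \<Rightarrow> real" where
  "past_average f b T n i = T / real (Suc n) * (\<Sum>j\<le>i. f (b (grid 0 T n i) - b (grid 0 T n j)))"

lemma past_average_bound:
  assumes "0 < T" "\<And>x. \<bar>f x\<bar> \<le> C" "i < Suc n"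
  shows "\<bar>past_average f b T n i\<bar> \<le> T * C"
proof -
  have C: "0 \<le> C" using assms(2)[of 0] by simp
  have "\<bar>\<Sum>j\<le>i. f (b (grid 0 T n i) - b (grid 0 T n j))\<bar> \<le> (\<Sum>j\<le>i. C)"
    by (intro order_trans[OF sum_abs] sum_mono assms(2))
  also have "\<dots> \<le> real (Suc n) * C" using assms(3) C by (simp add: mult_right_mono)
  finally have "T / real (Suc n) * \<bar>\<Sum>j\<le>i. f (b (grid 0 T n i) - b (grid 0 T n j))\<bar> \<le>
      T / real (Suc n) * (real (Suc n) * C)"
    using assms(1) by (intro mult_left_mono) auto
  then show ?thesis
    using assms(1) by (simp add: past_average_def abs_mult del: of_nat_Suc)
qed

lemma past_average_tendsto:
  fixes f b :: "real \<Rightarrow> real"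
  assumes T: "0 < T" and b: "continuous_on {0..T} b" and f: "continuous_on UNIV f"
    and C: "\<And>x. \<bar>f x\<bar> \<le> C" and s: "s \<in> {0<..T}"
  shows "(\<lambda>n. past_average f b T n (cell 0 T n s)) \<longlonglongrightarrow> (LBINT r:{0..s}. f (b s - b r))"
proof -
  let ?c = "\<lambda>n. cell 0 T n" and ?g = "\<lambda>n. grid 0 T n"
  \<comment> \<open>With the condition \<open>r \<le> s\<close> written as an inequality of cells,
    the domain of integration no longer depends on \<open>s\<close>.\<close>
  let ?\<phi> = "\<lambda>n r. if ?c n r \<le> ?c n s then f (b (?g n (?c n s)) - b (?g n (?c n r))) else 0"
  let ?\<psi> = "\<lambda>r. if r \<in> {0..s} then f (b s - b r) else 0"
  have C0: "0 \<le> C" using C[of 0] by simp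
  have eq: "past_average f b T n (?c n s) = (LBINT r:{0..T}. ?\<phi> n r)" for n
  proof -
    have "(\<Sum>j\<le>?c n s. f (b (?g n (?c n s)) - b (?g n j))) =
        (\<Sum>j<Suc n. if j \<le> ?c n s then f (b (?g n (?c n s)) - b (?g n j)) else 0)"
      using cell_grid(1)[OF T s, of n] by (intro sum.mono_neutral_cong_left) auto
    then show ?thesis
      using integral_cell[OF T, of "\<lambda>j. if j \<le> ?c n s then f (b (?g n (?c n s)) - b (?g n j)) else 0" n]
      by (simp add: past_average_def)
  qed
  have fcont: "(\<lambda>n. f (X n)) \<longlonglongrightarrow> f x" if "X \<longlonglongrightarrow> x" for X x
    using continuous_on_tendsto_compose[OF f that] by simp
  have "(\<lambda>n. LBINT r:{0..T}. ?\<phi> n r) \<longlonglongrightarrow> (LBINT r:{0..T}. ?\<psi> r)"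
  proof (rule set_integral_tendsto_bounded)
    show "?\<psi> \<in> borel_measurable borel"
    proof (rule borel_measurable_on_Icc)
      have "continuous_on {0..s} b" using b s by (auto intro: continuous_on_subset)
      then show "continuous_on {0..s} (\<lambda>r. f (b s - b r))"
        by (intro continuous_on_compose2[OF f] continuous_intros) auto
    qed
    \<comment> \<open>Away from \<open>r = s\<close> the comparison of the two cells is eventually
      that of \<open>r\<close> and \<open>s\<close>, since the grid points converge to them.\<close>
    show "AE r in lborel. r \<in> {0..T} \<longrightarrow> (\<lambda>n. ?\<phi> n r) \<longlonglongrightarrow> ?\<psi> r"
      using AE_lborel_singleton[of 0] AE_lborel_singleton[of s]
    proof (eventually_elim, intro impI)
      fix r assume "r \<noteq> 0" "r \<noteq> s" "r \<in> {0..T}"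
      then have r: "r \<in> {0<..T}" by auto
      have *: "(\<lambda>n. f (b (?g n (?c n s)) - b (?g n (?c n r)))) \<longlonglongrightarrow> f (b s - b r)"
        by (intro fcont tendsto_diff tendsto_along_grid[OF T _ b] r s)
      show "(\<lambda>n. ?\<phi> n r) \<longlonglongrightarrow> ?\<psi> r"
      proof (cases "r < s")
        case True
        have "\<forall>\<^sub>F n in sequentially. ?g n (?c n r) < ?g n (?c n s)"
          by (rule eventually_less_of_limits[OF tendsto_grid_cell[OF T r] tendsto_grid_cell[OF T s] True])
        then have "\<forall>\<^sub>F n in sequentially. f (b (?g n (?c n s)) - b (?g n (?c n r))) = ?\<phi> n r"
          by eventually_elim (auto simp: grid_less_iff[OF T])
        then show ?thesis using * True r by (simp add: tendsto_cong)
      next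
        case False
        then have "s < r" using \<open>r \<noteq> s\<close> by simp
        then have "\<forall>\<^sub>F n in sequentially. ?g n (?c n s) < ?g n (?c n r)"
          using eventually_less_of_limits[OF tendsto_grid_cell[OF T s] tendsto_grid_cell[OF T r]] by simp
        then have "\<forall>\<^sub>F n in sequentially. ?\<phi> n r = 0"
          by eventually_elim (auto simp: grid_less_iff[OF T])
        then have "(\<lambda>n. ?\<phi> n r) \<longlonglongrightarrow> 0" by (rule tendsto_eventually)
        then show ?thesis using \<open>s < r\<close> by simp
      qed
    qed
    show "AE r in lborel. r \<in> {0..T} \<longrightarrow> \<bar>?\<phi> n r\<bar> \<le> C" for n
      using C C0 by auto
  qed measurable
  also have "(LBINT r:{0..T}. ?\<psi> r) = (LBINT r:{0..s}. f (b s - b r))"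
    unfolding set_lebesgue_integral_def
    by (intro Bochner_Integration.integral_cong refl) (use s in \<open>auto simp: indicator_def\<close>)
  finally show ?thesis unfolding eq .
qed

text \<open>A pointwise limit of step functions; the point 0 is left out because cells are open on
  the left.\<close>

lemma borel_measurable_past_integral:
  fixes f b :: "real \<Rightarrow> real"
  assumes T: "0 < T" and b: "continuous_on {0..T} b" and f: "continuous_on UNIV f"
    and C: "\<And>x. \<bar>f x\<bar> \<le> C"
  shows "(\<lambda>s. if s \<in> {0<..T} then LBINT r:{0..s}. f (b s - b r) else 0) \<in> borel_measurable borel"
proof (rule borel_measurable_LIMSEQ_metric)
  show "(\<lambda>s. if s \<in> {0<..T} then past_average f b T n (cell 0 T n s) else 0) \<in> borel_measurable borel" for n
    by measurable
  show "(\<lambda>n. if s \<in> {0<..T} then past_average f b T n (cell 0 T n s) else 0)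
      \<longlonglongrightarrow> (if s \<in> {0<..T} then LBINT r:{0..s}. f (b s - b r) else 0)" for s
    using past_average_tendsto[OF assms, of s] by auto
qed

lemma riemann_sum_past_average_tendsto:
  fixes f b :: "real \<Rightarrow> real"
  assumes T: "0 < T" and b: "continuous_on {0..T} b" and f: "continuous_on UNIV f"
    and C: "\<And>x. \<bar>f x\<bar> \<le> C"
  shows "(\<lambda>n. T / real (Suc n) * (\<Sum>i<Suc n. past_average f b T n i))
    \<longlonglongrightarrow> (LBINT s:{0..T}. LBINT r:{0..s}. f (b s - b r))"
proof -
  let ?h = "\<lambda>s. LBINT r:{0..s}. f (b s - b r)"
  let ?k = "\<lambda>s. if s \<in> {0<..T} then ?h s else 0"
  have "(\<lambda>n. LBINT s:{0..T}. past_average f b T n (cell 0 T n s)) \<longlonglongrightarrow> (LBINT s:{0..T}. ?k s)"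
  proof (rule set_integral_tendsto_bounded)
    show "?k \<in> borel_measurable borel" by (rule borel_measurable_past_integral[OF assms])
    show "AE s in lborel. s \<in> {0..T} \<longrightarrow> (\<lambda>n. past_average f b T n (cell 0 T n s)) \<longlonglongrightarrow> ?k s"
      using past_average_tendsto[OF assms] by (intro AE_Icc_from_Ioc) auto
    show "AE s in lborel. s \<in> {0..T} \<longrightarrow> \<bar>past_average f b T n (cell 0 T n s)\<bar> \<le> T * C" for n
      using past_average_bound[OF T C] cell_grid(1)[OF T] by (intro AE_Icc_from_Ioc) auto
  qed measurable
  also have "(LBINT s:{0..T}. ?k s) = (LBINT s:{0..T}. ?h s)"
  proof (intro set_lebesgue_integral_cong allI impI)
    fix s assume "s \<in> {0..T}"
    moreover have "?h 0 = 0"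
      unfolding set_lebesgue_integral_def
      by (rule integral_eq_zero_AE) (use AE_lborel_singleton[of 0] in eventually_elim, auto)
    ultimately show "?k s = ?h s" by (cases "s = 0") auto
  qed simp
  finally show ?thesis using integral_cell[OF T, of "past_average f b T _"] by simp
qed

section \<open>Ito's formula along a path\<close>

text \<open>The Lagrange remainder differs from the second order term by an increment of
  \<open>g'\<close> over a distance below \<delta>. So a modulus of continuity of \<open>g'\<close>
  suffices, which matters because the test functions are only \<open>C^1\<close>.\<close>

lemma second_order_remainder:
  fixes G g g' :: "real \<Rightarrow> real"
  assumes G: "\<And>x. (G has_real_derivative g x) (at x)" and g: "\<And>x. (g has_real_derivative g' x) (at x)"
    and close: "\<And>u v. \<bar>u - v\<bar> < \<delta> \<Longrightarrow> \<bar>g' u - g' v\<bar> \<le> \<epsilon>" and h: "\<bar>h\<bar> < \<delta>"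
  shows "\<bar>G (y + h) - G y - g y * h - g' y * h\<^sup>2 / 2\<bar> \<le> \<epsilon> * h\<^sup>2 / 2"
proof (cases "h = 0")
  case False
  define d where "d m = (if m = 0 then G else if m = 1 then g else g')" for m :: nat
  have "\<exists>t. (if y + h < y then y + h < t \<and> t < y else y < t \<and> t < y + h) \<and>
     G (y + h) = (\<Sum>m<2. d m y / fact m * (y + h - y) ^ m) + d 2 t / fact 2 * (y + h - y) ^ 2"
    by (rule Taylor[where a = "min y (y + h)" and b = "max y (y + h)"])
      (use False G g in \<open>auto simp: d_def less_Suc_eq numeral_2_eq_2\<close>)
  then obtain t where "if y + h < y then y + h < t \<and> t < y else y < t \<and> t < y + h"
     "G (y + h) = (\<Sum>m<2. d m y / fact m * (y + h - y) ^ m) + d 2 t / fact 2 * (y + h - y) ^ 2" by blast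
  then have t: "\<bar>t - y\<bar> < \<bar>h\<bar>" "G (y + h) = G y + g y * h + g' t * h\<^sup>2 / 2"
    by (auto simp: d_def numeral_2_eq_2 split: if_splits)
  have "\<bar>g' t - g' y\<bar> \<le> \<epsilon>" using close t(1) h by force
  then have "\<bar>(g' t - g' y) * h\<^sup>2 / 2\<bar> \<le> \<epsilon> * h\<^sup>2 / 2"
    by (simp add: abs_mult mult_right_mono)
  moreover have "(g' t - g' y) * h\<^sup>2 / 2 = G (y + h) - G y - g y * h - g' y * h\<^sup>2 / 2"
    using t(2) by (simp add: field_simps)
  ultimately show ?thesis by simp
qed simp

text \<open>Summed by columns: column \<open>j\<close> starts on the diagonal at
  \<open>i = j\<close> and telescopes from \<open>F j j\<close> to \<open>F N j\<close>.\<close>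

lemma triangular_sum_telescope:
  fixes F :: "nat \<Rightarrow> nat \<Rightarrow> real"
  shows "(\<Sum>i<N. \<Sum>j\<le>i. F (Suc i) j - F i j) = (\<Sum>j<N. F N j - F j j)"
proof (induction N)
  case (Suc N)
  have "(\<Sum>j<N. F N j - F j j) + (\<Sum>j\<le>N. F (Suc N) j - F N j) = (\<Sum>j<N. F (Suc N) j - F j j) + (F (Suc N) N - F N N)"
    by (simp add: lessThan_Suc_atMost[symmetric] sum.distrib[symmetric])
  then show ?case using Suc by simp
qed simp

text \<open>Expand \<open>G (y (Suc i) - y j) - G (y i - y j)\<close> for all
  \<open>j \<le> i\<close> and sum over the triangle: the left side telescopes, and each sum over
  \<open>j\<close> becomes a past average. For each \<open>i\<close> there are at most
  \<open>Suc n\<close> remainders, and the factor \<open>T / real (Suc n)\<close> reduces them to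
  the constant \<open>\<epsilon> * T / 2\<close>.\<close>

lemma discrete_ito:
  fixes G g g' b :: "real \<Rightarrow> real"
  assumes T: "0 < T"
    and G: "\<And>x. (G has_real_derivative g x) (at x)" and g: "\<And>x. (g has_real_derivative g' x) (at x)"
    and close: "\<And>u v. \<bar>u - v\<bar> < \<delta> \<Longrightarrow> \<bar>g' u - g' v\<bar> \<le> \<epsilon>"
  defines "x \<equiv> \<lambda>n i. b (grid 0 T n i)"
  assumes small: "\<And>i. i < Suc n \<Longrightarrow> \<bar>x n (Suc i) - x n i\<bar> < \<delta>"
  shows "\<bar>(\<Sum>i<Suc n. past_average g b T n i * (x n (Suc i) - x n i)) -
      (T / real (Suc n) * (\<Sum>j<Suc n. G (b T - x n j) - G 0) -
       1/2 * (\<Sum>i<Suc n. past_average g' b T n i * (x n (Suc i) - x n i)\<^sup>2))\<bar>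
    \<le> \<epsilon> * T / 2 * (\<Sum>i<Suc n. (x n (Suc i) - x n i)\<^sup>2)"
proof -
  define \<Delta> where "\<Delta> = T / real (Suc n)"
  define y where "y = x n"
  have \<Delta>: "0 \<le> \<Delta>" "\<Delta> * real (Suc n) = T" using T by (simp_all add: \<Delta>_def del: of_nat_Suc)
  have yT: "y (Suc n) = b T" by (simp add: y_def x_def)
  have \<epsilon>: "0 \<le> \<epsilon>" using close[of 0 0] small[of 0] by force
  define R where "R i j = G (y (Suc i) - y j) - G (y i - y j) - g (y i - y j) * (y (Suc i) - y i) -
    g' (y i - y j) * (y (Suc i) - y i)\<^sup>2 / 2" for i j
  have R: "\<bar>R i j\<bar> \<le> \<epsilon> * (y (Suc i) - y i)\<^sup>2 / 2" if "i < Suc n" for i j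
    using second_order_remainder[OF G g close small[OF that], where y = "y i - y j"]
    by (simp add: R_def y_def)
  have "(\<Sum>j<Suc n. G (y (Suc n) - y j) - G (y j - y j)) =
      (\<Sum>i<Suc n. \<Sum>j\<le>i. G (y (Suc i) - y j) - G (y i - y j))"
    by (rule triangular_sum_telescope[symmetric])
  also have "\<dots> = (\<Sum>i<Suc n. \<Sum>j\<le>i. R i j + (g (y i - y j) * (y (Suc i) - y i) + 1/2 * (g' (y i - y j) * (y (Suc i) - y i)\<^sup>2)))"
    by (simp add: R_def)
  also have "\<dots> = (\<Sum>i<Suc n. \<Sum>j\<le>i. R i j) + ((\<Sum>i<Suc n. (\<Sum>j\<le>i. g (y i - y j)) * (y (Suc i) - y i)) +
      1/2 * (\<Sum>i<Suc n. (\<Sum>j\<le>i. g' (y i - y j)) * (y (Suc i) - y i)\<^sup>2))"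
    by (simp only: sum.distrib sum_distrib_left sum_distrib_right)
  finally have "(\<Sum>j<Suc n. G (b T - y j) - G 0) = \<dots>" by (simp only: yT diff_self)
  moreover have "(\<Sum>i<Suc n. past_average g b T n i * (y (Suc i) - y i)) =
      \<Delta> * (\<Sum>i<Suc n. (\<Sum>j\<le>i. g (y i - y j)) * (y (Suc i) - y i))"
    by (simp only: past_average_def \<Delta>_def y_def x_def sum_distrib_left[of _ _ "{..<Suc n}"] mult.assoc)
  moreover have "(\<Sum>i<Suc n. past_average g' b T n i * (y (Suc i) - y i)\<^sup>2) =
      \<Delta> * (\<Sum>i<Suc n. (\<Sum>j\<le>i. g' (y i - y j)) * (y (Suc i) - y i)\<^sup>2)"
    by (simp only: past_average_def \<Delta>_def y_def x_def sum_distrib_left[of _ _ "{..<Suc n}"] mult.assoc)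
  ultimately have "\<Delta> * (\<Sum>j<Suc n. G (b T - y j) - G 0) = \<Delta> * (\<Sum>i<Suc n. \<Sum>j\<le>i. R i j) +
      ((\<Sum>i<Suc n. past_average g b T n i * (y (Suc i) - y i)) +
       1/2 * (\<Sum>i<Suc n. past_average g' b T n i * (y (Suc i) - y i)\<^sup>2))"
    by (simp only: distrib_left mult.left_commute)
  then have "(\<Sum>i<Suc n. past_average g b T n i * (y (Suc i) - y i)) -
      (\<Delta> * (\<Sum>j<Suc n. G (b T - y j) - G 0) -
       1/2 * (\<Sum>i<Suc n. past_average g' b T n i * (y (Suc i) - y i)\<^sup>2)) = - (\<Delta> * (\<Sum>i<Suc n. \<Sum>j\<le>i. R i j))"
    by (simp only: algebra_simps)
  moreover have "\<bar>\<Delta> * (\<Sum>i<Suc n. \<Sum>j\<le>i. R i j)\<bar> \<le> \<epsilon> * T / 2 * (\<Sum>i<Suc n. (y (Suc i) - y i)\<^sup>2)"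
  proof -
    have "\<bar>\<Sum>i<Suc n. \<Sum>j\<le>i. R i j\<bar> \<le> (\<Sum>i<Suc n. real (Suc n) * (\<epsilon> * (y (Suc i) - y i)\<^sup>2 / 2))"
    proof (rule order_trans[OF sum_abs], rule sum_mono)
      fix i assume i: "i \<in> {..<Suc n}"
      have "\<bar>\<Sum>j\<le>i. R i j\<bar> \<le> (\<Sum>j\<le>i. \<epsilon> * (y (Suc i) - y i)\<^sup>2 / 2)"
        using R i by (intro order_trans[OF sum_abs] sum_mono) auto
      also have "\<dots> = real (Suc i) * (\<epsilon> * (y (Suc i) - y i)\<^sup>2 / 2)" by simp
      also have "\<dots> \<le> real (Suc n) * (\<epsilon> * (y (Suc i) - y i)\<^sup>2 / 2)"
        using i \<epsilon> by (intro mult_right_mono) auto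
      finally show "\<bar>\<Sum>j\<le>i. R i j\<bar> \<le> real (Suc n) * (\<epsilon> * (y (Suc i) - y i)\<^sup>2 / 2)" .
    qed
    then have "\<Delta> * \<bar>\<Sum>i<Suc n. \<Sum>j\<le>i. R i j\<bar> \<le> \<Delta> * (\<Sum>i<Suc n. real (Suc n) * (\<epsilon> * (y (Suc i) - y i)\<^sup>2 / 2))"
      using \<Delta>(1) by (rule mult_left_mono)
    also have "\<dots> = (\<Delta> * real (Suc n)) * (\<epsilon> / 2) * (\<Sum>i<Suc n. (y (Suc i) - y i)\<^sup>2)"
      unfolding sum_distrib_left by (intro sum.cong refl) (simp only: mult.assoc times_divide_eq_left times_divide_eq_right)
    finally show ?thesis unfolding \<Delta>(2) using \<Delta>(1) by (simp add: abs_mult mult.commute)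
  qed
  ultimately show ?thesis unfolding y_def \<Delta>_def by simp
qed

text \<open>A statement about a single path: chance enters only through \<open>qv\<close> and
  \<open>qv'\<close>. The first bounds the sum of squared increments and with it the Taylor error;
  the second replaces squared increments by \<open>T / real (Suc (r n))\<close>, which turns the
  correction term into a Riemann sum of the double integral. A subsequence is allowed since both
  will be obtained almost surely only along one.\<close>

lemma ito_formula_along_path:
  fixes G g g' b :: "real \<Rightarrow> real"
  assumes T: "0 < T" and b: "continuous_on {0..T} b"
    and G: "\<And>x. (G has_real_derivative g x) (at x)" and g: "\<And>x. (g has_real_derivative g' x) (at x)"
    and g': "uniformly_continuous_on UNIV g'" "\<And>x. \<bar>g' x\<bar> \<le> C"
    and r: "strict_mono (r :: nat \<Rightarrow> nat)"
  defines "x \<equiv> \<lambda>n i. b (grid 0 T n i)"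
  assumes qv: "(\<lambda>n. \<Sum>i<Suc (r n). (x (r n) (Suc i) - x (r n) i)\<^sup>2 - T / real (Suc (r n))) \<longlonglongrightarrow> 0"
    and qv': "(\<lambda>n. \<Sum>i<Suc (r n). past_average g' b T (r n) i *
      ((x (r n) (Suc i) - x (r n) i)\<^sup>2 - T / real (Suc (r n)))) \<longlonglongrightarrow> 0"
  shows "(\<lambda>n. \<Sum>i<Suc (r n). past_average g b T (r n) i * (x (r n) (Suc i) - x (r n) i)) \<longlonglongrightarrow>
    (LBINT u:{0..T}. G (b T - b u) - G 0) - 1/2 * (LBINT s:{0..T}. LBINT u:{0..s}. g' (b s - b u))"
proof -
  define S where "S n = (\<Sum>i<Suc n. past_average g b T n i * (x n (Suc i) - x n i))" for n
  define V where "V n = T / real (Suc n) * (\<Sum>j<Suc n. G (b T - x n j) - G 0) -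
       1/2 * (\<Sum>i<Suc n. past_average g' b T n i * (x n (Suc i) - x n i)\<^sup>2)" for n
  define W where "W n = (\<Sum>i<Suc n. (x n (Suc i) - x n i)\<^sup>2)" for n
  have "(\<lambda>n. W (r n) - T) \<longlonglongrightarrow> 0"
    using qv by (simp add: W_def sum_subtractf del: of_nat_Suc)
  then have W: "(\<lambda>n. W (r n)) \<longlonglongrightarrow> T" by (simp add: LIM_zero_iff)
  have contG: "continuous_on A G" for A
    using G by (intro DERIV_continuous_on) (auto intro: has_field_derivative_at_within)
  have "continuous_on {0..T} (\<lambda>u. G (b T - b u) - G 0)"
    by (intro continuous_intros continuous_on_compose2[OF contG] b) auto
  from LIMSEQ_subseq_LIMSEQ[OF riemann_sum_tendsto[OF T this] r]
  have l1: "(\<lambda>n. T / real (Suc (r n)) * (\<Sum>j<Suc (r n). G (b T - x (r n) j) - G 0)) \<longlonglongrightarrow>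
      (LBINT u:{0..T}. G (b T - b u) - G 0)"
    by (simp add: comp_def x_def del: of_nat_Suc sum.lessThan_Suc)
  from LIMSEQ_subseq_LIMSEQ[OF riemann_sum_past_average_tendsto[OF T b
      uniformly_continuous_imp_continuous[OF g'(1)] g'(2)] r]
  have "(\<lambda>n. T / real (Suc (r n)) * (\<Sum>i<Suc (r n). past_average g' b T (r n) i)) \<longlonglongrightarrow>
      (LBINT s:{0..T}. LBINT u:{0..s}. g' (b s - b u))"
    by (simp add: comp_def del: of_nat_Suc sum.lessThan_Suc)
  from tendsto_add[OF qv' this]
  have "(\<lambda>n. \<Sum>i<Suc (r n). past_average g' b T (r n) i * (x (r n) (Suc i) - x (r n) i)\<^sup>2) \<longlonglongrightarrow>
      (LBINT s:{0..T}. LBINT u:{0..s}. g' (b s - b u))"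
    by (simp add: right_diff_distrib sum_subtractf sum_distrib_left mult.commute del: of_nat_Suc sum.lessThan_Suc)
  from tendsto_diff[OF l1 tendsto_mult[OF tendsto_const[of "1/2"] this]]
  have V: "(\<lambda>n. V (r n)) \<longlonglongrightarrow>
    (LBINT u:{0..T}. G (b T - b u) - G 0) - 1/2 * (LBINT s:{0..T}. LBINT u:{0..s}. g' (b s - b u))"
    by (simp add: V_def del: of_nat_Suc sum.lessThan_Suc)
  have "(\<lambda>n. S (r n) - V (r n)) \<longlonglongrightarrow> 0"
  proof (rule LIMSEQ_I)
    fix e :: real assume e: "0 < e"
    \<comment> \<open>Chosen so that the error \<open>\<epsilon> * T / 2 * (T + 1)\<close> equals
      \<open>e / 2\<close> once the squared increments sum to less than
      \<open>T + 1\<close>.\<close>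
    define \<epsilon> where "\<epsilon> = e / (T * (T + 1))"
    have \<epsilon>: "\<epsilon> > 0" using e T by (simp add: \<epsilon>_def)
    obtain \<delta> where \<delta>: "\<delta> > 0" "\<And>u v. \<bar>u - v\<bar> < \<delta> \<Longrightarrow> \<bar>g' u - g' v\<bar> < \<epsilon>"
      using g'(1) \<epsilon> unfolding uniformly_continuous_on_def dist_real_def by (metis UNIV_I)
    obtain \<gamma> where \<gamma>: "\<gamma> > 0" "\<And>u v. u \<in> {0..T} \<Longrightarrow> v \<in> {0..T} \<Longrightarrow> \<bar>u - v\<bar> < \<gamma> \<Longrightarrow> \<bar>b u - b v\<bar> < \<delta>"
      using compact_uniformly_continuous[OF b] \<delta>(1) unfolding uniformly_continuous_on_def dist_real_def
      by (metis compact_Icc)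
    have "(\<lambda>n. T / real (Suc n)) \<longlonglongrightarrow> 0"
      using tendsto_mult[OF tendsto_const[of T] LIMSEQ_inverse_real_of_nat] by (simp add: divide_inverse)
    from LIMSEQ_subseq_LIMSEQ[OF this r] have "\<forall>\<^sub>F n in sequentially. T / real (Suc (r n)) < \<gamma>"
      using order_tendstoD(2) \<gamma>(1) by (auto simp: comp_def)
    moreover have "\<forall>\<^sub>F n in sequentially. W (r n) < T + 1"
      by (rule order_tendstoD(2)[OF W]) simp
    ultimately have "\<forall>\<^sub>F n in sequentially. norm (S (r n) - V (r n) - 0) < e"
    proof eventually_elim
      case (elim n)
      have close: "\<bar>g' u - g' v\<bar> \<le> \<epsilon>" if "\<bar>u - v\<bar> < \<delta>" for u v
        using \<delta>(2)[OF that] by simp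
      have "\<bar>x (r n) (Suc i) - x (r n) i\<bar> < \<delta>" if "i < Suc (r n)" for i
        unfolding x_def
      proof (rule \<gamma>(2))
        show "\<bar>grid 0 T (r n) (Suc i) - grid 0 T (r n) i\<bar> < \<gamma>"
          using elim(1) T grid_diff[of 0 T "r n" i] by simp
      qed (use that in \<open>intro grid_in[OF T]; simp\<close>)+
      from discrete_ito[OF T G g close this[unfolded x_def]]
      have "\<bar>S (r n) - V (r n)\<bar> \<le> \<epsilon> * T / 2 * W (r n)"
        unfolding S_def V_def W_def x_def .
      also have "\<dots> \<le> \<epsilon> * T / 2 * (T + 1)"
        using elim(2) \<epsilon> T by (intro mult_left_mono) auto
      also have "\<dots> = e / 2" using T by (simp add: \<epsilon>_def divide_simps)
      also have "\<dots> < e" using e by simp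
      finally show ?case by simp
    qed
    then show "\<exists>no. \<forall>n\<ge>no. norm (S (r n) - V (r n) - 0) < e"
      by (simp add: eventually_sequentially)
  qed
  from tendsto_add[OF this V] show ?thesis by (simp add: S_def del: sum.lessThan_Suc)
qed

section \<open>Approximation of the occupation average\<close>

lemma continuous_on_local_time_shifted:
  fixes l :: "real \<Rightarrow> real \<Rightarrow> real"
  assumes "continuous_on ({0..} \<times> UNIV) (\<lambda>(s, y). l s y)" "continuous_on {0..T} b"
  shows "continuous_on ({0..T} \<times> UNIV) (\<lambda>(s, x). l s (b s - x))"
proof -
  have "continuous_on ({0..T} \<times> (UNIV :: real set)) (\<lambda>z. (fst z, b (fst z) - snd z))"
    by (intro continuous_intros continuous_on_compose2[OF assms(2)]) auto
  moreover have "(\<lambda>z. (fst z, b (fst z) - snd z)) ` ({0..T} \<times> (UNIV :: real set)) \<subseteq> {0..} \<times> UNIV"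
    by auto
  ultimately have "continuous_on ({0..T} \<times> UNIV) (\<lambda>z. case (fst z, b (fst z) - snd z) of (s, y) \<Rightarrow> l s y)"
    by (rule continuous_on_compose2[OF assms(1)])
  then show ?thesis by (simp add: case_prod_beta)
qed

text \<open>The reflection \<open>x = a - y\<close> turns the left side into the occupation formula
  for \<open>g (a - y)\<close>. The level \<open>a\<close> will be \<open>b s\<close>: with the path
  and \<open>s\<close> fixed it is a constant.\<close>

lemma occupation_average:
  fixes b g l :: "real \<Rightarrow> real"
  assumes s: "0 \<le> s" and g: "continuous_on UNIV g" "\<And>x. \<bar>g x\<bar> \<le> C" and supp: "\<And>x. x \<notin> {c..d} \<Longrightarrow> g x = 0"
    and occ: "\<And>h. h \<in> borel_measurable borel \<Longrightarrow> bounded (range h) \<Longrightarrow>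
      (LBINT u:{0..s}. h (b u)) = (LBINT y. h y * l y)"
  shows "(LBINT x:{c..d}. g x * l (a - x)) = (LBINT u:{0..s}. g (a - b u))"
proof -
  have [measurable]: "g \<in> borel_measurable borel" using g(1) by (rule borel_measurable_continuous_onI)
  have "(LBINT x:{c..d}. g x * l (a - x)) = (LBINT x. g x * l (a - x))"
    unfolding set_lebesgue_integral_def
    by (intro Bochner_Integration.integral_cong refl) (use supp in \<open>auto simp: indicator_def\<close>)
  also have "\<dots> = (LBINT y. g (a - y) * l y)"
    using lborel_integral_real_affine[of "-1" "\<lambda>x. g x * l (a - x)" a] by simp
  also have "\<dots> = (LBINT u:{0..s}. g (a - b u))"
  proof (rule occ[symmetric])
    show "bounded (range (\<lambda>y. g (a - y)))" unfolding bounded_iff using g(2) by auto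
  qed measurable
  finally show ?thesis .
qed

text \<open>For fixed \<open>s\<close> the average over past times and the Riemann sum over levels
  have the same limit, the integral of \<open>g (b s - b u)\<close> over \<open>u \<le> s\<close>.
  Both are bounded uniformly in \<open>m\<close> and \<open>s\<close>, the second because local time
  along the path is jointly continuous on a compact set.\<close>

lemma riemann_local_time_L2_tendsto:
  fixes b g :: "real \<Rightarrow> real" and l :: "real \<Rightarrow> real \<Rightarrow> real"
  assumes T: "0 < T" and b: "continuous_on {0..T} b"
    and g: "continuous_on UNIV g" "\<And>x. \<bar>g x\<bar> \<le> C" and supp: "\<And>x. x \<notin> {c..d} \<Longrightarrow> g x = 0" and cd: "c < d"
    and l: "continuous_on ({0..} \<times> UNIV) (\<lambda>(s, y). l s y)"
    and occ: "\<And>s h. 0 \<le> s \<Longrightarrow> h \<in> borel_measurable borel \<Longrightarrow> bounded (range h) \<Longrightarrow>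
      (LBINT u:{0..s}. h (b u)) = (LBINT y. h y * l s y)"
  shows "(\<lambda>m. \<integral>\<^sup>+s\<in>{0..T}. ennreal ((past_average g b T m (cell 0 T m s) -
    (\<Sum>j<Suc m. (d - c) / real (Suc m) * g (grid c d m j) * l s (b s - grid c d m j)))\<^sup>2) \<partial>lborel) \<longlonglongrightarrow> 0"
proof -
  have lb: "continuous_on ({0..T} \<times> UNIV) (\<lambda>(s, x). l s (b s - x))"
    by (rule continuous_on_local_time_shifted[OF l b])
  have "compact ({0..T} \<times> {c..d})" by (intro compact_Times compact_Icc)
  moreover have "continuous_on ({0..T} \<times> {c..d}) (\<lambda>(s, x). l s (b s - x))"
    using lb by (rule continuous_on_subset) auto
  ultimately obtain K where K0: "0 \<le> K" and K: "\<And>s x. s \<in> {0..T} \<Longrightarrow> x \<in> {c..d} \<Longrightarrow> \<bar>l s (b s - x)\<bar> \<le> K"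
    using continuous_on_compact_bound[of "{0..T} \<times> {c..d}"] by (smt (verit, best) case_prod_conv mem_Sigma_iff)
  have C0: "0 \<le> C" using g(2)[of 0] by simp
  \<comment> \<open>Cut off outside \<open>{0..T}\<close>, because the path is known to be
    continuous only there and \<open>A m\<close> has to be Borel.\<close>
  define A where "A m s = (if s \<in> {0..T} then past_average g b T m (cell 0 T m s) -
    (\<Sum>j<Suc m. (d - c) / real (Suc m) * g (grid c d m j) * l s (b s - grid c d m j)) else 0)" for m s
  have A_meas[measurable]: "A m \<in> borel_measurable borel" for m
  proof -
    have [measurable]: "(\<lambda>s. if s \<in> {0..T} then l s (b s - x) else 0) \<in> borel_measurable borel" for x
      by (rule borel_measurable_on_Icc, rule continuous_on_compose2[OF lb, of "{0..T}" "\<lambda>s. (s, x)", simplified])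
        (auto intro!: continuous_intros)
    have eq: "A m = (\<lambda>s. (if s \<in> {0..T} then past_average g b T m (cell 0 T m s) else 0) -
      (\<Sum>j<Suc m. (d - c) / real (Suc m) * g (grid c d m j) * (if s \<in> {0..T} then l s (b s - grid c d m j) else 0)))"
      unfolding A_def by (intro ext) auto
    show ?thesis unfolding eq by measurable
  qed
  define B where "B = T * C + (d - c) * (C * K)"
  have A_bnd: "\<bar>A m s\<bar> \<le> B" if s: "s \<in> {0<..T}" for m s
  proof -
    have "\<bar>\<Sum>j<Suc m. (d - c) / real (Suc m) * g (grid c d m j) * l s (b s - grid c d m j)\<bar> \<le>
        (\<Sum>j<Suc m. (d - c) / real (Suc m) * (C * K))"
    proof (rule order_trans[OF sum_abs], rule sum_mono)
      fix j assume j: "j \<in> {..<Suc m}"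
      have "\<bar>g (grid c d m j) * l s (b s - grid c d m j)\<bar> \<le> C * K"
        unfolding abs_mult using j s by (intro mult_mono g K grid_in[OF cd] C0) auto
      then have "(d - c) / real (Suc m) * \<bar>g (grid c d m j) * l s (b s - grid c d m j)\<bar> \<le> (d - c) / real (Suc m) * (C * K)"
        using cd by (intro mult_left_mono) auto
      then show "\<bar>(d - c) / real (Suc m) * g (grid c d m j) * l s (b s - grid c d m j)\<bar> \<le> (d - c) / real (Suc m) * (C * K)"
        using cd by (simp add: abs_mult mult.assoc)
    qed
    also have "\<dots> = (d - c) * (C * K)" by (simp del: of_nat_Suc)
    finally have "\<bar>\<Sum>j<Suc m. (d - c) / real (Suc m) * g (grid c d m j) * l s (b s - grid c d m j)\<bar> \<le> (d - c) * (C * K)" .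
    moreover have "\<bar>past_average g b T m (cell 0 T m s)\<bar> \<le> T * C"
      by (rule past_average_bound[OF T g(2) cell_grid(1)[OF T s]])
    ultimately show ?thesis using s unfolding A_def B_def by auto
  qed
  have A_lim: "(\<lambda>m. A m s) \<longlonglongrightarrow> 0" if s: "s \<in> {0<..T}" for s
  proof -
    have "continuous_on {c..d} (\<lambda>x. l s (b s - x))"
      by (rule continuous_on_compose2[OF lb, of "{c..d}" "\<lambda>x. (s, x)", simplified])
        (use s in \<open>auto intro!: continuous_intros\<close>)
    then have "continuous_on {c..d} (\<lambda>x. g x * l s (b s - x))"
      using g(1) by (intro continuous_on_mult) (auto intro: continuous_on_subset)
    from riemann_sum_tendsto[OF cd this]
    have "(\<lambda>m. \<Sum>j<Suc m. (d - c) / real (Suc m) * g (grid c d m j) * l s (b s - grid c d m j)) \<longlonglongrightarrow>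
        (LBINT x:{c..d}. g x * l s (b s - x))"
      by (simp only: sum_distrib_left mult.assoc)
    also have "(LBINT x:{c..d}. g x * l s (b s - x)) = (LBINT u:{0..s}. g (b s - b u))"
      by (rule occupation_average[OF _ g supp occ]) (use s in auto)
    finally have "(\<lambda>m. past_average g b T m (cell 0 T m s) -
        (\<Sum>j<Suc m. (d - c) / real (Suc m) * g (grid c d m j) * l s (b s - grid c d m j))) \<longlonglongrightarrow>
        (LBINT u:{0..s}. g (b s - b u)) - (LBINT u:{0..s}. g (b s - b u))"
      by (intro tendsto_diff past_average_tendsto[OF T b g s])
    then show ?thesis using s by (simp add: A_def del: sum.lessThan_Suc of_nat_Suc)
  qed
  have "(\<lambda>m. \<integral>\<^sup>+s. ennreal ((A m s)\<^sup>2) * indicator {0..T} s \<partial>lborel) \<longlonglongrightarrow> (\<integral>\<^sup>+s. 0 \<partial>(lborel :: real measure))"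
  proof (rule nn_integral_dominated_convergence[where w = "\<lambda>s. ennreal (B\<^sup>2) * indicator {0..T} s"])
    show "(\<integral>\<^sup>+s. ennreal (B\<^sup>2) * indicator {0..T} s \<partial>lborel) < \<infinity>"
      using T by (simp add: nn_integral_cmult ennreal_mult_less_top)
    show "AE s in lborel. ennreal ((A m s)\<^sup>2) * indicator {0..T} s \<le> ennreal (B\<^sup>2) * indicator {0..T} s" for m
      using AE_lborel_singleton[of 0]
    proof eventually_elim
      case (elim s)
      show ?case
      proof (cases "s \<in> {0<..T}")
        case True
        have "(A m s)\<^sup>2 \<le> B\<^sup>2" using power_mono[OF A_bnd[OF True] abs_ge_zero, of m 2] by simp
        then show ?thesis by (intro mult_right_mono ennreal_leI) auto
      next
        case False then show ?thesis using elim by (auto simp: indicator_def)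
      qed
    qed
    show "AE s in lborel. (\<lambda>m. ennreal ((A m s)\<^sup>2) * indicator {0..T} s) \<longlonglongrightarrow> 0"
      using AE_lborel_singleton[of 0]
    proof eventually_elim
      case (elim s)
      show ?case
      proof (cases "s \<in> {0<..T}")
        case True
        have "(\<lambda>m. ennreal ((A m s)\<^sup>2)) \<longlonglongrightarrow> ennreal 0"
          using tendsto_power[OF A_lim[OF True], of 2] by (intro tendsto_ennrealI) simp
        then show ?thesis using True by simp
      next
        case False then show ?thesis using elim by (auto simp: indicator_def)
      qed
    qed
  qed measurable
  moreover have "(\<integral>\<^sup>+s. ennreal ((A m s)\<^sup>2) * indicator {0..T} s \<partial>lborel) =
    (\<integral>\<^sup>+s\<in>{0..T}. ennreal ((past_average g b T m (cell 0 T m s) -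
    (\<Sum>j<Suc m. (d - c) / real (Suc m) * g (grid c d m j) * l s (b s - grid c d m j)))\<^sup>2) \<partial>lborel)" for m
    by (intro nn_integral_cong) (auto simp: A_def indicator_def simp del: sum.lessThan_Suc)
  ultimately show ?thesis by simp
qed

section \<open>Adapted grid processes and quadratic variation\<close>

context brownian_motion begin

lemma past_average_filtration:
  assumes "0 < T" "i \<le> Suc n" "f \<in> borel_measurable borel"
  shows "(\<lambda>\<omega>. past_average f (\<lambda>t. B t \<omega>) T n i) \<in> borel_measurable (\<F> (grid 0 T n i))"
proof -
  have [measurable]: "B (grid 0 T n j) \<in> borel_measurable (\<F> (grid 0 T n i))" if "j \<le> i" for j
    using grid_in[OF assms(1), of j n] grid_le_iff[OF assms(1), of n j i] that assms(2)
    by (intro measurable_B_filtration) auto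
  have "(\<lambda>\<omega>. f (B (grid 0 T n i) \<omega> - B (grid 0 T n j) \<omega>)) \<in> borel_measurable (\<F> (grid 0 T n i))" if "j \<le> i" for j
    using that by (intro measurable_compose[OF _ assms(3)]) measurable
  then show ?thesis unfolding past_average_def
    by (intro borel_measurable_times borel_measurable_sum) auto
qed

lemma elementary_past_average:
  assumes T: "0 < T" and f: "f \<in> borel_measurable borel"
  shows "elementary T
    (\<lambda>s \<omega>. \<Sum>i<Suc n. past_average f (\<lambda>t. B t \<omega>) T n i * indicator {grid 0 T n i<..grid 0 T n (Suc i)} s)
    (\<lambda>\<omega>. \<Sum>i<Suc n. past_average f (\<lambda>t. B t \<omega>) T n i * (B (grid 0 T n (Suc i)) \<omega> - B (grid 0 T n i) \<omega>))"
proof (rule elementary_sum)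
  fix i assume i: "i \<in> {..<Suc n}"
  have "0 \<le> grid 0 T n i" "grid 0 T n i \<le> grid 0 T n (Suc i)" "grid 0 T n (Suc i) \<le> T"
    using grid_in[OF T, of i n] grid_in[OF T, of "Suc i" n] grid_le_iff[OF T, of n i "Suc i"] i by auto
  from elementary_block[OF elementary_zero this past_average_filtration[OF T _ f]] i
  show "elementary T
    (\<lambda>s \<omega>. past_average f (\<lambda>t. B t \<omega>) T n i * indicator {grid 0 T n i<..grid 0 T n (Suc i)} s)
    (\<lambda>\<omega>. past_average f (\<lambda>t. B t \<omega>) T n i * (B (grid 0 T n (Suc i)) \<omega> - B (grid 0 T n i) \<omega>))"
    by simp
qed

text \<open>The squared increments minus their mean are centred and independent of the past, so the
  weighted terms are orthogonal and the second moment is at most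
  \<open>2 * T^2 * C^2 / Suc n\<close>. The given \<open>r\<close> allows extraction from a sequence
  already thinned out.\<close>

lemma quadratic_variation_subseq:
  fixes \<eta> :: "nat \<Rightarrow> nat \<Rightarrow> 'a \<Rightarrow> real" and r :: "nat \<Rightarrow> nat"
  assumes T: "0 < T" and \<eta>: "\<And>n i. i < Suc n \<Longrightarrow> \<eta> n i \<in> borel_measurable (\<F> (grid 0 T n i))"
    and bnd: "\<And>n i \<omega>. i < Suc n \<Longrightarrow> \<bar>\<eta> n i \<omega>\<bar> \<le> C" and r: "strict_mono r"
  defines "Y \<equiv> \<lambda>n \<omega>. \<Sum>i<Suc n. \<eta> n i \<omega> * ((B (grid 0 T n (Suc i)) \<omega> - B (grid 0 T n i) \<omega>)\<^sup>2 - T / real (Suc n))"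
  shows "\<exists>q::nat \<Rightarrow> nat. strict_mono q \<and> (AE \<omega> in M. (\<lambda>n. Y (r (q n)) \<omega>) \<longlonglongrightarrow> 0)"
proof -
  have *: "integrable M (\<lambda>\<omega>. (Y n \<omega>)\<^sup>2) \<and> expectation (\<lambda>\<omega>. (Y n \<omega>)\<^sup>2) \<le> (2 * T\<^sup>2 * C\<^sup>2) * inverse (real (Suc n))" for n
  proof -
    define \<Delta> where "\<Delta> = T / real (Suc n)"
    define D where "D i \<omega> = (B (grid 0 T n (Suc i)) \<omega> - B (grid 0 T n i) \<omega>)\<^sup>2 - \<Delta>" for i \<omega>
    have D: "integrable M (D i)" "expectation (D i) = 0" "integrable M (\<lambda>\<omega>. (D i \<omega>)\<^sup>2)"
      "expectation (\<lambda>\<omega>. (D i \<omega>)\<^sup>2) = 2 * \<Delta>\<^sup>2" if "i < Suc n" for i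
    proof -
      have g: "0 \<le> grid 0 T n i" "grid 0 T n i < grid 0 T n (Suc i)"
        using grid_in[OF T, of i n] grid_less_iff[OF T, of n i "Suc i"] that by auto
      have gd: "grid 0 T n (Suc i) - grid 0 T n i = \<Delta>"
        using grid_diff[of 0 T n i] by (simp add: \<Delta>_def)
      note m = increment_moments[OF g, unfolded gd]
      have "(x\<^sup>2 - \<Delta>)\<^sup>2 = x^4 - 2 * \<Delta> * x\<^sup>2 + \<Delta>\<^sup>2" for x :: real
        by (simp add: power2_eq_square power4_eq_xxxx algebra_simps)
      \<comment> \<open>By the fourth moment the mean of this square is
        \<open>3 * \<Delta>^2 - 2 * \<Delta>^2 + \<Delta>^2\<close>.\<close>
      then have sq: "(D i \<omega>)\<^sup>2 = (B (grid 0 T n (Suc i)) \<omega> - B (grid 0 T n i) \<omega>)^4 -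
        2 * \<Delta> * (B (grid 0 T n (Suc i)) \<omega> - B (grid 0 T n i) \<omega>)\<^sup>2 + \<Delta>\<^sup>2" for \<omega>
        unfolding D_def .
      show "integrable M (D i)" "expectation (D i) = 0"
        unfolding D_def using m by (simp_all add: prob_space)
      show "integrable M (\<lambda>\<omega>. (D i \<omega>)\<^sup>2)" "expectation (\<lambda>\<omega>. (D i \<omega>)\<^sup>2) = 2 * \<Delta>\<^sup>2"
        unfolding sq using m by (simp_all add: prob_space power2_eq_square)
    qed
    have iso: "integrable M (\<lambda>\<omega>. (Y n \<omega>)\<^sup>2) \<and>
        (\<Sum>i<Suc n. 2 * \<Delta>\<^sup>2 * expectation (\<lambda>\<omega>. (\<eta> n i \<omega>)\<^sup>2)) = expectation (\<lambda>\<omega>. (Y n \<omega>)\<^sup>2)"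
      unfolding Y_def \<Delta>_def[symmetric]
      by (rule martingale_transform_L2[where f = "\<lambda>_ x. x\<^sup>2 - \<Delta>" and C = "\<lambda>_. C"])
        (use D[unfolded D_def] grid_less_iff[OF T] \<eta> bnd in auto)
    have "(\<Sum>i<Suc n. 2 * \<Delta>\<^sup>2 * expectation (\<lambda>\<omega>. (\<eta> n i \<omega>)\<^sup>2)) \<le> (\<Sum>i<Suc n. 2 * \<Delta>\<^sup>2 * C\<^sup>2)"
    proof (intro sum_mono mult_left_mono)
      fix i assume i: "i \<in> {..<Suc n}"
      have le: "(\<eta> n i \<omega>)\<^sup>2 \<le> C\<^sup>2" for \<omega>
        using power_mono[OF bnd abs_ge_zero, of i n \<omega> 2] i by simp
      have [measurable]: "\<eta> n i \<in> borel_measurable M"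
        using i by (intro measurable_filtration_M[OF \<eta>]) auto
      have "integrable M (\<lambda>\<omega>. (\<eta> n i \<omega>)\<^sup>2)"
        using le by (intro integrable_const_bound[where B = "C\<^sup>2"]) auto
      then have "expectation (\<lambda>\<omega>. (\<eta> n i \<omega>)\<^sup>2) \<le> expectation (\<lambda>\<omega>. C\<^sup>2)"
        using le by (intro integral_mono) auto
      then show "expectation (\<lambda>\<omega>. (\<eta> n i \<omega>)\<^sup>2) \<le> C\<^sup>2" by (simp add: prob_space)
    qed auto
    also have "\<dots> = (2 * T\<^sup>2 * C\<^sup>2) * inverse (real (Suc n))"
      by (simp add: \<Delta>_def power2_eq_square divide_inverse del: of_nat_Suc)
    finally show ?thesis using iso by simp
  qed
  have "(\<lambda>n. expectation (\<lambda>\<omega>. (Y n \<omega>)\<^sup>2)) \<longlonglongrightarrow> 0"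
  proof (rule tendsto_sandwich[OF _ _ tendsto_const])
    show "(\<lambda>n. (2 * T\<^sup>2 * C\<^sup>2) * inverse (real (Suc n))) \<longlonglongrightarrow> 0"
      using tendsto_mult[OF tendsto_const LIMSEQ_inverse_real_of_nat] by simp
  qed (use * in auto)
  from LIMSEQ_subseq_LIMSEQ[OF this r]
  have "(\<lambda>n. expectation (\<lambda>\<omega>. norm ((Y (r n) \<omega>)\<^sup>2))) \<longlonglongrightarrow> 0" by (simp add: comp_def)
  then obtain q :: "nat \<Rightarrow> nat" where q: "strict_mono q" "AE \<omega> in M. (\<lambda>n. (Y (r (q n)) \<omega>)\<^sup>2) \<longlonglongrightarrow> 0"
    using tendsto_L1_AE_subseq[of M "\<lambda>n \<omega>. (Y (r n) \<omega>)\<^sup>2"] * by auto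
  have "AE \<omega> in M. (\<lambda>n. Y (r (q n)) \<omega>) \<longlonglongrightarrow> 0"
    using q(2)
  proof eventually_elim
    case (elim \<omega>)
    show ?case using tendsto_real_sqrt[OF elim] by (simp add: tendsto_rabs_zero_iff)
  qed
  with q(1) show ?thesis by blast
qed

end

text \<open>Cauchy-Schwarz with \<open>\<bar>w j\<bar>\<close> split evenly between the factors, so
  that only the total mass of the weights enters and not their number.\<close>

lemma weighted_sum_power2_le:
  fixes w a :: "'i \<Rightarrow> real"
  shows "(\<Sum>j\<in>J. w j * a j)\<^sup>2 \<le> (\<Sum>j\<in>J. \<bar>w j\<bar>) * (\<Sum>j\<in>J. \<bar>w j\<bar> * (a j)\<^sup>2)"
proof -
  have "(\<Sum>j\<in>J. w j * a j)\<^sup>2 = (\<Sum>j\<in>J. sqrt \<bar>w j\<bar> * (sgn (w j) * sqrt \<bar>w j\<bar> * a j))\<^sup>2"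
  proof (intro arg_cong[where f = "\<lambda>x. x\<^sup>2"] sum.cong refl)
    fix j
    have "sqrt \<bar>w j\<bar> * (sgn (w j) * sqrt \<bar>w j\<bar>) = sgn (w j) * (sqrt \<bar>w j\<bar>)\<^sup>2"
      by (simp only: power2_eq_square mult.left_commute)
    then show "w j * a j = sqrt \<bar>w j\<bar> * (sgn (w j) * sqrt \<bar>w j\<bar> * a j)"
      by (simp add: mult.assoc[symmetric] sgn_mult_abs)
  qed
  also have "\<dots> \<le> (\<Sum>j\<in>J. (sqrt \<bar>w j\<bar>)\<^sup>2) * (\<Sum>j\<in>J. (sgn (w j) * sqrt \<bar>w j\<bar> * a j)\<^sup>2)"
    by (rule Cauchy_Schwarz_ineq_sum)
  also have "(\<Sum>j\<in>J. (sgn (w j) * sqrt \<bar>w j\<bar> * a j)\<^sup>2) = (\<Sum>j\<in>J. \<bar>w j\<bar> * (a j)\<^sup>2)"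
    by (intro sum.cong refl) (auto simp: power_mult_distrib sgn_if)
  finally show ?thesis by simp
qed

text \<open>The weights enter only through a bound on their total mass: \<open>N\<close> errors of
  squared norm at most \<epsilon> cost \<open>2 * W^2 * \<epsilon>\<close>, however many levels are
  sampled. The factors 2 come from \<open>(x + y)^2 \<le> 2 * x^2 + 2 * y^2\<close>.\<close>

lemma nn_integral_power2_perturbation:
  fixes u :: "real \<Rightarrow> real" and a :: "nat \<Rightarrow> real \<Rightarrow> real"
  assumes [measurable]: "u \<in> borel_measurable borel" "\<And>j. j < N \<Longrightarrow> a j \<in> borel_measurable borel"
    and W: "(\<Sum>j<N. \<bar>w j\<bar>) \<le> W"
    and a: "\<And>j. j < N \<Longrightarrow> (\<integral>\<^sup>+s. ennreal ((a j s)\<^sup>2) \<partial>lborel) \<le> ennreal \<epsilon>" and "0 \<le> \<epsilon>"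
  shows "(\<integral>\<^sup>+s. ennreal ((u s + (\<Sum>j<N. w j * a j s))\<^sup>2) \<partial>lborel) \<le>
    2 * (\<integral>\<^sup>+s. ennreal ((u s)\<^sup>2) \<partial>lborel) + ennreal (2 * W\<^sup>2 * \<epsilon>)"
proof -
  have W0: "0 \<le> W" using order_trans[OF _ W] by (simp add: sum_nonneg)
  have pt: "ennreal ((u s + (\<Sum>j<N. w j * a j s))\<^sup>2) \<le>
      2 * ennreal ((u s)\<^sup>2) + (\<Sum>j<N. ennreal (2 * W * \<bar>w j\<bar>) * ennreal ((a j s)\<^sup>2))" for s
  proof -
    have sq: "(x + y)\<^sup>2 \<le> 2 * x\<^sup>2 + 2 * y\<^sup>2" for x y :: real
      using zero_le_power2[of "x - y"] by (simp add: power2_eq_square algebra_simps)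
    have "(\<Sum>j<N. w j * a j s)\<^sup>2 \<le> W * (\<Sum>j<N. \<bar>w j\<bar> * (a j s)\<^sup>2)"
      by (rule order_trans[OF weighted_sum_power2_le mult_right_mono[OF W]]) (intro sum_nonneg, simp)
    then have "(u s + (\<Sum>j<N. w j * a j s))\<^sup>2 \<le> 2 * (u s)\<^sup>2 + 2 * (W * (\<Sum>j<N. \<bar>w j\<bar> * (a j s)\<^sup>2))"
      using sq[of "u s" "\<Sum>j<N. w j * a j s"] by linarith
    also have "\<dots> = 2 * (u s)\<^sup>2 + (\<Sum>j<N. (2 * W * \<bar>w j\<bar>) * (a j s)\<^sup>2)"
      by (simp add: sum_distrib_left mult.assoc)
    finally have "ennreal ((u s + (\<Sum>j<N. w j * a j s))\<^sup>2) \<le> ennreal (2 * (u s)\<^sup>2 + (\<Sum>j<N. (2 * W * \<bar>w j\<bar>) * (a j s)\<^sup>2))"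
      by (rule ennreal_leI)
    also have "\<dots> = 2 * ennreal ((u s)\<^sup>2) + (\<Sum>j<N. ennreal (2 * W * \<bar>w j\<bar>) * ennreal ((a j s)\<^sup>2))"
      using W0 by (simp add: ennreal_plus sum_nonneg ennreal_mult flip: sum_ennreal)
    finally show ?thesis .
  qed
  have "(\<integral>\<^sup>+s. ennreal ((u s + (\<Sum>j<N. w j * a j s))\<^sup>2) \<partial>lborel) \<le>
      (\<integral>\<^sup>+s. 2 * ennreal ((u s)\<^sup>2) + (\<Sum>j<N. ennreal (2 * W * \<bar>w j\<bar>) * ennreal ((a j s)\<^sup>2)) \<partial>lborel)"
    by (intro nn_integral_mono pt)
  also have "\<dots> = 2 * (\<integral>\<^sup>+s. ennreal ((u s)\<^sup>2) \<partial>lborel) +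
      (\<Sum>j<N. ennreal (2 * W * \<bar>w j\<bar>) * (\<integral>\<^sup>+s. ennreal ((a j s)\<^sup>2) \<partial>lborel))"
  proof (subst nn_integral_add)
    show "(\<lambda>s. \<Sum>j<N. ennreal (2 * W * \<bar>w j\<bar>) * ennreal ((a j s)\<^sup>2)) \<in> borel_measurable lborel"
      by (intro borel_measurable_sum) auto
    have "(\<integral>\<^sup>+s. (\<Sum>j<N. ennreal (2 * W * \<bar>w j\<bar>) * ennreal ((a j s)\<^sup>2)) \<partial>lborel) =
        (\<Sum>j<N. \<integral>\<^sup>+s. ennreal (2 * W * \<bar>w j\<bar>) * ennreal ((a j s)\<^sup>2) \<partial>lborel)"
      by (rule nn_integral_sum) auto
    also have "\<dots> = (\<Sum>j<N. ennreal (2 * W * \<bar>w j\<bar>) * (\<integral>\<^sup>+s. ennreal ((a j s)\<^sup>2) \<partial>lborel))"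
      by (intro sum.cong refl nn_integral_cmult) auto
    finally show "(\<integral>\<^sup>+s. 2 * ennreal ((u s)\<^sup>2) \<partial>lborel) +
        (\<integral>\<^sup>+s. (\<Sum>j<N. ennreal (2 * W * \<bar>w j\<bar>) * ennreal ((a j s)\<^sup>2)) \<partial>lborel) =
      2 * (\<integral>\<^sup>+s. ennreal ((u s)\<^sup>2) \<partial>lborel) +
        (\<Sum>j<N. ennreal (2 * W * \<bar>w j\<bar>) * (\<integral>\<^sup>+s. ennreal ((a j s)\<^sup>2) \<partial>lborel))"
      by (simp add: nn_integral_cmult)
  qed auto
  also have "(\<Sum>j<N. ennreal (2 * W * \<bar>w j\<bar>) * (\<integral>\<^sup>+s. ennreal ((a j s)\<^sup>2) \<partial>lborel)) \<le>
      (\<Sum>j<N. ennreal (2 * W * \<bar>w j\<bar>) * ennreal \<epsilon>)"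
    by (intro sum_mono mult_left_mono a) auto
  also have "\<dots> = ennreal (2 * W * (\<Sum>j<N. \<bar>w j\<bar>) * \<epsilon>)"
    using W0 assms(5) by (simp add: ennreal_mult[symmetric] sum_distrib_left sum_distrib_right sum_nonneg flip: sum_ennreal)
  also have "\<dots> \<le> ennreal (2 * W\<^sup>2 * \<epsilon>)"
    using W W0 assms(5) by (intro ennreal_leI mult_right_mono) (auto simp: power2_eq_square intro: mult_left_mono)
  finally show ?thesis by (simp add: add_left_mono)
qed

section \<open>Approximating a given Ito integral\<close>

context brownian_motion begin

lemma elementary_measurable: "elementary T \<Phi> Z \<Longrightarrow> (\<lambda>s. \<Phi> s \<omega>) \<in> borel_measurable borel"
  by (induction rule: elementary.induct) auto

text \<open>The exceedance sets lie in the completion; each is covered by an event of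
  \<open>M\<close> with the same measure, so that unions and Borel-Cantelli can be carried out in
  \<open>M\<close>.\<close>

lemma tendsto_zero_in_prob_small:
  assumes "tendsto_zero_in_prob M D" "0 < e" "0 < \<delta>"
  shows "\<forall>\<^sub>F k in sequentially. \<exists>N\<in>events. prob N < \<delta> \<and> (\<forall>\<omega>\<in>space M - N. D k \<omega> \<le> ennreal e)"
proof -
  have meas: "D k \<in> borel_measurable (completion M)" for k
    using assms(1) by (simp add: tendsto_zero_in_prob_def)
  have "(\<lambda>k. emeasure (completion M) {\<omega> \<in> space M. ennreal e < D k \<omega>}) \<longlonglongrightarrow> 0"
    using assms(1,2) by (simp add: tendsto_zero_in_prob_def)
  then have "\<forall>\<^sub>F k in sequentially. emeasure (completion M) {\<omega> \<in> space M. ennreal e < D k \<omega>} < ennreal \<delta>"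
    by (rule order_tendstoD) (use assms(3) in simp)
  then show ?thesis
  proof eventually_elim
    case (elim k)
    have "{\<omega> \<in> space (completion M). ennreal e < D k \<omega>} \<in> sets (completion M)"
      using meas[of k] by measurable
    then obtain N where N: "N \<in> events" "{\<omega> \<in> space M. ennreal e < D k \<omega>} \<subseteq> N"
      "emeasure (completion M) {\<omega> \<in> space M. ennreal e < D k \<omega>} = emeasure M N"
      using Complete_Measure.completion_upper[of "{\<omega> \<in> space M. ennreal e < D k \<omega>}" M] by auto
    then have "prob N < \<delta>" using elim assms(3) by (simp add: emeasure_eq_measure ennreal_less_iff)
    moreover have "\<forall>\<omega>\<in>space M - N. D k \<omega> \<le> ennreal e" using N(2) by (auto simp: not_less[symmetric])
    ultimately show ?case using N(1) by blast
  qed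
qed

text \<open>Tolerances are prescribed in advance, one for the errors and one for the exceptional
  probability, so that approximations at many levels can be combined without any relation between
  their sequences. Norm and integral each get \<open>\<delta> / 2\<close>.\<close>

lemma ito_integral_approx:
  assumes "ito_integral M B H T J" "0 \<le> T" "0 < e" "0 < \<delta>"
  shows "\<exists>\<Phi> Z N. elementary T \<Phi> Z \<and> N \<in> events \<and> prob N < \<delta> \<and> (\<forall>\<omega>\<in>space M - N.
    (\<integral>\<^sup>+s\<in>{0..T}. ennreal ((H s \<omega> - \<Phi> s \<omega>)\<^sup>2) \<partial>lborel) \<le> ennreal e \<and> \<bar>Z \<omega> - J \<omega>\<bar> \<le> e)"
proof -
  obtain n \<tau> \<xi> where simple: "\<And>k::nat. simple_integrand M B (n k) (\<tau> k) (\<xi> k)"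
    and lim: "tendsto_zero_in_prob M (\<lambda>k \<omega>.
        \<integral>\<^sup>+s\<in>{0..T}. ennreal ((simple_process (n k) (\<tau> k) (\<xi> k) s \<omega> - H s \<omega>)\<^sup>2) \<partial>lborel)"
      "tendsto_zero_in_prob M (\<lambda>k \<omega>. ennreal \<bar>simple_integral B (n k) (\<tau> k) (\<xi> k) T \<omega> - J \<omega>\<bar>)"
    using assms(1) unfolding ito_integral_def by blast
  have "\<delta> / 2 > 0" using assms(4) by simp
  from eventually_conj[OF tendsto_zero_in_prob_small[OF lim(1) assms(3) this]
      tendsto_zero_in_prob_small[OF lim(2) assms(3) this]]
  obtain k N1 N2 where N: "N1 \<in> events" "prob N1 < \<delta> / 2" "N2 \<in> events" "prob N2 < \<delta> / 2"
    "\<And>\<omega>. \<omega> \<in> space M - N1 \<Longrightarrow>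
       (\<integral>\<^sup>+s\<in>{0..T}. ennreal ((simple_process (n k) (\<tau> k) (\<xi> k) s \<omega> - H s \<omega>)\<^sup>2) \<partial>lborel) \<le> ennreal e"
    "\<And>\<omega>. \<omega> \<in> space M - N2 \<Longrightarrow> ennreal \<bar>simple_integral B (n k) (\<tau> k) (\<xi> k) T \<omega> - J \<omega>\<bar> \<le> ennreal e"
    using eventually_happens'[OF sequentially_bot] by (smt (verit))
  obtain \<Phi> where \<Phi>: "elementary T \<Phi> (simple_integral B (n k) (\<tau> k) (\<xi> k) T)"
    "\<And>s \<omega>. s \<in> {0..T} \<Longrightarrow> \<Phi> s \<omega> = simple_process (n k) (\<tau> k) (\<xi> k) s \<omega>"
    using elementary_simple[OF simple assms(2)] by blast
  have "(\<integral>\<^sup>+s\<in>{0..T}. ennreal ((H s \<omega> - \<Phi> s \<omega>)\<^sup>2) \<partial>lborel) =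
      (\<integral>\<^sup>+s\<in>{0..T}. ennreal ((simple_process (n k) (\<tau> k) (\<xi> k) s \<omega> - H s \<omega>)\<^sup>2) \<partial>lborel)" for \<omega>
    by (intro nn_integral_cong) (auto simp: \<Phi>(2) power2_commute indicator_def)
  moreover have "prob (N1 \<union> N2) < \<delta>"
    using measure_Un_le[OF N(1,3)] N(2,4) by simp
  ultimately show ?thesis
    using \<Phi>(1) N assms(3) by (intro exI[of _ \<Phi>] exI[of _ "simple_integral B (n k) (\<tau> k) (\<xi> k) T"] exI[of _ "N1 \<union> N2"]) auto
qed

end

section \<open>The identity integrated against a test function\<close>

lemma local_time_paths:
  assumes "local_time M B L"
  shows "AE \<omega> in M. continuous_on ({0..} \<times> UNIV) (\<lambda>(s, y). L s y \<omega>) \<and>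
    (\<forall>s\<ge>0. \<forall>h\<in>borel_measurable borel. bounded (range h) \<longrightarrow>
      integrable lborel (\<lambda>y. h y * L s y \<omega>) \<and> (LBINT u:{0..s}. h (B u \<omega>)) = (LBINT y. h y * L s y \<omega>))"
  using assms unfolding local_time_def by (auto elim: eventually_mono)

context brownian_motion begin

text \<open>The integral over \<open>x\<close> is a limit of Riemann sums, each of which is the Ito integral of a
  finite combination of the processes \<open>L s (B s - x)\<close>; by the occupation formula these combinations
  converge to the integral of \<open>g (B s - B u)\<close> over \<open>u \<le> s\<close>.  This replaces a stochastic Fubini theorem.\<close>

lemma smeared_identity:
  fixes G g g' :: "real \<Rightarrow> real" and J :: "real \<Rightarrow> 'a \<Rightarrow> real"
  assumes lt: "local_time M B L" and T: "0 < T"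
    and ito: "\<And>x. ito_integral M B (\<lambda>s \<omega>. L s (B s \<omega> - x) \<omega>) T (J x)"
    and J: "AE \<omega> in M. continuous_on UNIV (\<lambda>x. J x \<omega>)"
    and G: "\<And>x. (G has_real_derivative g x) (at x)" and g: "\<And>x. (g has_real_derivative g' x) (at x)"
    and g': "uniformly_continuous_on UNIV g'" "\<And>x. \<bar>g' x\<bar> \<le> C'"
    and bnd: "\<And>x. \<bar>g x\<bar> \<le> C" and supp: "\<And>x. x \<notin> {c..d} \<Longrightarrow> g x = 0" and cd: "c < d"
  shows "AE \<omega> in M. (LBINT x:{c..d}. g x * J x \<omega>) = (LBINT u:{0..T}. G (B T \<omega> - B u \<omega>) - G 0) -
    1/2 * (LBINT s:{0..T}. LBINT u:{0..s}. g' (B s \<omega> - B u \<omega>))"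
proof -
  have gc: "continuous_on A g" for A
    using g by (intro DERIV_continuous_on) (auto intro: has_field_derivative_at_within)
  have g_borel: "g \<in> borel_measurable borel" by (rule borel_measurable_continuous_onI[OF gc])
  have g'_borel: "g' \<in> borel_measurable borel"
    by (rule borel_measurable_continuous_onI[OF uniformly_continuous_imp_continuous[OF g'(1)]])
  define x where "x m j = grid c d m j" for m j
  define w where "w m j = (d - c) / real (Suc m) * g (x m j)" for m j
  define W where "W = (d - c) * C"
  have C0: "0 \<le> C" using bnd[of 0] by simp
  have W0: "0 \<le> W" using C0 cd by (simp add: W_def)
  have wW: "(\<Sum>j<Suc m. \<bar>w m j\<bar>) \<le> W" for m
  proof -
    have "(\<Sum>j<Suc m. \<bar>w m j\<bar>) \<le> (\<Sum>j<Suc m. (d - c) / real (Suc m) * C)"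
      using cd bnd by (intro sum_mono) (simp add: w_def abs_mult mult_left_mono divide_right_mono del: of_nat_Suc)
    also have "\<dots> = W" by (simp add: W_def del: of_nat_Suc)
    finally show ?thesis .
  qed
  \<comment> \<open>Geometric decay serves twice: the errors tend to 0 and the exceptional
    probabilities are summable.\<close>
  define \<epsilon> where "\<epsilon> m = (1/2 :: real) ^ m" for m
  have \<epsilon>: "0 < \<epsilon> m" for m by (simp add: \<epsilon>_def)
  have \<epsilon>_lim: "\<epsilon> \<longlonglongrightarrow> 0" unfolding \<epsilon>_def by (rule LIMSEQ_realpow_zero) auto
  \<comment> \<open>The probability is divided by \<open>Suc m\<close>, the number of levels at
    stage \<open>m\<close>, so that the union over the levels has probability at most
    \<open>\<epsilon> m\<close>.\<close>
  define R where "R y m p \<longleftrightarrow> elementary T (fst p) (fst (snd p)) \<and> snd (snd p) \<in> events \<and>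
      prob (snd (snd p)) < \<epsilon> m / real (Suc m) \<and> (\<forall>\<omega>\<in>space M - snd (snd p).
      (\<integral>\<^sup>+s\<in>{0..T}. ennreal ((L s (B s \<omega> - y) \<omega> - fst p s \<omega>)\<^sup>2) \<partial>lborel) \<le> ennreal (\<epsilon> m) \<and>
      \<bar>fst (snd p) \<omega> - J y \<omega>\<bar> \<le> \<epsilon> m)" for y m p
  have "\<exists>p. R y m p" for y m
  proof -
    have "0 < \<epsilon> m / real (Suc m)" using \<epsilon>[of m] by simp
    from ito_integral_approx[OF ito less_imp_le[OF T] \<epsilon> this, of y]
    show ?thesis unfolding R_def by (simp add: split_paired_Ex)
  qed
  then obtain F where F: "R y m (F y m)" for y m by metis
  define \<Phi> where "\<Phi> m j = fst (F (x m j) m)" for m j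
  define Z where "Z m j = fst (snd (F (x m j) m))" for m j
  define N where "N m j = snd (snd (F (x m j) m))" for m j
  have el: "elementary T (\<Phi> m j) (Z m j)" and N: "N m j \<in> events" "prob (N m j) < \<epsilon> m / real (Suc m)"
    and good: "\<And>\<omega>. \<omega> \<in> space M - N m j \<Longrightarrow>
      (\<integral>\<^sup>+s\<in>{0..T}. ennreal ((L s (B s \<omega> - x m j) \<omega> - \<Phi> m j s \<omega>)\<^sup>2) \<partial>lborel) \<le> ennreal (\<epsilon> m) \<and>
      \<bar>Z m j \<omega> - J (x m j) \<omega>\<bar> \<le> \<epsilon> m" for m j
    using F[of "x m j" m] unfolding R_def \<Phi>_def Z_def N_def by auto
  have ev_good: "AE \<omega> in M. \<forall>\<^sub>F m in sequentially. \<omega> \<in> space M - (\<Union>j<Suc m. N m j)"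
  proof (rule borel_cantelli_AE1)
    show "(\<Union>j<Suc m. N m j) \<in> events" for m using N(1) by auto
    have le: "prob (\<Union>j<Suc m. N m j) \<le> \<epsilon> m" for m
    proof -
      have "prob (\<Union>j<Suc m. N m j) \<le> (\<Sum>j<Suc m. prob (N m j))"
        using N(1) by (intro measure_UNION_le) auto
      also have "\<dots> \<le> (\<Sum>j<Suc m. \<epsilon> m / real (Suc m))"
        using N(2) by (intro sum_mono less_imp_le)
      also have "\<dots> = \<epsilon> m" by (simp del: of_nat_Suc)
      finally show ?thesis .
    qed
    show "summable (\<lambda>m. prob (\<Union>j<Suc m. N m j))"
    proof (rule summable_comparison_test'[where g = \<epsilon> and N = 0])
      show "summable \<epsilon>" unfolding \<epsilon>_def by (rule summable_geometric) simp
    qed (use le in auto)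
  qed (simp add: less_top[symmetric])
  define S where "S m \<omega> = (\<Sum>i<Suc m. past_average g (\<lambda>t. B t \<omega>) T m i * (B (grid 0 T m (Suc i)) \<omega> - B (grid 0 T m i) \<omega>))" for m \<omega>
  \<comment> \<open>Grid average minus the weighted approximations at the sampled levels. It is
    elementary with a known integral, and its norm will tend to 0 along almost every path.\<close>
  define \<Psi> where "\<Psi> m s \<omega> = (\<Sum>i<Suc m. past_average g (\<lambda>t. B t \<omega>) T m i * indicator {grid 0 T m i<..grid 0 T m (Suc i)} s)
    + (\<Sum>j<Suc m. - w m j * \<Phi> m j s \<omega>)" for m s \<omega>
  have el\<Psi>: "elementary T (\<Psi> m) (\<lambda>\<omega>. S m \<omega> + (\<Sum>j<Suc m. - w m j * Z m j \<omega>))" for m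
    unfolding \<Psi>_def[abs_def] S_def
    by (rule elementary_add[OF elementary_past_average[OF T g_borel] elementary_sum[OF elementary_scale[OF el]]])
  have "AE \<omega> in M. (\<lambda>m. \<integral>\<^sup>+s\<in>{0..T}. ennreal ((\<Psi> m s \<omega>)\<^sup>2) \<partial>lborel) \<longlonglongrightarrow> 0"
    using ev_good continuous_paths local_time_paths[OF lt]
  proof eventually_elim
    case (elim \<omega>)
    define b where "b t = B t \<omega>" for t
    define l where "l s y = L s y \<omega>" for s y
    have b: "continuous_on {0..T} b" unfolding b_def using elim(2) by (auto intro: continuous_on_subset)
    have l: "continuous_on ({0..} \<times> UNIV) (\<lambda>(s, y). l s y)" unfolding l_def using elim(3) by simp
    have occ: "(LBINT u:{0..s}. h (b u)) = (LBINT y. h y * l s y)"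
      if "0 \<le> s" "h \<in> borel_measurable borel" "bounded (range h)" for s h
      using elim(3)[THEN conjunct2, rule_format, OF that] unfolding b_def l_def by simp
    \<comment> \<open>Splitting of \<open>\<Psi> m\<close>: \<open>u\<close> compares the grid
      average with the exact combination of local times, and \<open>a\<close> is the error of
      approximating local time at one level.\<close>
    define u where "u m s = (if s \<in> {0..T} then past_average g b T m (cell 0 T m s) -
      (\<Sum>j<Suc m. w m j * l s (b s - x m j)) else 0)" for m s
    define a where "a m j s = (if s \<in> {0..T} then l s (b s - x m j) - \<Phi> m j s \<omega> else 0)" for m j s
    have lb[measurable]: "(\<lambda>s. if s \<in> {0..T} then l s (b s - y) else 0) \<in> borel_measurable borel" for y
      by (rule borel_measurable_on_Icc,
          rule continuous_on_compose2[OF continuous_on_local_time_shifted[OF l b], of "{0..T}" "\<lambda>s. (s, y)", simplified])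
        (auto intro!: continuous_intros)
    have u_meas: "u m \<in> borel_measurable borel" for m
    proof -
      have eq: "u m = (\<lambda>s. (if s \<in> {0..T} then past_average g b T m (cell 0 T m s) else 0) -
          (\<Sum>j<Suc m. w m j * (if s \<in> {0..T} then l s (b s - x m j) else 0)))"
        unfolding u_def by (intro ext) auto
      show ?thesis unfolding eq by measurable
    qed
    have a_meas: "a m j \<in> borel_measurable borel" for m j
    proof -
      have [measurable]: "(\<lambda>s. \<Phi> m j s \<omega>) \<in> borel_measurable borel" by (rule elementary_measurable[OF el])
      have eq: "a m j = (\<lambda>s. (if s \<in> {0..T} then l s (b s - x m j) else 0) - (if s \<in> {0..T} then \<Phi> m j s \<omega> else 0))"
        unfolding a_def by (intro ext) auto
      show ?thesis unfolding eq by measurable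
    qed
    define U where "U m = (\<integral>\<^sup>+s. ennreal ((u m s)\<^sup>2) \<partial>lborel)" for m
    have "U m = (\<integral>\<^sup>+s\<in>{0..T}. ennreal ((past_average g b T m (cell 0 T m s) -
        (\<Sum>j<Suc m. (d - c) / real (Suc m) * g (grid c d m j) * l s (b s - grid c d m j)))\<^sup>2) \<partial>lborel)" for m
      unfolding U_def u_def w_def x_def by (intro nn_integral_cong) (auto simp: indicator_def simp del: sum.lessThan_Suc)
    then have U_eq: "(\<lambda>m. \<integral>\<^sup>+s\<in>{0..T}. ennreal ((past_average g b T m (cell 0 T m s) -
        (\<Sum>j<Suc m. (d - c) / real (Suc m) * g (grid c d m j) * l s (b s - grid c d m j)))\<^sup>2) \<partial>lborel) = U"
      by (intro ext) (rule sym)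
    have U_lim: "U \<longlonglongrightarrow> 0"
      unfolding U_eq[symmetric] by (rule riemann_local_time_L2_tendsto[OF T b gc bnd supp cd l occ])
    have le: "\<forall>\<^sub>F m in sequentially. (\<integral>\<^sup>+s\<in>{0..T}. ennreal ((\<Psi> m s \<omega>)\<^sup>2) \<partial>lborel) \<le> 2 * U m + ennreal (2 * W\<^sup>2 * \<epsilon> m)"
      using elim(1)
    proof eventually_elim
      case (elim m)
      have "(\<integral>\<^sup>+s\<in>{0..T}. ennreal ((\<Psi> m s \<omega>)\<^sup>2) \<partial>lborel) =
          (\<integral>\<^sup>+s. ennreal ((u m s + (\<Sum>j<Suc m. w m j * a m j s))\<^sup>2) \<partial>lborel)"
      proof (rule nn_integral_cong_AE, use AE_lborel_singleton[of 0] in eventually_elim)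
        case (elim s)
        show ?case
        proof (cases "s \<in> {0<..T}")
          case True
          have "\<Psi> m s \<omega> = past_average g b T m (cell 0 T m s) + (\<Sum>j<Suc m. - w m j * \<Phi> m j s \<omega>)"
            unfolding \<Psi>_def sum_indicator_cell[OF T True] b_def ..
          also have "\<dots> = u m s + (\<Sum>j<Suc m. w m j * a m j s)"
            using True by (simp add: u_def a_def right_diff_distrib sum_subtractf sum_negf del: sum.lessThan_Suc)
          finally show ?thesis using True by simp
        next
          case False
          then show ?thesis using elim by (auto simp: u_def a_def)
        qed
      qed
      also have "\<dots> \<le> 2 * U m + ennreal (2 * W\<^sup>2 * \<epsilon> m)"
        unfolding U_def
      proof (rule nn_integral_power2_perturbation[OF u_meas a_meas wW])
        fix j assume j: "j < Suc m"
        have "(\<integral>\<^sup>+s. ennreal ((a m j s)\<^sup>2) \<partial>lborel) =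
            (\<integral>\<^sup>+s\<in>{0..T}. ennreal ((L s (B s \<omega> - x m j) \<omega> - \<Phi> m j s \<omega>)\<^sup>2) \<partial>lborel)"
          by (intro nn_integral_cong) (auto simp: a_def l_def b_def indicator_def)
        also have "\<dots> \<le> ennreal (\<epsilon> m)"
          using good[of \<omega> m j] elim j by blast
        finally show "(\<integral>\<^sup>+s. ennreal ((a m j s)\<^sup>2) \<partial>lborel) \<le> ennreal (\<epsilon> m)" .
      qed (use \<epsilon>[of m] in simp)
      finally show ?case .
    qed
    have "(\<lambda>m. ennreal (2 * W\<^sup>2 * \<epsilon> m)) \<longlonglongrightarrow> ennreal (2 * W\<^sup>2 * 0)"
      by (intro tendsto_ennrealI tendsto_mult \<epsilon>_lim tendsto_const)
    moreover have "(\<lambda>m. 2 * U m) \<longlonglongrightarrow> 2 * 0"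
      by (intro ennreal_tendsto_cmult U_lim) simp
    ultimately have "(\<lambda>m. 2 * U m + ennreal (2 * W\<^sup>2 * \<epsilon> m)) \<longlonglongrightarrow> 0"
      using tendsto_add[of "\<lambda>m. 2 * U m" "2 * 0" sequentially "\<lambda>m. ennreal (2 * W\<^sup>2 * \<epsilon> m)" "ennreal (2 * W\<^sup>2 * 0)"] by simp
    then show ?case
      by (rule tendsto_sandwich[OF _ le tendsto_const, rotated]) simp
  qed
  from elementary_integral_subseq[OF el\<Psi> less_imp_le[OF T] this] obtain r :: "nat \<Rightarrow> nat"
    where r: "strict_mono r" "AE \<omega> in M. (\<lambda>n. S (r n) \<omega> + (\<Sum>j<Suc (r n). - w (r n) j * Z (r n) j \<omega>)) \<longlonglongrightarrow> 0"
    by blast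
  have g'_avg: "\<bar>past_average g' (\<lambda>t. B t \<omega>) T n i\<bar> \<le> T * C'" if "i < Suc n" for n i \<omega>
    by (rule past_average_bound[OF T g'(2) that])
  \<comment> \<open>Three almost sure limits are each available along a subsequence only, so they
    are extracted one inside the other. Weights 1 give the plain quadratic variation.\<close>
  from quadratic_variation_subseq[OF T _ _ r(1), of "\<lambda>_ _ _. 1" 1] obtain p :: "nat \<Rightarrow> nat"
    where p: "strict_mono p" "AE \<omega> in M. (\<lambda>n. \<Sum>i<Suc (r (p n)).
      1 * ((B (grid 0 T (r (p n)) (Suc i)) \<omega> - B (grid 0 T (r (p n)) i) \<omega>)\<^sup>2 - T / real (Suc (r (p n))))) \<longlonglongrightarrow> 0"
    by (auto simp only: borel_measurable_const abs_one order_refl simp_thms)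
  have rp: "strict_mono (r \<circ> p)" using r(1) p(1) by (rule strict_mono_o)
  from quadratic_variation_subseq[OF T past_average_filtration[OF T _ g'_borel] g'_avg rp] obtain q :: "nat \<Rightarrow> nat"
    where q: "strict_mono q" "AE \<omega> in M. (\<lambda>n. \<Sum>i<Suc (r (p (q n))). past_average g' (\<lambda>t. B t \<omega>) T (r (p (q n))) i *
      ((B (grid 0 T (r (p (q n))) (Suc i)) \<omega> - B (grid 0 T (r (p (q n))) i) \<omega>)\<^sup>2 - T / real (Suc (r (p (q n)))))) \<longlonglongrightarrow> 0"
    unfolding comp_def using less_imp_le by blast
  define \<rho> where "\<rho> n = r (p (q n))" for n
  have \<rho>: "strict_mono \<rho>" unfolding \<rho>_def using r(1) p(1) q(1) by (simp add: strict_mono_def)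
  show ?thesis
    using ev_good continuous_paths J r(2) p(2) q(2)
  proof eventually_elim
    case (elim \<omega>)
    have b: "continuous_on {0..T} (\<lambda>t. B t \<omega>)" using elim(2) by (auto intro: continuous_on_subset)
    have qv: "(\<lambda>n. \<Sum>i<Suc (\<rho> n). (B (grid 0 T (\<rho> n) (Suc i)) \<omega> - B (grid 0 T (\<rho> n) i) \<omega>)\<^sup>2 - T / real (Suc (\<rho> n))) \<longlonglongrightarrow> 0"
      using LIMSEQ_subseq_LIMSEQ[OF elim(5) q(1)] by (simp only: comp_def \<rho>_def mult_1)
    have lim1: "(\<lambda>n. S (\<rho> n) \<omega>) \<longlonglongrightarrow> (LBINT u:{0..T}. G (B T \<omega> - B u \<omega>) - G 0) -
        1/2 * (LBINT s:{0..T}. LBINT u:{0..s}. g' (B s \<omega> - B u \<omega>))"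
      using ito_formula_along_path[OF T b G g g' \<rho> qv elim(6)[folded \<rho>_def]] by (simp only: S_def)
    have "continuous_on {c..d} (\<lambda>y. g y * J y \<omega>)"
      using elim(3) by (intro continuous_on_mult gc) (auto intro: continuous_on_subset)
    from riemann_sum_tendsto[OF cd this]
    have wJ: "(\<lambda>m. \<Sum>j<Suc m. w m j * J (x m j) \<omega>) \<longlonglongrightarrow> (LBINT y:{c..d}. g y * J y \<omega>)"
      by (simp only: w_def x_def sum_distrib_left mult.assoc)
    \<comment> \<open>On the good events every level errs by at most \<open>\<epsilon> m\<close>,
      and the weights have total mass at most \<open>W\<close>.\<close>
    have diff: "(\<lambda>m. \<Sum>j<Suc m. w m j * (Z m j \<omega> - J (x m j) \<omega>)) \<longlonglongrightarrow> 0"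
    proof (rule tendsto_rabs_zero_cancel, rule tendsto_sandwich[OF _ _ tendsto_const])
      show "(\<lambda>m. W * \<epsilon> m) \<longlonglongrightarrow> 0" using tendsto_mult[OF tendsto_const \<epsilon>_lim, of W] by simp
      show "\<forall>\<^sub>F m in sequentially. \<bar>\<Sum>j<Suc m. w m j * (Z m j \<omega> - J (x m j) \<omega>)\<bar> \<le> W * \<epsilon> m"
        using elim(1)
      proof eventually_elim
        case (elim m)
        have "\<bar>\<Sum>j<Suc m. w m j * (Z m j \<omega> - J (x m j) \<omega>)\<bar> \<le> (\<Sum>j<Suc m. \<bar>w m j\<bar> * \<epsilon> m)"
        proof (rule order_trans[OF sum_abs], rule sum_mono)
          fix j assume "j \<in> {..<Suc m}"
          then have "\<bar>Z m j \<omega> - J (x m j) \<omega>\<bar> \<le> \<epsilon> m" using good[of \<omega> m j] elim by blast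
          then show "\<bar>w m j * (Z m j \<omega> - J (x m j) \<omega>)\<bar> \<le> \<bar>w m j\<bar> * \<epsilon> m"
            unfolding abs_mult by (rule mult_left_mono) simp
        qed
        also have "\<dots> \<le> W * \<epsilon> m"
          unfolding sum_distrib_right[symmetric] using \<epsilon>[of m] by (intro mult_right_mono wW) simp
        finally show ?case .
      qed
    qed simp
    have "(\<lambda>m. \<Sum>j<Suc m. w m j * Z m j \<omega>) \<longlonglongrightarrow> (LBINT y:{c..d}. g y * J y \<omega>)"
      using tendsto_add[OF diff wJ] by (simp add: right_diff_distrib sum_subtractf del: sum.lessThan_Suc)
    from tendsto_add[OF elim(4) LIMSEQ_subseq_LIMSEQ[OF this r(1)]]
    have "(\<lambda>n. S (r n) \<omega>) \<longlonglongrightarrow> (LBINT y:{c..d}. g y * J y \<omega>)"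
      by (simp add: comp_def sum_negf del: sum.lessThan_Suc)
    from LIMSEQ_subseq_LIMSEQ[OF this strict_mono_o[OF p(1) q(1)]]
    have "(\<lambda>n. S (\<rho> n) \<omega>) \<longlonglongrightarrow> (LBINT y:{c..d}. g y * J y \<omega>)" by (simp add: comp_def \<rho>_def)
    \<comment> \<open>The grid integrals \<open>S\<close> have two limits: the integral of
      \<open>g * J\<close> through the Ito integrals, and the right side through Ito's
      formula.\<close>
    from LIMSEQ_unique[OF this lim1] show ?case .
  qed
qed

end

section \<open>Bump functions and continuity of the sign integral\<close>

text \<open>Covers the kink at 0 of the squared positive part, where the positive part itself is not
  differentiable.\<close>

lemma DERIV_of_quadratic_bound:
  fixes f :: "real \<Rightarrow> real"
  assumes "\<And>v. \<bar>f v - f u - D * (v - u)\<bar> \<le> K * (v - u)\<^sup>2"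
  shows "(f has_real_derivative D) (at u)"
  unfolding has_field_derivative_iff
proof (rule Lim_null[THEN iffD2], rule Lim_null_comparison)
  show "\<forall>\<^sub>F v in at u. norm ((f v - f u) / (v - u) - D) \<le> K * \<bar>v - u\<bar>"
  proof (rule eventually_at_filter[THEN iffD2], rule always_eventually, intro allI impI)
    fix v assume "v \<noteq> u"
    then have "(f v - f u) / (v - u) - D = (f v - f u - D * (v - u)) / (v - u)"
      by (simp add: diff_divide_distrib)
    then have "\<bar>(f v - f u) / (v - u) - D\<bar> = \<bar>f v - f u - D * (v - u)\<bar> / \<bar>v - u\<bar>" by simp
    also have "\<dots> \<le> K * (v - u)\<^sup>2 / \<bar>v - u\<bar>" by (intro divide_right_mono assms) simp
    also have "\<dots> = K * \<bar>v - u\<bar>"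
    proof -
      have sq: "(v - u)\<^sup>2 = \<bar>v - u\<bar> * \<bar>v - u\<bar>" by (simp add: power2_eq_square)
      have "K * (a * a) / a = K * a" if "a \<noteq> 0" for a :: real using that by simp
      from this[of "\<bar>v - u\<bar>"] show ?thesis unfolding sq using \<open>v \<noteq> u\<close> by auto
    qed
    finally show "norm ((f v - f u) / (v - u) - D) \<le> K * \<bar>v - u\<bar>" by simp
  qed
  have "((\<lambda>v. K * \<bar>v - u\<bar>) \<longlongrightarrow> K * \<bar>u - u\<bar>) (at u)" by (intro tendsto_intros)
  then show "((\<lambda>v. K * \<bar>v - u\<bar>) \<longlongrightarrow> 0) (at u)" by simp
qed

lemma DERIV_max_0_power2: "((\<lambda>u::real. (max 0 u)\<^sup>2) has_real_derivative 2 * max 0 u) (at u)"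
proof (rule DERIV_of_quadratic_bound[where K = 1])
  fix v :: real
  have "0 \<le> u * u - 2 * (u * v)" if "v < 0" "0 \<le> u"
    using mult_nonneg_nonpos[of u v] zero_le_square[of u] that by linarith
  moreover have uv: "u * v \<le> 0" if "u < 0" "0 \<le> v"
    using mult_nonneg_nonpos[of v u] that by (simp add: mult.commute)
  moreover have "0 \<le> v * v - 2 * (u * v) + u * u" if "u < 0" "0 \<le> v"
    using uv[OF that] zero_le_square[of u] zero_le_square[of v] by linarith
  moreover have "2 * (u * v) \<le> u * u + v * v"
    using zero_le_square[of "v - u"] by (simp add: algebra_simps)
  ultimately show "\<bar>(max 0 v)\<^sup>2 - (max 0 u)\<^sup>2 - 2 * max 0 u * (v - u)\<bar> \<le> 1 * (v - u)\<^sup>2"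
    by (cases "0 \<le> u"; cases "0 \<le> v")
      (auto simp: max_def power2_eq_square algebra_simps abs_if)
qed

text \<open>For \<open>c < d\<close> the squared positive part of a parabola with roots
  \<open>c\<close> and \<open>d\<close>: positive exactly between them and of class
  \<open>C^1\<close>, which is the smoothness in the definition of \<alpha>'. Rational end points
  give a countable family.\<close>

definition bump :: "real \<Rightarrow> real \<Rightarrow> real \<Rightarrow> real" where
  "bump c d x = (max 0 ((x - c) * (d - x)))\<^sup>2"

definition bump' :: "real \<Rightarrow> real \<Rightarrow> real \<Rightarrow> real" where
  "bump' c d x = 2 * max 0 ((x - c) * (d - x)) * (c + d - 2 * x)"

lemma DERIV_bump: "(bump c d has_real_derivative bump' c d x) (at x)"
proof -
  have "((\<lambda>x. (x - c) * (d - x)) has_real_derivative (c + d - 2 * x)) (at x)"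
    by (auto intro!: derivative_eq_intros)
  from DERIV_chain2[OF DERIV_max_0_power2 this] show ?thesis
    unfolding bump_def[abs_def] bump'_def by simp
qed

lemma bump_factor_neg:
  fixes c d x :: real
  assumes "c < d" "x \<notin> {c..d}"
  shows "(x - c) * (d - x) < 0"
  using assms by (auto simp: mult_less_0_iff)

lemma bump_support: "c < d \<Longrightarrow> x \<notin> {c..d} \<Longrightarrow> bump c d x = 0"
  and bump'_support: "c < d \<Longrightarrow> x \<notin> {c..d} \<Longrightarrow> bump' c d x = 0"
  using bump_factor_neg[of c d x] by (auto simp: bump_def bump'_def)

lemma bump_nonneg: "0 \<le> bump c d x"
  by (simp add: bump_def)

lemma bump_pos: "x \<in> {c<..<d} \<Longrightarrow> 0 < bump c d x"
  by (simp add: bump_def)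

lemma continuous_on_bump: "continuous_on A (bump c d)"
  and continuous_on_bump': "continuous_on A (bump' c d)"
  unfolding bump_def[abs_def] bump'_def[abs_def] by (intro continuous_intros)+

lemma compact_support_uniformly_continuous:
  fixes f :: "real \<Rightarrow> real"
  assumes "continuous_on UNIV f" "\<And>x. x \<notin> {c..d} \<Longrightarrow> f x = 0"
  shows "uniformly_continuous_on UNIV f"
  unfolding uniformly_continuous_on_def dist_real_def
proof (intro allI impI)
  fix e :: real assume "0 < e"
  \<comment> \<open>One unit of margin: if two points are closer than 1 and one lies in
    \<open>{c..d}\<close>, both lie in the larger interval.\<close>
  have "continuous_on {c - 1..d + 1} f" using assms(1) by (rule continuous_on_subset) simp
  from compact_uniformly_continuous[OF this compact_Icc] \<open>0 < e\<close>
  obtain \<delta> where \<delta>: "0 < \<delta>" "\<forall>x\<in>{c - 1..d + 1}. \<forall>x'\<in>{c - 1..d + 1}. \<bar>x' - x\<bar> < \<delta> \<longrightarrow> \<bar>f x' - f x\<bar> < e"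
    unfolding uniformly_continuous_on_def dist_real_def by blast
  show "\<exists>\<delta>>0. \<forall>x\<in>UNIV. \<forall>x'\<in>UNIV. \<bar>x' - x\<bar> < \<delta> \<longrightarrow> \<bar>f x' - f x\<bar> < e"
  proof (intro exI[of _ "min \<delta> 1"] conjI ballI impI)
    fix x x' :: real assume *: "\<bar>x' - x\<bar> < min \<delta> 1"
    show "\<bar>f x' - f x\<bar> < e"
    proof (cases "x \<in> {c..d} \<or> x' \<in> {c..d}")
      case True
      then have "x \<in> {c - 1..d + 1}" "x' \<in> {c - 1..d + 1}" using * by auto
      then show ?thesis using \<delta>(2) * by simp
    qed (use assms(2) \<open>0 < e\<close> in auto)
  qed (use \<delta>(1) in simp)
qed

lemma compact_support_bounded:
  fixes f :: "real \<Rightarrow> real"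
  assumes "continuous_on UNIV f" "\<And>x. x \<notin> {c..d} \<Longrightarrow> f x = 0"
  obtains C where "\<And>x. \<bar>f x\<bar> \<le> C"
proof -
  have "continuous_on {c..d} f" using assms(1) by (rule continuous_on_subset) simp
  then obtain C where C: "0 \<le> C" "\<And>x. x \<in> {c..d} \<Longrightarrow> \<bar>f x\<bar> \<le> C"
    using continuous_on_compact_bound[OF _ compact_Icc] by blast
  then have "\<bar>f x\<bar> \<le> C" for x using assms(2)[of x] by (cases "x \<in> {c..d}") auto
  then show thesis by (rule that)
qed

section \<open>Sign integrals and antiderivatives\<close>

lemma continuous_antiderivative:
  fixes f :: "real \<Rightarrow> real"
  assumes "continuous_on UNIV f"
  obtains F where "\<And>x. (F has_real_derivative f x) (at x)"
proof -
  have "isCont f x" for x using assms by (simp add: continuous_on_eq_continuous_at)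
  then have "\<exists>F. \<forall>x::real. -\<infinity> < ereal x \<longrightarrow> ereal x < \<infinity> \<longrightarrow> (F has_vector_derivative f x) (at x)"
    by (intro einterval_antiderivative) auto
  then show thesis using that by (auto simp: has_real_derivative_iff_has_vector_derivative)
qed

text \<open>In the sense of distributions \<open>sgn\<close> has derivative twice a point mass.
  Concretely, split at \<open>y\<close> clamped to \<open>{c..d}\<close>: \<open>g\<close> enters
  with sign 1 on the left and -1 on the right, and \<open>P\<close> is constant on either side of
  the interval.\<close>

lemma integral_against_sgn:
  fixes g P :: "real \<Rightarrow> real"
  assumes P: "\<And>x. (P has_real_derivative g x) (at x)" and g: "continuous_on UNIV g"
    and supp: "\<And>x. x \<notin> {c..d} \<Longrightarrow> g x = 0" and cd: "c < d"
  shows "(LBINT x:{c..d}. g x * sgn (y - x)) = 2 * P y - P c - P d"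
proof -
  define z where "z = max c (min d y)"
  have z: "c \<le> z" "z \<le> d" using cd by (auto simp: z_def)
  have gcont: "isCont g x" for x using g by (simp add: continuous_on_eq_continuous_at)
  have Pz: "P z = P y"
  proof -
    consider "y < c" | "d < y" | "y \<in> {c..d}" by fastforce
    then show ?thesis
    proof cases
      case 1
      then obtain t where "y < t" "t < c" "P c - P y = (c - y) * g t" using MVT2[OF _ P] by blast
      then show ?thesis using supp[of t] 1 cd by (simp add: z_def)
    next
      case 2
      then obtain t where "d < t" "t < y" "P y - P d = (y - d) * g t" using MVT2[OF _ P] by blast
      then show ?thesis using supp[of t] 2 cd by (simp add: z_def)
    qed (auto simp: z_def)
  qed
  have FTC: "integrable lborel (\<lambda>x. g x * indicator {a..b} x)"
    "(\<integral>x. g x * indicator {a..b} x \<partial>lborel) = P b - P a" if "a \<le> b" for a b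
    using integral_FTC_Icc_real[OF that P gcont] borel_integrable_atLeastAtMost[of a b g] gcont
    by (auto simp: mult.commute indicator_def)
  have "(LBINT x:{c..d}. g x * sgn (y - x)) = (\<integral>x. g x * indicator {c..z} x - g x * indicator {z..d} x \<partial>lborel)"
    unfolding set_lebesgue_integral_def
  proof (rule integral_cong_AE)
    show "(\<lambda>x. indicator {c..d} x *\<^sub>R (g x * sgn (y - x))) \<in> borel_measurable lborel"
      using borel_measurable_continuous_onI[OF g] by measurable
    \<comment> \<open>At \<open>c\<close>, \<open>d\<close> or \<open>y\<close> the two closed
      intervals may overlap and \<open>sgn\<close> may be 0; these points are null.\<close>
    show "AE x in lborel. indicator {c..d} x *\<^sub>R (g x * sgn (y - x)) = g x * indicator {c..z} x - g x * indicator {z..d} x"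
      using AE_lborel_singleton[of c] AE_lborel_singleton[of d] AE_lborel_singleton[of y]
      by eventually_elim (auto simp: indicator_def z_def max_def min_def sgn_if split: if_splits)
  qed (use borel_measurable_continuous_onI[OF g] in measurable)
  also have "\<dots> = (P z - P c) - (P d - P z)"
    using FTC[OF z(1)] FTC[OF z(2)] by simp
  finally show ?thesis unfolding Pz by simp
qed

text \<open>Apply \<open>integral_against_sgn\<close> at \<open>a - b u\<close> and at 0 and
  subtract: the constants \<open>P c + P d\<close> cancel, and \<open>- sgn (0 - x) = sgn x\<close>
  leaves the term \<open>T * sgn x\<close> after integration over \<open>u\<close>. Fubini exchanges
  the two integrals.\<close>

lemma integral_antiderivative_increment:
  fixes g P b :: "real \<Rightarrow> real"
  assumes P: "\<And>x. (P has_real_derivative g x) (at x)" and g: "continuous_on UNIV g"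
    and supp: "\<And>x. x \<notin> {c..d} \<Longrightarrow> g x = 0" and cd: "c < d"
    and b: "continuous_on {0..T} b" and T: "0 < T"
  shows "(LBINT u:{0..T}. P (a - b u) - P 0) =
    1/2 * (LBINT x:{c..d}. g x * ((LBINT u:{0..T}. sgn (a - b u - x)) + T * sgn x))"
proof -
  have [measurable]: "g \<in> borel_measurable borel" by (rule borel_measurable_continuous_onI[OF g])
  obtain C where C: "\<And>x. \<bar>g x\<bar> \<le> C" using compact_support_bounded[OF g supp] by blast
  have C0: "0 \<le> C" using C[of 0] by simp
  \<comment> \<open>Extended by 0 to a Borel function, since \<open>b\<close> is controlled on
    \<open>{0..T}\<close> only.\<close>
  define \<beta> where "\<beta> u = (if u \<in> {0..T} then b u else 0)" for u
  have [measurable]: "\<beta> \<in> borel_measurable borel" unfolding \<beta>_def by (rule borel_measurable_on_Icc[OF b])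
  define f where "f u x = indicator {0..T} u * (indicator {c..d} x * (g x * (sgn (a - \<beta> u - x) + sgn x)))" for u x
  have f_int: "integrable (lborel \<Otimes>\<^sub>M lborel) (\<lambda>(u, x). f u x)"
  proof (rule integrableI_bounded_set[where A = "{0..T} \<times> {c..d}" and B = "2 * C"])
    show "(\<lambda>(u, x). f u x) \<in> borel_measurable (lborel \<Otimes>\<^sub>M lborel)" unfolding f_def by measurable
    show "emeasure (lborel \<Otimes>\<^sub>M lborel) ({0..T} \<times> {c..d}) < \<infinity>"
      using T cd by (simp add: lborel.emeasure_pair_measure_Times ennreal_mult_less_top)
    show "AE z in lborel \<Otimes>\<^sub>M lborel. z \<in> {0..T} \<times> {c..d} \<longrightarrow> norm (case z of (u, x) \<Rightarrow> f u x) \<le> 2 * C"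
    proof (intro AE_I2 impI)
      fix z :: "real \<times> real" assume "z \<in> {0..T} \<times> {c..d}"
      then obtain u x where z: "z = (u, x)" "u \<in> {0..T}" "x \<in> {c..d}" by auto
      have "\<bar>sgn (a - \<beta> u - x) + sgn x\<bar> \<le> 2" by (auto simp: sgn_if)
      then have "\<bar>g x\<bar> * \<bar>sgn (a - \<beta> u - x) + sgn x\<bar> \<le> C * 2" using C[of x] C0 by (intro mult_mono) auto
      then show "norm (case z of (u, x) \<Rightarrow> f u x) \<le> 2 * C" using z by (simp add: f_def abs_mult)
    qed
  qed (auto simp: f_def indicator_def)
  have sgn_int: "set_integrable lborel {0..T} (\<lambda>u. sgn (a - \<beta> u - x))" for x
    unfolding set_integrable_def
  proof (rule integrableI_bounded_set[where A = "{0..T}" and B = 1])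
    show "AE u in lborel. u \<in> {0..T} \<longrightarrow> norm (indicator {0..T} u *\<^sub>R sgn (a - \<beta> u - x)) \<le> 1"
      by (intro AE_I2) (auto simp: sgn_if)
  qed (use T in auto)
  have in_x: "(\<integral>u. f u x \<partial>lborel) = indicator {c..d} x * (g x * ((LBINT u:{0..T}. sgn (a - b u - x)) + T * sgn x))" for x
  proof -
    have "(\<integral>u. f u x \<partial>lborel) = indicator {c..d} x * (g x * (\<integral>u. indicator {0..T} u *\<^sub>R sgn (a - \<beta> u - x) + indicator {0..T} u * sgn x \<partial>lborel))"
      unfolding f_def integral_mult_right_zero[symmetric]
      by (intro Bochner_Integration.integral_cong refl) (simp add: algebra_simps)
    also have "(\<integral>u. indicator {0..T} u *\<^sub>R sgn (a - \<beta> u - x) + indicator {0..T} u * sgn x \<partial>lborel) =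
        (\<integral>u. indicator {0..T} u *\<^sub>R sgn (a - \<beta> u - x) \<partial>lborel) + (\<integral>u. indicator {0..T} u * sgn x \<partial>lborel)"
      using sgn_int[of x] T by (intro Bochner_Integration.integral_add) (auto simp: set_integrable_def)
    also have "(\<integral>u. indicator {0..T} u *\<^sub>R sgn (a - \<beta> u - x) \<partial>lborel) = (LBINT u:{0..T}. sgn (a - b u - x))"
      unfolding set_lebesgue_integral_def
      by (intro Bochner_Integration.integral_cong refl) (simp add: \<beta>_def indicator_def)
    finally show ?thesis using T by simp
  qed
  have in_u: "(\<integral>x. f u x \<partial>lborel) = indicator {0..T} u * (2 * (P (a - b u) - P 0))" for u
  proof -
    have sg: "set_integrable lborel {c..d} (\<lambda>x. g x * sgn (v - x))" for v
      unfolding set_integrable_def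
    proof (rule integrableI_bounded_set[where A = "{c..d}" and B = C])
      show "AE x in lborel. x \<in> {c..d} \<longrightarrow> norm (indicator {c..d} x *\<^sub>R (g x * sgn (v - x))) \<le> C"
        using C C0 by (intro AE_I2) (auto simp: sgn_if abs_mult)
    qed (use cd in auto)
    have sg_eq: "(\<integral>x. indicator {c..d} x *\<^sub>R (g x * sgn (v - x)) \<partial>lborel) = 2 * P v - P c - P d" for v
      using integral_against_sgn[where y = v, OF P g supp cd] unfolding set_lebesgue_integral_def .
    have "(\<integral>x. f u x \<partial>lborel) = indicator {0..T} u * (\<integral>x. indicator {c..d} x *\<^sub>R (g x * sgn ((a - \<beta> u) - x)) -
        indicator {c..d} x *\<^sub>R (g x * sgn (0 - x)) \<partial>lborel)"
      unfolding f_def integral_mult_right_zero[symmetric]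
      by (intro Bochner_Integration.integral_cong refl) (simp add: algebra_simps sgn_minus)
    also have "(\<integral>x. indicator {c..d} x *\<^sub>R (g x * sgn ((a - \<beta> u) - x)) -
        indicator {c..d} x *\<^sub>R (g x * sgn (0 - x)) \<partial>lborel) =
        (\<integral>x. indicator {c..d} x *\<^sub>R (g x * sgn ((a - \<beta> u) - x)) \<partial>lborel) -
        (\<integral>x. indicator {c..d} x *\<^sub>R (g x * sgn (0 - x)) \<partial>lborel)"
      by (rule Bochner_Integration.integral_diff[OF sg[unfolded set_integrable_def] sg[unfolded set_integrable_def]])
    also have "\<dots> = 2 * (P (a - \<beta> u) - P 0)"
      unfolding sg_eq by simp
    finally show ?thesis by (simp add: \<beta>_def indicator_def)
  qed
  have "(LBINT u:{0..T}. P (a - b u) - P 0) = 1/2 * (\<integral>u. \<integral>x. f u x \<partial>lborel \<partial>lborel)"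
    unfolding in_u set_lebesgue_integral_def integral_mult_right_zero[symmetric]
    by (intro Bochner_Integration.integral_cong refl) simp
  also have "(\<integral>u. \<integral>x. f u x \<partial>lborel \<partial>lborel) = (\<integral>x. \<integral>u. f u x \<partial>lborel \<partial>lborel)"
    using lborel_pair.Fubini_integral[OF f_int] by simp
  finally show ?thesis unfolding in_x set_lebesgue_integral_def by simp
qed

text \<open>The sign jumps only where \<open>b u = b t - x\<close>, and by the occupation formula
  the path spends no time at a given level. Off this null set the integrands converge, and they are
  bounded by 1.\<close>

lemma continuous_on_sgn_integral:
  fixes b :: "real \<Rightarrow> real" and l :: "real \<Rightarrow> real \<Rightarrow> real"
  assumes b: "continuous_on {0..} b"
    and occ: "\<And>s h. 0 \<le> s \<Longrightarrow> h \<in> borel_measurable borel \<Longrightarrow> bounded (range h) \<Longrightarrow>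
      (LBINT u:{0..s}. h (b u)) = (LBINT y. h y * l s y)"
  shows "continuous_on ({0..} \<times> UNIV) (\<lambda>(t, x). LBINT u:{0..t}. sgn (b t - b u - x))"
  unfolding continuous_on_sequentially
proof (intro allI ballI impI)
  fix z :: "nat \<Rightarrow> real \<times> real" and a :: "real \<times> real"
  assume a: "a \<in> {0..} \<times> UNIV" and z: "(\<forall>n. z n \<in> {0..} \<times> UNIV) \<and> z \<longlonglongrightarrow> a"
  define t where "t n = fst (z n)" for n
  define x where "x n = snd (z n)" for n
  define t0 where "t0 = fst a"
  define x0 where "x0 = snd a"
  have t: "\<And>n. 0 \<le> t n" "0 \<le> t0" using a z by (auto simp: t_def t0_def mem_Times_iff)
  have lim: "t \<longlonglongrightarrow> t0" "x \<longlonglongrightarrow> x0"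
    using z unfolding t_def[abs_def] t0_def x_def[abs_def] x0_def by (auto intro: tendsto_fst tendsto_snd)
  \<comment> \<open>A common time horizon: all integrals are rewritten over \<open>{0..K}\<close>,
    with the varying end point moved into the integrand.\<close>
  obtain K where K: "\<And>n. t n \<le> K"
  proof -
    have "Bseq t" using lim(1) by (intro convergent_imp_Bseq) (auto simp: convergent_def)
    then obtain K where "\<And>n. norm (t n) \<le> K" unfolding Bseq_def by blast
    then have "t n \<le> K" for n by (metis abs_le_D1 real_norm_def)
    then show thesis by (rule that)
  qed
  have K0: "t0 \<le> K" by (rule LIMSEQ_le_const2[OF lim(1)]) (use K in auto)
  have bK: "continuous_on {0..K} b" using b by (rule continuous_on_subset) auto
  define \<beta> where "\<beta> u = (if u \<in> {0..K} then b u else 0)" for u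
  have [measurable]: "\<beta> \<in> borel_measurable borel" unfolding \<beta>_def by (rule borel_measurable_on_Icc[OF bK])
  let ?f = "\<lambda>s y u. if u \<le> s then sgn (b s - \<beta> u - y) else 0"
  have eq: "(LBINT u:{0..s}. sgn (b s - b u - y)) = (LBINT u:{0..K}. ?f s y u)" if "0 \<le> s" "s \<le> K" for s y
    unfolding set_lebesgue_integral_def
    by (intro Bochner_Integration.integral_cong refl) (use that in \<open>auto simp: indicator_def \<beta>_def\<close>)
  have level_null: "AE u in lborel. u \<in> {0..t0} \<longrightarrow> b u \<noteq> b t0 - x0"
  proof -
    let ?y = "b t0 - x0"
    have "(LBINT u:{0..t0}. indicator {?y} (b u) :: real) = (LBINT y. indicator {?y} y * l t0 y)"
      by (rule occ) (use t in \<open>auto simp: bounded_iff indicator_def intro!: exI[of _ 1]\<close>)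
    also have "\<dots> = 0"
      by (rule integral_eq_zero_AE) (use AE_lborel_singleton[of ?y] in \<open>eventually_elim, auto\<close>)
    finally have "(\<integral>u. indicator {0..t0} u * indicator {?y} (\<beta> u) \<partial>lborel) = (0 :: real)"
      unfolding set_lebesgue_integral_def
      by (subst (asm) Bochner_Integration.integral_cong[OF refl, where g = "\<lambda>u. indicator {0..t0} u * indicator {?y} (\<beta> u)"])
        (use K0 in \<open>auto simp: \<beta>_def indicator_def\<close>)
    moreover have "integrable lborel (\<lambda>u. indicator {0..t0} u * indicator {?y} (\<beta> u) :: real)"
      by (rule integrableI_bounded_set[where A = "{0..t0}" and B = 1]) (use t in \<open>auto simp: indicator_def\<close>)
    ultimately have "AE u in lborel. indicator {0..t0} u * indicator {?y} (\<beta> u) = (0 :: real)"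
      by (subst integral_nonneg_eq_0_iff_AE[symmetric]) auto
    then show ?thesis by eventually_elim (use K0 in \<open>auto simp: \<beta>_def indicator_def split: if_splits\<close>)
  qed
  have "(\<lambda>n. LBINT u:{0..K}. ?f (t n) (x n) u) \<longlonglongrightarrow> (LBINT u:{0..K}. ?f t0 x0 u)"
  proof (rule set_integral_tendsto_bounded)
    show "AE u in lborel. u \<in> {0..K} \<longrightarrow> (\<lambda>n. ?f (t n) (x n) u) \<longlonglongrightarrow> ?f t0 x0 u"
      using level_null AE_lborel_singleton[of t0]
    proof (eventually_elim, intro impI)
      fix u assume u: "u \<in> {0..t0} \<longrightarrow> b u \<noteq> b t0 - x0" "u \<noteq> t0" "u \<in> {0..K}"
      show "(\<lambda>n. ?f (t n) (x n) u) \<longlonglongrightarrow> ?f t0 x0 u"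
      proof (cases "u < t0")
        case True
        have "(\<lambda>n. b (t n)) \<longlonglongrightarrow> b t0"
          by (rule continuous_on_tendsto_compose[OF b lim(1)]) (use t in auto)
        then have "(\<lambda>n. sgn (b (t n) - \<beta> u - x n)) \<longlonglongrightarrow> sgn (b t0 - \<beta> u - x0)"
          using u True by (intro tendsto_sgn tendsto_diff lim(2) tendsto_const) (auto simp: \<beta>_def)
        moreover have "\<forall>\<^sub>F n in sequentially. sgn (b (t n) - \<beta> u - x n) = ?f (t n) (x n) u"
          using order_tendstoD(1)[OF lim(1) True] by eventually_elim auto
        ultimately show ?thesis using True by (simp add: tendsto_cong)
      next
        case False
        then have "t0 < u" using u(2) by simp
        from order_tendstoD(2)[OF lim(1) this] have "\<forall>\<^sub>F n in sequentially. ?f (t n) (x n) u = 0"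
          by eventually_elim auto
        then have "(\<lambda>n. ?f (t n) (x n) u) \<longlonglongrightarrow> 0" by (rule tendsto_eventually)
        then show ?thesis using \<open>t0 < u\<close> by simp
      qed
    qed
    show "AE u in lborel. u \<in> {0..K} \<longrightarrow> \<bar>?f (t n) (x n) u\<bar> \<le> 1" for n
      by (intro AE_I2) (auto simp: sgn_if)
  qed measurable
  then have "(\<lambda>n. LBINT u:{0..t n}. sgn (b (t n) - b u - x n)) \<longlonglongrightarrow> (LBINT u:{0..t0}. sgn (b t0 - b u - x0))"
    using eq t K K0 by simp
  then show "((\<lambda>(t, x). LBINT u:{0..t}. sgn (b t - b u - x)) \<circ> z) \<longlonglongrightarrow>
      (\<lambda>(t, x). LBINT u:{0..t}. sgn (b t - b u - x)) a"
    by (simp add: comp_def case_prod_beta t_def x_def t0_def x0_def)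
qed

text \<open>Where \<open>f\<close> is positive, a bump with rational end points close to
  \<open>x\<close> has a positive integral against it; the same argument applies to
  \<open>- f\<close>.\<close>

lemma continuous_zero_if_bump_integrals_zero:
  fixes f :: "real \<Rightarrow> real"
  assumes f: "continuous_on UNIV f"
    and zero: "\<And>c d. c \<in> \<rat> \<Longrightarrow> d \<in> \<rat> \<Longrightarrow> c < d \<Longrightarrow> (LBINT x:{c..d}. bump c d x * f x) = 0"
  shows "f x = 0"
proof -
  have nonpos: "h x \<le> 0" if h: "continuous_on UNIV h"
    and z: "\<And>c d. c \<in> \<rat> \<Longrightarrow> d \<in> \<rat> \<Longrightarrow> c < d \<Longrightarrow> (LBINT x:{c..d}. bump c d x * h x) = 0" for h :: "real \<Rightarrow> real"
  proof (rule ccontr)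
    assume "\<not> h x \<le> 0"
    then have "0 < h x" by simp
    moreover have "open {y. 0 < h y}" by (rule open_Collect_less[OF continuous_on_const h])
    ultimately obtain e where e: "0 < e" "\<And>y. \<bar>y - x\<bar> < e \<Longrightarrow> 0 < h y"
      unfolding open_dist dist_real_def by (metis mem_Collect_eq)
    obtain c where c: "c \<in> \<rat>" "x - e < c" "c < x" using Rats_dense_in_real[of "x - e" x] e(1) by auto
    obtain d where d: "d \<in> \<rat>" "x < d" "d < x + e" using Rats_dense_in_real[of x "x + e"] e(1) by auto
    have h_pos: "0 < h y" if "y \<in> {c..d}" for y using that c d by (intro e(2)) auto
    have cont: "continuous_on {c..d} (\<lambda>y. bump c d y * h y)"
      using h by (intro continuous_on_mult continuous_on_bump) (auto intro: continuous_on_subset)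
    have "set_integrable lborel {c..d} (\<lambda>y. bump c d y * h y)"
      by (rule borel_integrable_atLeastAtMost'[OF cont])
    moreover have "(LBINT y:{c..d}. bump c d y * h y) = 0" using c d by (intro z) auto
    ultimately have "AE y in lborel. indicator {c..d} y *\<^sub>R (bump c d y * h y) = 0"
      unfolding set_integrable_def set_lebesgue_integral_def
      by (subst integral_nonneg_eq_0_iff_AE[symmetric])
        (auto simp: indicator_def bump_nonneg h_pos less_imp_le)
    then have "AE y in lborel. y \<notin> {c<..<d}"
    proof eventually_elim
      case (elim y)
      show ?case
      proof
        assume y: "y \<in> {c<..<d}"
        then have "0 < bump c d y * h y" using bump_pos[OF y] h_pos[of y] by simp
        moreover have "bump c d y * h y = 0" using elim y by auto
        ultimately show False by linarith
      qed
    qed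
    then have "{c<..<d} \<in> null_sets lborel" by (subst AE_iff_null_sets) auto
    then show False using c d by (simp add: null_sets_def)
  qed
  have "- f x \<le> 0"
    by (rule nonpos[of "\<lambda>y. - f y"])
      (use zero f in \<open>auto intro: continuous_on_minus simp: set_lebesgue_integral_def\<close>)
  moreover have "f x \<le> 0" by (rule nonpos[OF f zero])
  ultimately show ?thesis by simp
qed

section \<open>The pointwise identity\<close>

context brownian_motion begin

text \<open>The terms are grouped as \<open>\<alpha> T x + T * sgn x\<close>, whose continuity in
  \<open>x\<close> is known, whereas for \<alpha> alone the definition supplies integrability
  against the bump. The separate integrals are therefore formed under the bump.\<close>

lemma bump_identity:
  assumes lt: "local_time M B L" and \<alpha>: "self_intersection_local_time_deriv M B \<alpha>"
    and ito: "\<And>x. ito_integral M B (\<lambda>s \<omega>. L s (B s \<omega> - x) \<omega>) T (J x)"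
    and J: "AE \<omega> in M. continuous_on UNIV (\<lambda>x. J x \<omega>)" and T: "0 < T" and cd: "c < d"
  shows "AE \<omega> in M. (LBINT x:{c..d}. bump c d x * (J x \<omega> - 1/2 * (\<alpha> T x \<omega> + T * sgn x) -
    1/2 * (LBINT u:{0..T}. sgn (B T \<omega> - B u \<omega> - x)))) = 0"
proof -
  let ?g = "bump c d"
  obtain G where G: "\<And>x. (G has_real_derivative ?g x) (at x)"
    using continuous_antiderivative[OF continuous_on_bump] by blast
  obtain C where C: "\<And>x. \<bar>?g x\<bar> \<le> C"
    using compact_support_bounded[OF continuous_on_bump bump_support[OF cd]] by blast
  obtain C' where C': "\<And>x. \<bar>bump' c d x\<bar> \<le> C'"
    using compact_support_bounded[OF continuous_on_bump' bump'_support[OF cd]] by blast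
  have uc: "uniformly_continuous_on UNIV (bump' c d)"
    by (rule compact_support_uniformly_continuous[OF continuous_on_bump' bump'_support[OF cd]])
  have \<alpha>_paths: "AE \<omega> in M. continuous_on ({0..} \<times> UNIV) (\<lambda>(t, y). \<alpha> t y \<omega> + t * sgn y) \<and>
      integrable lborel (\<lambda>y. ?g y * \<alpha> T y \<omega>) \<and>
      (LBINT s:{0..T}. (LBINT r:{0..s}. bump' c d (B s \<omega> - B r \<omega>))) = - (LBINT y. ?g y * \<alpha> T y \<omega>)"
  proof -
    have "(\<forall>y. (?g has_real_derivative bump' c d y) (at y)) \<and> continuous_on UNIV (bump' c d)"
      using DERIV_bump continuous_on_bump' by blast
    moreover have "AE \<omega> in M. continuous_on ({0..} \<times> UNIV) (\<lambda>(t, y). \<alpha> t y \<omega> + t * sgn y) \<and>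
      (\<forall>t\<ge>0. \<forall>g g'. (\<forall>y. (g has_real_derivative g' y) (at y)) \<and> continuous_on UNIV g' \<longrightarrow>
        integrable lborel (\<lambda>y. g y * \<alpha> t y \<omega>) \<and>
        (LBINT s:{0..t}. (LBINT r:{0..s}. g' (B s \<omega> - B r \<omega>))) = - (LBINT y. g y * \<alpha> t y \<omega>))"
      using \<alpha> unfolding self_intersection_local_time_deriv_def by blast
    ultimately show ?thesis
      by (elim eventually_mono) (use T in \<open>blast intro: less_imp_le\<close>)
  qed
  have "AE \<omega> in M. (LBINT x:{c..d}. ?g x * J x \<omega>) = (LBINT u:{0..T}. G (B T \<omega> - B u \<omega>) - G 0) -
      1/2 * (LBINT s:{0..T}. LBINT u:{0..s}. bump' c d (B s \<omega> - B u \<omega>))"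
    by (rule smeared_identity[OF lt T ito J G DERIV_bump uc C' C _ cd]) (rule bump_support[OF cd])
  then show ?thesis
    using continuous_paths local_time_paths[OF lt] \<alpha>_paths J
  proof eventually_elim
    case (elim \<omega>)
    define b where "b t = B t \<omega>" for t
    define \<sigma> where "\<sigma> x = (LBINT u:{0..T}. sgn (b T - b u - x))" for x
    define A where "A x = \<alpha> T x \<omega>" for x
    define E where "E f = (LBINT x:{c..d}. f x)" for f :: "real \<Rightarrow> real"
    have b: "continuous_on {0..} b" unfolding b_def using elim(2) .
    have occ: "(LBINT u:{0..s}. h (b u)) = (LBINT y. h y * L s y \<omega>)"
      if "0 \<le> s" "h \<in> borel_measurable borel" "bounded (range h)" for s h
      using elim(3)[THEN conjunct2, rule_format, OF that] unfolding b_def by simp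
    have "continuous_on UNIV (\<lambda>x. case (T, x) of (t, x) \<Rightarrow> LBINT u:{0..t}. sgn (b t - b u - x))"
      by (rule continuous_on_compose2[OF continuous_on_sgn_integral[OF b occ]])
        (use T in \<open>auto intro!: continuous_intros\<close>)
    then have \<sigma>_cont: "continuous_on UNIV \<sigma>" by (simp add: \<sigma>_def[abs_def])
    have "continuous_on UNIV (\<lambda>x. case (T, x) of (t, x) \<Rightarrow> \<alpha> t x \<omega> + t * sgn x)"
      by (rule continuous_on_compose2[OF elim(4)[THEN conjunct1]])
        (use T in \<open>auto intro!: continuous_intros\<close>)
    then have A_cont: "continuous_on UNIV (\<lambda>x. A x + T * sgn x)" by (simp add: A_def[abs_def])
    have int_cont: "set_integrable lborel {c..d} (\<lambda>x. ?g x * f x)" if "continuous_on UNIV f" for f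
      by (intro borel_integrable_atLeastAtMost' continuous_on_mult continuous_on_bump continuous_on_subset[OF that]) simp
    note iJ = int_cont[OF elim(5)] and i\<sigma> = int_cont[OF \<sigma>_cont]
    \<comment> \<open>The bump vanishes outside \<open>{c..d}\<close>, so the integral over the line
      in the definition of \<alpha>' is one over the interval.\<close>
    have gA: "(\<lambda>x. indicator {c..d} x *\<^sub>R (?g x * A x)) = (\<lambda>x. ?g x * \<alpha> T x \<omega>)"
      using bump_support[OF cd] by (auto simp: A_def indicator_def fun_eq_iff)
    have iA: "set_integrable lborel {c..d} (\<lambda>x. ?g x * A x)"
      unfolding set_integrable_def gA using elim(4) by blast
    have EA: "E (\<lambda>x. ?g x * A x) = (LBINT y. ?g y * \<alpha> T y \<omega>)"
      unfolding E_def set_lebesgue_integral_def gA ..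
    have "(\<lambda>x. ?g x * (A x + T * sgn x) - ?g x * A x) = (\<lambda>x. ?g x * (T * sgn x))"
      by (simp add: algebra_simps)
    \<comment> \<open>Integrability of the sign term is read off from the continuous combination
      minus the \<alpha> part.\<close>
    with set_integral_diff(1)[OF int_cont[OF A_cont] iA]
    have iS: "set_integrable lborel {c..d} (\<lambda>x. ?g x * (T * sgn x))" by simp
    \<comment> \<open>The double integral is minus the integral against \<alpha>, so the Ito
      correction enters with a plus sign.\<close>
    have lin: "j - 1/2 * (e + f) - 1/2 * a = 0" if "j = 1/2 * (a + f) - 1/2 * - e" for j a e f :: real
      using that by (simp add: field_simps)
    have "E (\<lambda>x. ?g x * J x \<omega>) = (LBINT u:{0..T}. G (b T - b u) - G 0) -
        1/2 * (LBINT s:{0..T}. LBINT u:{0..s}. bump' c d (b s - b u))"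
      unfolding E_def b_def by (rule elim(1))
    also have "(LBINT u:{0..T}. G (b T - b u) - G 0) = 1/2 * E (\<lambda>x. ?g x * (\<sigma> x + T * sgn x))"
      unfolding E_def \<sigma>_def
    proof (rule integral_antiderivative_increment[OF G continuous_on_bump _ cd _ T])
      show "continuous_on {0..T} b" by (rule continuous_on_subset[OF b]) simp
    qed (rule bump_support[OF cd])
    also have "E (\<lambda>x. ?g x * (\<sigma> x + T * sgn x)) = E (\<lambda>x. ?g x * \<sigma> x) + E (\<lambda>x. ?g x * (T * sgn x))"
      unfolding E_def distrib_left by (rule set_integral_add(2)[OF i\<sigma> iS])
    also have "(LBINT s:{0..T}. LBINT u:{0..s}. bump' c d (b s - b u)) = - E (\<lambda>x. ?g x * A x)"
      unfolding EA b_def using elim(4) by blast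
    finally have main: "E (\<lambda>x. ?g x * J x \<omega>) - 1/2 * (E (\<lambda>x. ?g x * A x) + E (\<lambda>x. ?g x * (T * sgn x)))
        - 1/2 * E (\<lambda>x. ?g x * \<sigma> x) = 0" by (rule lin)
    have iA2: "set_integrable lborel {c..d} (\<lambda>x. 1/2 * (?g x * A x + ?g x * (T * sgn x)))"
      and i\<sigma>2: "set_integrable lborel {c..d} (\<lambda>x. 1/2 * (?g x * \<sigma> x))"
      using set_integral_add(1)[OF iA iS] i\<sigma> by (intro set_integrable_mult_right; simp)+
    have "E (\<lambda>x. ?g x * (J x \<omega> - 1/2 * (A x + T * sgn x) - 1/2 * \<sigma> x)) =
        E (\<lambda>x. ?g x * J x \<omega> - 1/2 * (?g x * A x + ?g x * (T * sgn x)) - 1/2 * (?g x * \<sigma> x))"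
      by (simp add: algebra_simps)
    also have "\<dots> = E (\<lambda>x. ?g x * J x \<omega>) - 1/2 * (E (\<lambda>x. ?g x * A x) + E (\<lambda>x. ?g x * (T * sgn x)))
        - 1/2 * E (\<lambda>x. ?g x * \<sigma> x)"
      unfolding E_def
      by (simp only: set_integral_diff(2)[OF set_integral_diff(1)[OF iJ iA2] i\<sigma>2] set_integral_diff(2)[OF iJ iA2]
          set_integral_mult_right set_integral_add(2)[OF iA iS])
    also have "\<dots> = 0" by (rule main)
    finally show ?case unfolding E_def A_def \<sigma>_def b_def .
  qed
qed

end

theorem theorem1:
  fixes M :: "'a measure"
    and B :: "real \<Rightarrow> 'a \<Rightarrow> real"
    and L \<alpha> I :: "real \<Rightarrow> real \<Rightarrow> 'a \<Rightarrow> real"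
  assumes "brownian_motion M B"
    and "local_time M B L"
    and "self_intersection_local_time_deriv M B \<alpha>"
    and "\<And>x t. 0 \<le> t \<Longrightarrow> ito_integral M B (\<lambda>s \<omega>. L s (B s \<omega> - x) \<omega>) t (I x t)"
    and "AE \<omega> in M. continuous_on (UNIV \<times> {0..}) (\<lambda>(x, t). I x t \<omega>)"
  shows "AE \<omega> in M. \<forall>x. \<forall>t\<ge>0.
    1/2 * \<alpha> t x \<omega> + 1/2 * sgn x * t =
      I x t \<omega> - 1/2 * (LBINT u:{0..t}. sgn (B t \<omega> - B u \<omega> - x))"
proof -
  interpret brownian_motion M B by fact
  \<comment> \<open>The right side minus the left, with \<alpha> and \<open>t * sgn x\<close> kept
    together because it is their sum that is continuous across \<open>x = 0\<close>.\<close>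
  define F where "F \<omega> t x = I x t \<omega> - 1/2 * (\<alpha> t x \<omega> + t * sgn x) -
    1/2 * (LBINT u:{0..t}. sgn (B t \<omega> - B u \<omega> - x))" for \<omega> t x
  have I_x: "AE \<omega> in M. continuous_on UNIV (\<lambda>x. I x t \<omega>)" if "0 < t" for t
    using assms(5)
  proof eventually_elim
    case (elim \<omega>)
    have "continuous_on UNIV (\<lambda>x. case (x, t) of (x, t) \<Rightarrow> I x t \<omega>)"
      by (rule continuous_on_compose2[OF elim]) (use that in \<open>auto intro!: continuous_intros\<close>)
    then show ?case by simp
  qed
  \<comment> \<open>Rational times and rational end points leave a single exceptional null
    set.\<close>
  have "AE \<omega> in M. \<forall>t\<in>\<rat>. \<forall>c\<in>\<rat>. \<forall>d\<in>\<rat>. 0 < t \<longrightarrow> c < d \<longrightarrow> (LBINT x:{c..d}. bump c d x * F \<omega> t x) = 0"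
  proof (intro AE_ball_countable[THEN iffD2, OF countable_rat] ballI)
    fix t c d :: real
    show "AE \<omega> in M. 0 < t \<longrightarrow> c < d \<longrightarrow> (LBINT x:{c..d}. bump c d x * F \<omega> t x) = 0"
    proof (cases "0 < t \<and> c < d")
      case True
      then show ?thesis
        using bump_identity[OF assms(2,3) assms(4) I_x, of t c d] unfolding F_def by simp
    qed auto
  qed
  moreover have "AE \<omega> in M. continuous_on ({0..} \<times> UNIV) (\<lambda>(t, y). \<alpha> t y \<omega> + t * sgn y)"
    using assms(3) unfolding self_intersection_local_time_deriv_def by (auto elim: eventually_mono)
  ultimately show ?thesis
    using assms(5) continuous_paths local_time_paths[OF assms(2)]
  proof eventually_elim
    case (elim \<omega>)
    have occ: "(LBINT u:{0..s}. h (B u \<omega>)) = (LBINT y. h y * L s y \<omega>)"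
      if "0 \<le> s" "h \<in> borel_measurable borel" "bounded (range h)" for s h
      using elim(5)[THEN conjunct2, rule_format, OF that] by simp
    have "continuous_on ({0..} \<times> UNIV) (\<lambda>z. case (snd z, fst z) of (x, t) \<Rightarrow> I x t \<omega>)"
      by (rule continuous_on_compose2[OF elim(3)]) (auto intro!: continuous_intros)
    then have "continuous_on ({0..} \<times> UNIV) (\<lambda>(t, x). I x t \<omega>)" by (simp add: case_prod_beta)
    from continuous_on_diff[OF continuous_on_diff[OF this continuous_on_mult_left[OF elim(2), of "1/2"]]
        continuous_on_mult_left[OF continuous_on_sgn_integral[OF elim(4) occ], of "1/2"]]
    have F_cont: "continuous_on ({0..} \<times> UNIV) (\<lambda>(t, x). F \<omega> t x)"
      unfolding F_def case_prod_unfold .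
    have F_x: "continuous_on UNIV (F \<omega> t)" if "0 \<le> t" for t
    proof -
      have "continuous_on UNIV (\<lambda>x. case (t, x) of (t, x) \<Rightarrow> F \<omega> t x)"
        by (rule continuous_on_compose2[OF F_cont]) (use that in \<open>auto intro!: continuous_intros\<close>)
      then show ?thesis by simp
    qed
    have F_t: "continuous_on {0..} (\<lambda>t. F \<omega> t x)" for x
    proof -
      have "continuous_on {0..} (\<lambda>t. case (t, x) of (t, x) \<Rightarrow> F \<omega> t x)"
        by (rule continuous_on_compose2[OF F_cont]) (auto intro!: continuous_intros)
      then show ?thesis by simp
    qed
    have F_rat: "F \<omega> t x = 0" if "t \<in> \<rat>" "0 < t" for t x
    proof (rule continuous_zero_if_bump_integrals_zero[where f = "F \<omega> t"])
      show "continuous_on UNIV (F \<omega> t)" using that by (intro F_x) simp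
      show "(LBINT x:{c..d}. bump c d x * F \<omega> t x) = 0" if "c \<in> \<rat>" "d \<in> \<rat>" "c < d" for c d
        using elim(1)[THEN bspec, OF \<open>t \<in> \<rat>\<close>, THEN bspec, OF that(1), THEN bspec, OF that(2)]
          \<open>0 < t\<close> that(3) by blast
    qed
    have F_zero: "F \<omega> t x = 0" if t: "0 \<le> t" for t x
    proof (rule ccontr)
      assume "F \<omega> t x \<noteq> 0"
      then have pos: "0 < \<bar>F \<omega> t x\<bar>" by simp
      have "t \<in> {0..}" using t by simp
      from F_t[of x, unfolded continuous_on_iff, THEN bspec, OF this, THEN spec, THEN mp, OF pos]
      obtain \<delta> where \<delta>: "0 < \<delta>"
        "\<And>s. s \<in> {0..} \<Longrightarrow> dist s t < \<delta> \<Longrightarrow> dist (F \<omega> s x) (F \<omega> t x) < \<bar>F \<omega> t x\<bar>"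
        by blast
      \<comment> \<open>A rational to the right of \<open>t\<close> is positive even for
        \<open>t = 0\<close>, a time at which no bump identity has been taken.\<close>
      obtain q where q: "q \<in> \<rat>" "t < q" "q < t + \<delta>"
        using Rats_dense_in_real[of t "t + \<delta>"] \<delta>(1) by auto
      then have "dist (F \<omega> q x) (F \<omega> t x) < \<bar>F \<omega> t x\<bar>"
        using t by (intro \<delta>(2)) (auto simp: dist_real_def)
      then show False using F_rat[OF q(1)] q(2) t by (simp add: dist_real_def)
    qed
    show ?case
    proof (intro allI impI)
      fix x t :: real
      assume "0 \<le> t"
      from F_zero[OF this, of x]
      show "1/2 * \<alpha> t x \<omega> + 1/2 * sgn x * t = I x t \<omega> - 1/2 * (LBINT u:{0..t}. sgn (B t \<omega> - B u \<omega> - x))"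
        unfolding F_def by (simp add: algebra_simps)
    qed
  qed
qed

end
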